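(* Fix an integer $l\ge 1$. Let $f=F_{W_l}\circ\cdots\circ F_{W_1}:(\mathbb{R}^d)^n\to\mathbb{R}$ be a random layered network, where for $v=1,\ldots,l$, $F_{W_v}:(\mathbb{R}^{d_{v-1}})^{n_{v-1}}\to(\mathbb{R}^{d_v})^{n_v}$ is a convolutional layer of some width $w_v$ and stride $s_v$ with Xavier weight matrix $W_v$, the matrices $W_1,\ldots,W_l$ are independent, $d_0=d$, $n_0=n$, $d_l=n_l=1$, the activation of layers $1,\ldots,l-1$ is the ReLU $\sigma(x)=\max(x,0)$ and the activation of layer $l$ is the identity. Assume that $d$ and the numbers of channels $d_1,\ldots,d_{l-1}$ are all $\omega(\log(nd))$. Fix $R>0$, $\vec{\mathbf{x}}_0\in\left(R\cdot\mathbb{S}^{d-1}\right)^n$ and $\tau>0$. Then, with probability at least $(1-o_d(1))\left(1-2e^{-\Omega(\tau^2/\log^2(d))}\right)$ over the choice of $f$, either $f(\vec{\mathbf{x}}_0)=0$ or there is $\vec{\mathbf{x}}\in(\mathbb{R}^d)^n$ such that \[ \|\vec{\mathbf{x}}-\vec{\mathbf{x}}_0\|\le\left(\frac{\tau}{\sqrt{d-2}}\cdot\frac{\|\vec{\mathbf{x}}_0\|_\mathrm{sp}}{\|\vec{\mathbf{x}}_0\|}\right)\cdot\|\vec{\mathbf{x}}_0\| \] and $\mathrm{sign}(f(\vec{\mathbf{x}}))\ne\mathrm{sign}(f(\vec{\mathbf{x}}_0))$. The asymptotic notations ($o_d(1)$ as $d\to\infty$, and the constant in $\Omega$) depend only on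 the depth $l$.
   Context: Norms: $\|\cdot\|$ is the Euclidean norm on $(\mathbb{R}^d)^n\cong\mathbb{R}^{dn}$; for $\vec{\mathbf{x}}=(\mathbf{x}_1,\ldots,\mathbf{x}_n)$, $\|\vec{\mathbf{x}}\|_\mathrm{sp}$ is the spectral norm of the $d\times n$ matrix with columns $\mathbf{x}_i$. $\mathbb{S}^{d-1}$ is the unit sphere in $\mathbb{R}^d$. A convolutional layer of width $w$, stride $s$ (with $s$ dividing $n'-w$), input $(\mathbb{R}^{d_1})^{n'}$ and $d_2\times(d_1w)$ weight matrix $W$ is the map $F_W(\vec{\mathbf{x}})=\left(\sigma(WT_{0}(\vec{\mathbf{x}})),\ldots,\sigma(WT_{\frac{n'-w}{s}}(\vec{\mathbf{x}}))\right)\in(\mathbb{R}^{d_2})^{\frac{n'-w}{s}+1}$, where $T_i(\vec{\mathbf{x}})=(\mathbf{x}_{is+1},\ldots,\mathbf{x}_{is+w})\in\mathbb{R}^{d_1w}$ and $\sigma$ is applied coordinatewise. $W$ is Xavier if its entries are i.i.d. centered Gaussians with variance $\frac{1}{d_1w}$. *)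

theory Defs
  imports "HOL-Probability.Probability"
begin

text \<open>Inputs \<open>(R^d)^n\<close> are represented as \<open>x :: nat \<Rightarrow> nat \<Rightarrow> real\<close>,
 where \<open>x j k\<close> is coordinate \<open>k < d\<close> of token \<open>j < n\<close> (0-based).
 A weight matrix of size \<open>d2 \<times> (d1 w)\<close> is \<open>W :: nat \<Rightarrow> nat \<Rightarrow> real\<close>, \<open>W r c\<close>.
 The window \<open>T_i(x)\<close> is concatenated token by token: its coordinate \<open>p*d1 + k\<close>
 is coordinate \<open>k\<close> of token \<open>i*s + p\<close>.\<close>

definition relu :: "real \<Rightarrow> real" where
  "relu x = max x 0"

definition conv_layer ::
  "(real \<Rightarrow> real) \<Rightarrow> nat \<Rightarrow> nat \<Rightarrow> nat \<Rightarrow> (nat \<Rightarrow> nat \<Rightarrow> real) \<Rightarrow> (nat \<Rightarrow> nat \<Rightarrow> real) \<Rightarrow> (nat \<Rightarrow> nat \<Rightarrow> real)" where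
  "conv_layer \<sigma> din w s W x =
     (\<lambda>i r. \<sigma> (\<Sum>p<w. \<Sum>k<din. W r (p * din + k) * x (i * s + p) k))"

fun net_layers ::
  "nat \<Rightarrow> (nat \<Rightarrow> nat) \<Rightarrow> (nat \<Rightarrow> nat) \<Rightarrow> (nat \<Rightarrow> nat) \<Rightarrow> (nat \<Rightarrow> nat \<Rightarrow> nat \<Rightarrow> real)
     \<Rightarrow> nat \<Rightarrow> (nat \<Rightarrow> nat \<Rightarrow> real) \<Rightarrow> (nat \<Rightarrow> nat \<Rightarrow> real)" where
  "net_layers l dims ws ss W 0 x = x"
| "net_layers l dims ws ss W (Suc k) x =
     conv_layer (if Suc k = l then id else relu) (dims k) (ws (Suc k)) (ss (Suc k)) (W (Suc k))
       (net_layers l dims ws ss W k x)"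

definition net_output ::
  "nat \<Rightarrow> (nat \<Rightarrow> nat) \<Rightarrow> (nat \<Rightarrow> nat) \<Rightarrow> (nat \<Rightarrow> nat) \<Rightarrow> (nat \<Rightarrow> nat \<Rightarrow> nat \<Rightarrow> real)
     \<Rightarrow> (nat \<Rightarrow> nat \<Rightarrow> real) \<Rightarrow> real" where
  "net_output l dims ws ss W x = net_layers l dims ws ss W l x 0 0"

definition conv_arch ::
  "nat \<Rightarrow> (nat \<Rightarrow> nat) \<Rightarrow> (nat \<Rightarrow> nat) \<Rightarrow> (nat \<Rightarrow> nat) \<Rightarrow> (nat \<Rightarrow> nat) \<Rightarrow> bool" where
  "conv_arch l dims ns ws ss \<longleftrightarrow>
     (\<forall>v\<le>l. 0 < dims v \<and> 0 < ns v) \<and> dims l = 1 \<and> ns l = 1 \<and>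
     (\<forall>v. 1 \<le> v \<and> v \<le> l \<longrightarrow>
        1 \<le> ws v \<and> 1 \<le> ss v \<and> ws v \<le> ns (v - 1) \<and>
        ss v dvd (ns (v - 1) - ws v) \<and>
        ns v = (ns (v - 1) - ws v) div ss v + 1)"

definition weight_index :: "nat \<Rightarrow> (nat \<Rightarrow> nat) \<Rightarrow> (nat \<Rightarrow> nat) \<Rightarrow> (nat \<times> nat \<times> nat) set" where
  "weight_index l dims ws =
     {(v, r, c). 1 \<le> v \<and> v \<le> l \<and> r < dims v \<and> c < dims (v - 1) * ws v}"

definition xavier_measure ::
  "nat \<Rightarrow> (nat \<Rightarrow> nat) \<Rightarrow> (nat \<Rightarrow> nat) \<Rightarrow> ((nat \<times> nat \<times> nat) \<Rightarrow> real) measure" where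
  "xavier_measure l dims ws =
     PiM (weight_index l dims ws)
       (\<lambda>(v, r, c). density lborel (normal_density 0 (sqrt (1 / real (dims (v - 1) * ws v)))))"

definition weights_of :: "((nat \<times> nat \<times> nat) \<Rightarrow> real) \<Rightarrow> nat \<Rightarrow> nat \<Rightarrow> nat \<Rightarrow> real" where
  "weights_of \<omega> = (\<lambda>v r c. \<omega> (v, r, c))"

definition tnorm :: "nat \<Rightarrow> nat \<Rightarrow> (nat \<Rightarrow> nat \<Rightarrow> real) \<Rightarrow> real" where
  "tnorm n d x = sqrt (\<Sum>j<n. \<Sum>k<d. (x j k)\<^sup>2)"

definition spnorm :: "nat \<Rightarrow> nat \<Rightarrow> (nat \<Rightarrow> nat \<Rightarrow> real) \<Rightarrow> real" where
  "spnorm n d x =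
     Sup {sqrt (\<Sum>k<d. (\<Sum>j<n. u j * x j k)\<^sup>2) | u. (\<Sum>j<n. (u j)\<^sup>2) = 1}"

end

theory Submission
  imports Defs
begin

text \<open>
  Rotating all tokens by the same orthogonal matrix \<open>O\<close> can be absorbed into the first weight matrix,
  whose law is invariant. Let \<open>O = cos \<theta> + sin \<theta> A\<close> with a random isotropic skew matrix \<open>A\<close>. Along the
  path \<open>\<theta> \<in> [0, \<pi>/2]\<close> the rotated network stays independent of \<open>A\<close>, so by isotropy the distance from
  \<open>O x\<^sub>0\<close> to the set where the output has a given sign changes by only \<open>O(\<parallel>x\<^sub>0\<parallel>\<^sub>s\<^sub>p / \<surd>d)\<close> in mean
  square. For \<open>m\<close> such rotations the rotated inputs are nearly orthogonal, and the covariance matrix of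
  the \<open>m\<close> outputs, given the hidden layers, stays bounded below because a ReLU layer loses at most a
  factor 4. So with probability close to 1 both signs occur among the \<open>m\<close> outputs, and then \<open>x\<^sub>0\<close>
  itself is within distance of order \<open>log d \<parallel>x\<^sub>0\<parallel>\<^sub>s\<^sub>p / \<surd>d\<close> of both signs. For \<open>\<tau> < log d\<close> the
  claimed probability is not positive.
\<close>

section \<open>Gaussian product measures\<close>

text \<open>Neither the ReLU nor a distance function is differentiable, so only a one-sided
  expansion is used: the distance from a rotated input is compared with a point \<open>y\<close>
  that was almost optimal before the rotation. The first-order term is then the inner product of
  \<open>A x\<close> with a direction fixed by the weights before \<open>A\<close> is drawn, which
  is what lets isotropy act. For one large rotation the second-order error is not small; over
  \<open>N\<close> equal steps along a path it is of order \<open>1 / N^2\<close> and vanishes in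
  the limit. The random matrix \<open>A\<close> is a finite average over \<open>d\<close> pairings
  and \<open>2 ^ d\<close> sign patterns. Good rotations are picked from this average once and for
  all, so the \<open>m\<close> inputs are deterministic and only the weights stay random.
  \<open>m\<close> and the other parameters are chosen from the allowed failure probability and
  \<open>l\<close> alone, before \<open>d\<close> grows. This is why Chebyshev, union bounds and
  losses such as \<open>3 ^ l\<close> and \<open>4 ^ l\<close> suffice. Sign events constrain an
  output that is Gaussian given the hidden layers; no lower bound on a single output is needed, only
  that many nearly uncorrelated outputs do not all share a sign.\<close>

definition gauss :: "real \<Rightarrow> real measure" where
  "gauss s = density lborel (normal_density 0 s)"

lemma sets_gauss [simp, measurable_cong]: "sets (gauss s) = sets borel"
  by (simp add: gauss_def)

lemma space_gauss [simp]: "space (gauss s) = UNIV"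
  by (simp add: gauss_def)

lemma nn_integral_gauss:
  "f \<in> borel_measurable borel \<Longrightarrow>
    (\<integral>\<^sup>+x. f x \<partial>gauss s) = (\<integral>\<^sup>+x. ennreal (normal_density 0 s x) * f x \<partial>lborel)"
  unfolding gauss_def by (subst nn_integral_density) auto

lemma prob_space_gauss: "0 < s \<Longrightarrow> prob_space (gauss s)"
  unfolding gauss_def by (rule prob_space_normal_density)

section \<open>Invariance of Gaussian products under plane rotations\<close>

text \<open>A rotation is factored into two one-dimensional affine substitutions. The first makes
  \<open>c * x - s * y\<close> the new variable and costs \<open>1 / \<bar>c\<bar>\<close>; after
  exchanging the integrals, the second absorbs exactly this factor. Dividing by \<open>c\<close>
  excludes the right angle.\<close>

lemma nn_integral_lborel_rotation:
  fixes G :: "real \<Rightarrow> real \<Rightarrow> ennreal"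
  assumes G [measurable]: "(\<lambda>(x, y). G x y) \<in> borel_measurable (borel \<Otimes>\<^sub>M borel)"
    and cs: "c\<^sup>2 + s\<^sup>2 = 1" "c \<noteq> 0"
  shows "(\<integral>\<^sup>+y. \<integral>\<^sup>+x. G (c * x - s * y) (s * x + c * y) \<partial>lborel \<partial>lborel)
    = (\<integral>\<^sup>+y. \<integral>\<^sup>+x. G x y \<partial>lborel \<partial>lborel)"
proof -
  have [measurable]: "(\<lambda>x. G (f x) (g x)) \<in> borel_measurable N"
    if "f \<in> borel_measurable N" "g \<in> borel_measurable N" for f g and N :: "'z measure"
    using measurable_compose[OF measurable_Pair[OF that] G] by simp
  have inner: "(\<integral>\<^sup>+x. G (c * x - s * y) (s * x + c * y) \<partial>lborel)
      = ennreal (1 / \<bar>c\<bar>) * (\<integral>\<^sup>+x. G x (s / c * x + 1 / c * y) \<partial>lborel)" for y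
  proof -
    have "(\<integral>\<^sup>+x. G (c * x - s * y) (s * x + c * y) \<partial>lborel)
       = \<bar>1 / c\<bar> * (\<integral>\<^sup>+x. G (c * (s * y / c + 1 / c * x) - s * y)
            (s * (s * y / c + 1 / c * x) + c * y) \<partial>lborel)"
      using cs by (intro nn_integral_real_affine) auto
    also have "(\<lambda>x. G (c * (s * y / c + 1 / c * x) - s * y) (s * (s * y / c + 1 / c * x) + c * y))
        = (\<lambda>x. G x (s / c * x + 1 / c * y))"
    proof
      fix x
      have "c * (s * y / c + 1 / c * x) - s * y = x"
        using cs by (simp add: field_simps)
      moreover have "s * (s * y / c + 1 / c * x) + c * y = s / c * x + (c\<^sup>2 + s\<^sup>2) / c * y"
        using cs(2) by (simp add: field_simps power2_eq_square)
      ultimately show "G (c * (s * y / c + 1 / c * x) - s * y) (s * (s * y / c + 1 / c * x) + c * y)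
        = G x (s / c * x + 1 / c * y)"
        using cs by simp
    qed
    finally show ?thesis by (simp add: abs_divide)
  qed
  have "(\<integral>\<^sup>+y. \<integral>\<^sup>+x. G (c * x - s * y) (s * x + c * y) \<partial>lborel \<partial>lborel)
     = ennreal (1 / \<bar>c\<bar>) * (\<integral>\<^sup>+y. \<integral>\<^sup>+x. G x (s / c * x + 1 / c * y) \<partial>lborel \<partial>lborel)"
    unfolding inner by (rule nn_integral_cmult) measurable
  also have "(\<integral>\<^sup>+y. \<integral>\<^sup>+x. G x (s / c * x + 1 / c * y) \<partial>lborel \<partial>lborel)
     = (\<integral>\<^sup>+x. \<integral>\<^sup>+y. G x (s / c * x + 1 / c * y) \<partial>lborel \<partial>lborel)"
    by (rule lborel_pair.Fubini') measurable
  also have "ennreal (1 / \<bar>c\<bar>) * \<dots> = (\<integral>\<^sup>+x. ennreal (1 / \<bar>c\<bar>) * (\<integral>\<^sup>+y. G x (s / c * x + 1 / c * y) \<partial>lborel) \<partial>lborel)"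
    by (rule nn_integral_cmult[symmetric]) measurable
  also have "\<dots> = (\<integral>\<^sup>+x. \<integral>\<^sup>+y. G x y \<partial>lborel \<partial>lborel)"
  proof (rule nn_integral_cong)
    fix x
    have "(\<integral>\<^sup>+y. G x y \<partial>lborel) = \<bar>1 / c\<bar> * (\<integral>\<^sup>+y. G x (s / c * x + 1 / c * y) \<partial>lborel)"
      using cs by (intro nn_integral_real_affine) auto
    then show "ennreal (1 / \<bar>c\<bar>) * (\<integral>\<^sup>+y. G x (s / c * x + 1 / c * y) \<partial>lborel) = (\<integral>\<^sup>+y. G x y \<partial>lborel)"
      by (simp add: abs_divide)
  qed
  also have "\<dots> = (\<integral>\<^sup>+y. \<integral>\<^sup>+x. G x y \<partial>lborel \<partial>lborel)"
    by (rule lborel_pair.Fubini') measurable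
  finally show ?thesis .
qed

lemma normal_density_rotation:
  assumes "c\<^sup>2 + s\<^sup>2 = 1"
  shows "normal_density 0 t (c * x - s * y) * normal_density 0 t (s * x + c * y)
       = normal_density 0 t x * normal_density 0 t y"
proof -
  have e: "(c * x - s * y)\<^sup>2 + (s * x + c * y)\<^sup>2 = x\<^sup>2 + y\<^sup>2"
  proof -
    have "(c * x - s * y)\<^sup>2 + (s * x + c * y)\<^sup>2 = (c\<^sup>2 + s\<^sup>2) * (x\<^sup>2 + y\<^sup>2)"
      by (simp add: power2_eq_square algebra_simps)
    with assms show ?thesis by simp
  qed
  have *: "exp (- a / k) * exp (- b / k) = exp (- (a + b) / k)" for a b k :: real
    by (simp add: exp_add[symmetric] diff_divide_distrib)
  have **: "normal_density 0 t a * normal_density 0 t b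
      = (1 / sqrt (2 * pi * t\<^sup>2))\<^sup>2 * exp (- (a\<^sup>2 + b\<^sup>2) / (2 * t\<^sup>2))" for a b
    unfolding normal_density_def *[symmetric] by (simp add: power2_eq_square)
  show ?thesis unfolding ** e ..
qed

lemma nn_integral_gauss_rotation:
  fixes G :: "real \<Rightarrow> real \<Rightarrow> ennreal"
  assumes G [measurable]: "(\<lambda>(x, y). G x y) \<in> borel_measurable (borel \<Otimes>\<^sub>M borel)"
    and cs: "c\<^sup>2 + s\<^sup>2 = 1" "c \<noteq> 0"
  shows "(\<integral>\<^sup>+y. \<integral>\<^sup>+x. G (c * x - s * y) (s * x + c * y) \<partial>gauss t \<partial>gauss t)
    = (\<integral>\<^sup>+y. \<integral>\<^sup>+x. G x y \<partial>gauss t \<partial>gauss t)"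
proof -
  have GM [measurable]: "(\<lambda>x. G (f x) (g x)) \<in> borel_measurable N"
    if "f \<in> borel_measurable N" "g \<in> borel_measurable N" for f g and N :: "'z measure"
    using measurable_compose[OF measurable_Pair[OF that] G] by simp
  let ?n = "normal_density 0 t"
  let ?H = "\<lambda>x y. ennreal (?n x * ?n y) * G x y"
  have red: "(\<integral>\<^sup>+y. \<integral>\<^sup>+x. F x y \<partial>gauss t \<partial>gauss t)
    = (\<integral>\<^sup>+y. \<integral>\<^sup>+x. ennreal (?n x * ?n y) * F x y \<partial>lborel \<partial>lborel)"
    if F [measurable]: "(\<lambda>(x, y). F x y) \<in> borel_measurable (borel \<Otimes>\<^sub>M borel)" for F
  proof -
    have [measurable]: "(\<lambda>x. F (f x) (g x)) \<in> borel_measurable N"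
      if "f \<in> borel_measurable N" "g \<in> borel_measurable N" for f g and N :: "'z measure"
      using measurable_compose[OF measurable_Pair[OF that] F] by simp
    have "(\<integral>\<^sup>+y. \<integral>\<^sup>+x. F x y \<partial>gauss t \<partial>gauss t)
      = (\<integral>\<^sup>+y. ennreal (?n y) * (\<integral>\<^sup>+x. ennreal (?n x) * F x y \<partial>lborel) \<partial>lborel)"
      by (simp add: nn_integral_gauss)
    also have "\<dots> = (\<integral>\<^sup>+y. \<integral>\<^sup>+x. ennreal (?n x * ?n y) * F x y \<partial>lborel \<partial>lborel)"
      by (subst nn_integral_cmult[symmetric]) (auto simp: ennreal_mult mult_ac intro!: nn_integral_cong)
    finally show ?thesis .
  qed
  have "(\<integral>\<^sup>+y. \<integral>\<^sup>+x. G (c * x - s * y) (s * x + c * y) \<partial>gauss t \<partial>gauss t)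
    = (\<integral>\<^sup>+y. \<integral>\<^sup>+x. ?H (c * x - s * y) (s * x + c * y) \<partial>lborel \<partial>lborel)"
    by (subst red) (auto simp: normal_density_rotation[OF cs(1)])
  also have "\<dots> = (\<integral>\<^sup>+y. \<integral>\<^sup>+x. ?H x y \<partial>lborel \<partial>lborel)"
    by (rule nn_integral_lborel_rotation[OF _ cs]) auto
  also have "\<dots> = (\<integral>\<^sup>+y. \<integral>\<^sup>+x. G x y \<partial>gauss t \<partial>gauss t)"
    by (rule red[symmetric]) auto
  finally show ?thesis .
qed

text \<open>Positivity is required at every index, also off \<open>I\<close>, because the product
  locale interpreted next wants a probability space at each index.\<close>

locale gaussian_family =
  fixes sd :: "'i \<Rightarrow> real" and I :: "'i set"
  assumes sd_pos: "\<And>i. 0 < sd i" and finite_I: "finite I"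
begin

sublocale finite_product_prob_space "\<lambda>i. gauss (sd i)" I
proof -
  interpret P: prob_space "gauss (sd i)" for i
    by (rule prob_space_gauss[OF sd_pos])
  show "finite_product_prob_space (\<lambda>i. gauss (sd i)) I"
    by standard (simp_all add: finite_I)
qed

abbreviation PG :: "('i \<Rightarrow> real) measure" where
  "PG \<equiv> PiM I (\<lambda>i. gauss (sd i))"

definition givens :: "'i \<Rightarrow> 'i \<Rightarrow> real \<Rightarrow> real \<Rightarrow> ('i \<Rightarrow> real) \<Rightarrow> ('i \<Rightarrow> real)" where
  "givens i j c s w = w(i := c * w i - s * w j, j := s * w i + c * w j)"

lemma measurable_givens [measurable]:
  assumes "i \<in> I" "j \<in> I"
  shows "givens i j c s \<in> measurable PG PG"
proof (rule measurable_PiM_single')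
  fix k assume "k \<in> I"
  then show "(\<lambda>w. givens i j c s w k) \<in> PG \<rightarrow>\<^sub>M gauss (sd k)"
    using assms by (cases "k = i"; cases "k = j") (simp_all add: givens_def)
next
  show "givens i j c s \<in> space PG \<rightarrow> (\<Pi>\<^sub>E i\<in>I. space (gauss (sd i)))"
    using assms by (auto simp: givens_def space_PiM PiE_iff extensional_def)
qed

text \<open>With the coordinates \<open>i\<close> and \<open>j\<close> integrated innermost, the
  remaining double integral is the planar case.\<close>

lemma distr_givens:
  assumes ij: "i \<in> I" "j \<in> I" "i \<noteq> j" "sd i = sd j" and cs: "c\<^sup>2 + s\<^sup>2 = 1" "c \<noteq> 0"
  shows "distr PG PG (givens i j c s) = PG"
proof -
  define I' where "I' = I - {i, j}"
  have I': "I = insert i (insert j I')" "finite I'" "j \<notin> I'" "i \<notin> insert j I'"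
    using ij finite_I by (auto simp: I'_def)
  interpret product_sigma_finite "\<lambda>i. gauss (sd i)" by standard
  \<comment> \<open>Both inner integrals can use \<open>gauss (sd j)\<close> because the two
    deviations agree; this equality is what makes the planar law rotation invariant.\<close>
  have expand: "(\<integral>\<^sup>+w. F w \<partial>PG) =
      (\<integral>\<^sup>+w. \<integral>\<^sup>+y. \<integral>\<^sup>+x. F (w(j := y, i := x)) \<partial>gauss (sd j) \<partial>gauss (sd j) \<partial>PiM I' (\<lambda>i. gauss (sd i)))"
    if F [measurable]: "F \<in> borel_measurable PG" for F
  proof -
    have Fm: "F \<in> borel_measurable (Pi\<^sub>M (insert i (insert j I')) (\<lambda>i. gauss (sd i)))"
      using F I'(1) by simp
    have "(\<integral>\<^sup>+w. F w \<partial>PG) = (\<integral>\<^sup>+w. \<integral>\<^sup>+x. F (w(i := x)) \<partial>gauss (sd j)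
        \<partial>PiM (insert j I') (\<lambda>i. gauss (sd i)))"
      unfolding I'(1) using I' Fm ij by (subst product_nn_integral_insert) auto
    also have "\<dots> = (\<integral>\<^sup>+w. \<integral>\<^sup>+y. \<integral>\<^sup>+x. F (w(j := y, i := x)) \<partial>gauss (sd j) \<partial>gauss (sd j) \<partial>PiM I' (\<lambda>i. gauss (sd i)))"
    proof (subst product_nn_integral_insert)
      have "(\<lambda>p. F ((fst p)(i := snd p))) \<in> borel_measurable
        (PiM (insert j I') (\<lambda>i. gauss (sd i)) \<Otimes>\<^sub>M gauss (sd j))"
      proof (rule measurable_compose[OF _ Fm])
        show "(\<lambda>p. (fst p)(i := snd p)) \<in> PiM (insert j I') (\<lambda>i. gauss (sd i)) \<Otimes>\<^sub>M gauss (sd j) \<rightarrow>\<^sub>M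
           Pi\<^sub>M (insert i (insert j I')) (\<lambda>i. gauss (sd i))"
          by (rule measurable_fun_upd[where J="insert j I'"]) (auto simp: ij(4))
      qed
      from sigma_finite_measure.borel_measurable_nn_integral_fst[OF _ this]
      show "(\<lambda>w. \<integral>\<^sup>+x. F (w(i := x)) \<partial>gauss (sd j)) \<in> borel_measurable (PiM (insert j I') (\<lambda>i. gauss (sd i)))"
        by (simp add: sigma_finite_measures)
    qed (use I' in auto)
    finally show ?thesis .
  qed
  show ?thesis
  proof (rule measure_eqI)
    fix A assume "A \<in> sets (distr PG PG (givens i j c s))"
    then have A [measurable]: "A \<in> sets PG" by simp
    note [measurable] = measurable_givens[OF ij(1,2)]
    have "emeasure (distr PG PG (givens i j c s)) A = (\<integral>\<^sup>+w. indicator A w \<partial>distr PG PG (givens i j c s))"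
      by (subst nn_integral_indicator) auto
    also have "\<dots> = (\<integral>\<^sup>+w. indicator A (givens i j c s w) \<partial>PG)"
      by (subst nn_integral_distr) auto
    also have "\<dots> = (\<integral>\<^sup>+w. \<integral>\<^sup>+y. \<integral>\<^sup>+x. indicator A (givens i j c s (w(j := y, i := x))) \<partial>gauss (sd j) \<partial>gauss (sd j) \<partial>PiM I' (\<lambda>i. gauss (sd i)))"
      by (rule expand) measurable
    also have "\<dots> = (\<integral>\<^sup>+w. \<integral>\<^sup>+y. \<integral>\<^sup>+x. indicator A (w(j := y, i := x)) \<partial>gauss (sd j) \<partial>gauss (sd j) \<partial>PiM I' (\<lambda>i. gauss (sd i)))"
    proof (rule nn_integral_cong)
      fix w assume w: "w \<in> space (PiM I' (\<lambda>i. gauss (sd i)))"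
      let ?G = "\<lambda>x y. indicator A (w(j := y, i := x)) :: ennreal"
      have gi: "givens i j c s (w(j := y, i := x)) = w(j := s * x + c * y, i := c * x - s * y)" for x y
        using ij(3) by (auto simp: givens_def fun_eq_iff)
      have "(\<lambda>(x, y). w(j := y, i := x)) \<in> measurable (borel \<Otimes>\<^sub>M borel) PG"
      proof (rule measurable_PiM_single')
        fix k assume "k \<in> I"
        then show "(\<lambda>p. (case p of (x, y) \<Rightarrow> w(j := y, i := x)) k) \<in> borel \<Otimes>\<^sub>M borel \<rightarrow>\<^sub>M gauss (sd k)"
          by (cases "k = i"; cases "k = j") (auto simp: case_prod_beta)
      next
        show "(\<lambda>(x, y). w(j := y, i := x)) \<in> space (borel \<Otimes>\<^sub>M borel) \<rightarrow> (\<Pi>\<^sub>E i\<in>I. space (gauss (sd i)))"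
          using w I'(1) by (auto simp: space_PiM PiE_iff extensional_def)
      qed
      then have "(\<lambda>(x, y). ?G x y) \<in> borel_measurable (borel \<Otimes>\<^sub>M borel)"
        by (simp add: case_prod_beta)
      from nn_integral_gauss_rotation[OF this cs]
      show "(\<integral>\<^sup>+y. \<integral>\<^sup>+x. indicator A (givens i j c s (w(j := y, i := x))) \<partial>gauss (sd j) \<partial>gauss (sd j))
        = (\<integral>\<^sup>+y. \<integral>\<^sup>+x. ?G x y \<partial>gauss (sd j) \<partial>gauss (sd j))"
        unfolding gi .
    qed
    also have "\<dots> = (\<integral>\<^sup>+w. indicator A w \<partial>PG)"
      by (rule expand[symmetric]) measurable
    finally show "emeasure (distr PG PG (givens i j c s)) A = emeasure PG A" by simp
  qed simp
qed

end

text \<open>Cameron-Martin formula in dimension one: translate Lebesgue measure, then complete the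
  square in the density.\<close>

lemma nn_integral_gauss_shift:
  assumes "0 < s" and [measurable]: "f \<in> borel_measurable borel"
  shows "(\<integral>\<^sup>+x. f (x + u) \<partial>gauss s) = (\<integral>\<^sup>+x. ennreal (exp (x * u / s\<^sup>2 - u\<^sup>2 / (2 * s\<^sup>2))) * f x \<partial>gauss s)"
proof -
  have "(\<integral>\<^sup>+x. f (x + u) \<partial>gauss s) = (\<integral>\<^sup>+x. ennreal (normal_density 0 s x) * f (x + u) \<partial>lborel)"
    by (rule nn_integral_gauss) measurable
  also have "\<dots> = (\<integral>\<^sup>+x. ennreal (normal_density 0 s (x - u)) * f x \<partial>lborel)"
    by (subst nn_integral_real_affine[where c=1 and t="-u"]) auto
  also have "\<dots> = (\<integral>\<^sup>+x. ennreal (normal_density 0 s x) *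
      (ennreal (exp (x * u / s\<^sup>2 - u\<^sup>2 / (2 * s\<^sup>2))) * f x) \<partial>lborel)"
  proof (rule nn_integral_cong)
    fix x
    have "normal_density 0 s (x - u) = normal_density 0 s x * exp (x * u / s\<^sup>2 - u\<^sup>2 / (2 * s\<^sup>2))"
    proof -
      have "- (x - u)\<^sup>2 / (2 * s\<^sup>2) = - x\<^sup>2 / (2 * s\<^sup>2) + (x * u / s\<^sup>2 - u\<^sup>2 / (2 * s\<^sup>2))"
        using assms(1) by (simp add: field_simps power2_eq_square)
      then show ?thesis
        unfolding normal_density_def by (simp only: diff_0_right exp_add mult.assoc)
    qed
    then show "ennreal (normal_density 0 s (x - u)) * f x = ennreal (normal_density 0 s x) *
      (ennreal (exp (x * u / s\<^sup>2 - u\<^sup>2 / (2 * s\<^sup>2))) * f x)"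
      by (simp add: ennreal_mult mult.assoc)
  qed
  also have "\<dots> = (\<integral>\<^sup>+x. ennreal (exp (x * u / s\<^sup>2 - u\<^sup>2 / (2 * s\<^sup>2))) * f x \<partial>gauss s)"
    by (rule nn_integral_gauss[symmetric]) measurable
  finally show ?thesis .
qed

lemma nn_integral_gauss_exp:
  assumes "0 < s"
  shows "(\<integral>\<^sup>+x. ennreal (exp (x * u / s\<^sup>2 - u\<^sup>2 / (2 * s\<^sup>2))) \<partial>gauss s) = 1"
  using nn_integral_gauss_shift[OF assms, of "\<lambda>_. 1" u] prob_space.emeasure_space_1[OF prob_space_gauss[OF assms]]
  by simp

lemma distr_gauss_uminus: "distr (gauss s) (gauss s) uminus = gauss s"
proof (rule measure_eqI)
  fix A assume "A \<in> sets (distr (gauss s) (gauss s) uminus)"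
  then have [measurable]: "A \<in> sets borel" by simp
  have "emeasure (distr (gauss s) (gauss s) uminus) A = (\<integral>\<^sup>+x. indicator A x \<partial>distr (gauss s) (gauss s) uminus)"
    by (subst nn_integral_indicator) auto
  also have "\<dots> = (\<integral>\<^sup>+x. indicator A (- x) \<partial>gauss s)"
    by (subst nn_integral_distr) auto
  also have "\<dots> = (\<integral>\<^sup>+x. ennreal (normal_density 0 s x) * indicator A (- x) \<partial>lborel)"
    by (rule nn_integral_gauss) measurable
  also have "\<dots> = (\<integral>\<^sup>+x. ennreal (normal_density 0 s x) * indicator A x \<partial>lborel)"
    by (subst nn_integral_real_affine[where c="-1" and t="0"]) (auto simp: normal_density_def)
  also have "\<dots> = (\<integral>\<^sup>+x. indicator A x \<partial>gauss s)"
    by (rule nn_integral_gauss[symmetric]) measurable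
  finally show "emeasure (distr (gauss s) (gauss s) uminus) A = emeasure (gauss s) A"
    by simp
qed simp

section \<open>Simultaneous rotation of paired coordinates\<close>

context gaussian_family
begin

text \<open>The sign \<open>s\<close> orients the pairs \<open>{i, \<tau> i}\<close>: if it is
  antisymmetric under \<open>\<tau>\<close>, every pair is rotated by \<open>\<theta>\<close> in its
  own plane.\<close>

definition pairrot :: "'i set \<Rightarrow> ('i \<Rightarrow> 'i) \<Rightarrow> ('i \<Rightarrow> real) \<Rightarrow> real \<Rightarrow> ('i \<Rightarrow> real) \<Rightarrow> ('i \<Rightarrow> real)" where
  "pairrot J \<tau> s \<theta> w = (\<lambda>i. if i \<in> J then cos \<theta> * w i + sin \<theta> * s i * w (\<tau> i) else w i)"

lemma measurable_pairrot [measurable]: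
  assumes "J \<subseteq> I" "\<And>i. i \<in> J \<Longrightarrow> \<tau> i \<in> J"
  shows "pairrot J \<tau> s \<theta> \<in> measurable PG PG"
proof (rule measurable_PiM_single')
  fix k assume "k \<in> I"
  moreover have "\<tau> k \<in> I" if "k \<in> J" using that assms by auto
  ultimately show "(\<lambda>w. pairrot J \<tau> s \<theta> w k) \<in> PG \<rightarrow>\<^sub>M gauss (sd k)"
    by (cases "k \<in> J") (simp_all add: pairrot_def)
next
  show "pairrot J \<tau> s \<theta> \<in> space PG \<rightarrow> (\<Pi>\<^sub>E i\<in>I. space (gauss (sd i)))"
    using assms by (auto simp: pairrot_def space_PiM PiE_iff extensional_def)
qed

text \<open>The planes of different pairs are disjoint, so the map is a composition of Givens
  rotations, one for each pair. Antisymmetry of \<open>s\<close> excludes fixed points of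
  \<open>\<tau>\<close> on \<open>J\<close>.\<close>

lemma distr_pairrot:
  assumes J: "J \<subseteq> I"
    and \<tau>: "\<And>i. i \<in> J \<Longrightarrow> \<tau> i \<in> J" "\<And>i. i \<in> J \<Longrightarrow> \<tau> (\<tau> i) = i"
    and sd: "\<And>i. i \<in> J \<Longrightarrow> sd (\<tau> i) = sd i"
    and s: "\<And>i. i \<in> J \<Longrightarrow> s i = 1 \<or> s i = -1" "\<And>i. i \<in> J \<Longrightarrow> s (\<tau> i) = - s i"
    and c: "cos \<theta> \<noteq> 0"
  shows "distr PG PG (pairrot J \<tau> s \<theta>) = PG"
proof -
  \<comment> \<open>One representative of each pair, the element with sign 1.\<close>
  define R where "R = {i \<in> J. s i = 1}"
  have "finite R" using finite_subset[OF J finite_I] by (simp add: R_def)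
  have ne: "\<tau> i \<noteq> i" if "i \<in> J" for i
    using s(1)[OF that] s(2)[OF that] by auto
  have "distr PG PG (pairrot (R' \<union> \<tau> ` R') \<tau> s \<theta>) = PG" if "R' \<subseteq> R" for R'
    using finite_subset[OF that \<open>finite R\<close>] that
  proof (induction R')
    case empty
    have "pairrot ({} \<union> \<tau> ` {}) \<tau> s \<theta> = (\<lambda>w. w)"
      by (auto simp: pairrot_def)
    then show ?case by (simp add: distr_id[unfolded id_def])
  next
    case (insert i R')
    have iJ: "i \<in> J" "s i = 1" "s (\<tau> i) = -1" "\<tau> i \<in> J" "\<tau> (\<tau> i) = i" "\<tau> i \<noteq> i" "sd i = sd (\<tau> i)"
      using insert.prems \<tau> s sd ne by (auto simp: R_def)
    have nR: "i \<notin> R' \<union> \<tau> ` R'" "\<tau> i \<notin> R' \<union> \<tau> ` R'"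
    proof -
      have "i \<noteq> \<tau> j" if "j \<in> R'" for j
        using that insert.prems s(2)[of j] iJ by (auto simp: R_def)
      moreover have "\<tau> i \<noteq> j" if "j \<in> R'" for j
        using that insert.prems iJ by (auto simp: R_def)
      moreover have "\<tau> i \<noteq> \<tau> j" if "j \<in> R'" for j
        using that insert.prems insert.hyps \<tau>(2)[of j] iJ by (metis R_def insertCI mem_Collect_eq subsetD)
      ultimately show "i \<notin> R' \<union> \<tau> ` R'" "\<tau> i \<notin> R' \<union> \<tau> ` R'"
        using insert.hyps by auto
    qed
    have tau_out: "\<tau> k \<noteq> i \<and> \<tau> k \<noteq> \<tau> i" if "k \<in> R' \<union> \<tau> ` R'" for k
    proof -
      have "k \<in> J" using that insert.prems \<tau> by (auto simp: R_def)
      moreover have "k \<noteq> i" "k \<noteq> \<tau> i" using that nR by auto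
      ultimately show ?thesis using \<tau>(2) iJ by metis
    qed
    \<comment> \<open>The sine enters with a minus sign because \<open>givens\<close> subtracts the
      second coordinate in its first row, while \<open>pairrot\<close> adds it at an index of sign
      1.\<close>
    have eq: "pairrot (insert i R' \<union> \<tau> ` insert i R') \<tau> s \<theta>
       = givens i (\<tau> i) (cos \<theta>) (- sin \<theta>) \<circ> pairrot (R' \<union> \<tau> ` R') \<tau> s \<theta>"
      using iJ nR by (auto simp: fun_eq_iff pairrot_def givens_def)
    have sub: "R' \<union> \<tau> ` R' \<subseteq> I" "\<And>k. k \<in> R' \<union> \<tau> ` R' \<Longrightarrow> \<tau> k \<in> R' \<union> \<tau> ` R'"
      using insert.prems J \<tau> by (auto simp: R_def)
    have m: "givens i (\<tau> i) (cos \<theta>) (- sin \<theta>) \<in> measurable PG PG"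
      using iJ J by (intro measurable_givens) auto
    have "distr PG PG (pairrot (insert i R' \<union> \<tau> ` insert i R') \<tau> s \<theta>)
      = distr (distr PG PG (pairrot (R' \<union> \<tau> ` R') \<tau> s \<theta>)) PG (givens i (\<tau> i) (cos \<theta>) (- sin \<theta>))"
      unfolding eq by (subst distr_distr[OF m measurable_pairrot]) (use sub in auto)
    also have "\<dots> = distr PG PG (givens i (\<tau> i) (cos \<theta>) (- sin \<theta>))"
      using insert by simp
    also have "\<dots> = PG"
      using iJ J c by (intro distr_givens) auto
    finally show ?case .
  qed
  from this[of R] have "distr PG PG (pairrot (R \<union> \<tau> ` R) \<tau> s \<theta>) = PG" by simp
  also have "R \<union> \<tau> ` R = J"
  proof
    show "J \<subseteq> R \<union> \<tau> ` R"
    proof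
      fix i assume i: "i \<in> J"
      show "i \<in> R \<union> \<tau> ` R"
      proof (cases "s i = 1")
        case False
        then have "\<tau> i \<in> R" using i s \<tau> by (force simp: R_def)
        then show ?thesis using \<tau>(2)[OF i] by (metis UnI2 image_eqI)
      qed (use i in \<open>auto simp: R_def\<close>)
    qed
  qed (use \<tau> in \<open>auto simp: R_def\<close>)
  finally show ?thesis .
qed

section \<open>Resampling a block of coordinates\<close>

definition override :: "'i set \<Rightarrow> ('i \<Rightarrow> real) \<Rightarrow> ('i \<Rightarrow> real) \<Rightarrow> ('i \<Rightarrow> real)" where
  "override J w v = (\<lambda>i. if i \<in> J then v i else w i)"

abbreviation PGJ :: "'i set \<Rightarrow> ('i \<Rightarrow> real) measure" where
  "PGJ J \<equiv> PiM J (\<lambda>i. gauss (sd i))"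

lemma gaussian_family_subset: "J \<subseteq> I \<Longrightarrow> gaussian_family sd J"
  using sd_pos finite_I finite_subset by unfold_locales auto

lemma measurable_override:
  assumes "J \<subseteq> I"
  shows "(\<lambda>p. override J (fst p) (snd p)) \<in> PG \<Otimes>\<^sub>M PGJ J \<rightarrow>\<^sub>M PG"
proof (rule measurable_PiM_single')
  fix k assume k: "k \<in> I"
  show "(\<lambda>p. override J (fst p) (snd p) k) \<in> PG \<Otimes>\<^sub>M PGJ J \<rightarrow>\<^sub>M gauss (sd k)"
    by (cases "k \<in> J") (simp_all add: override_def k)
next
  show "(\<lambda>p. override J (fst p) (snd p)) \<in> space (PG \<Otimes>\<^sub>M PGJ J) \<rightarrow> (\<Pi>\<^sub>E i\<in>I. space (gauss (sd i)))"
    using assms by (auto simp: override_def space_pair_measure space_PiM PiE_iff extensional_def)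
qed

lemma distr_override:
  assumes J: "J \<subseteq> I"
  shows "distr (PG \<Otimes>\<^sub>M PGJ J) PG (\<lambda>p. override J (fst p) (snd p)) = PG"
proof (rule PiM_eqI)
  interpret J: gaussian_family sd J by (rule gaussian_family_subset[OF J])
  fix A assume A: "\<And>i. i \<in> I \<Longrightarrow> A i \<in> sets (gauss (sd i))"
  \<comment> \<open>The old coordinates in \<open>J\<close> are overwritten, hence unconstrained;
    they contribute factors 1.\<close>
  let ?B = "\<lambda>i. if i \<in> J then UNIV else A i"
  have A': "Pi\<^sub>E I A \<in> sets PG"
    using A by (intro sets_PiM_I_finite finite_I) auto
  have pre: "(\<lambda>p. override J (fst p) (snd p)) -` Pi\<^sub>E I A \<inter> space (PG \<Otimes>\<^sub>M PGJ J)
    = Pi\<^sub>E I ?B \<times> Pi\<^sub>E J A"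
    using J by (auto simp: override_def space_pair_measure space_PiM PiE_iff extensional_def split: if_splits)
  have B: "?B i \<in> sets (gauss (sd i))" if "i \<in> I" for i using A[OF that] by auto
  have "emeasure (distr (PG \<Otimes>\<^sub>M PGJ J) PG (\<lambda>p. override J (fst p) (snd p))) (Pi\<^sub>E I A)
     = emeasure (PG \<Otimes>\<^sub>M PGJ J) (Pi\<^sub>E I ?B \<times> Pi\<^sub>E J A)"
    by (subst emeasure_distr[OF measurable_override[OF J] A']) (simp add: pre)
  also have "\<dots> = emeasure PG (Pi\<^sub>E I ?B) * emeasure (PGJ J) (Pi\<^sub>E J A)"
    using A B J by (intro J.emeasure_pair_measure_Times sets_PiM_I_finite finite_I J.finite_I) auto
  also have "emeasure PG (Pi\<^sub>E I ?B) = (\<Prod>i\<in>I. emeasure (gauss (sd i)) (?B i))"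
    using B by (intro measure_times) auto
  also have "emeasure (PGJ J) (Pi\<^sub>E J A) = (\<Prod>i\<in>J. emeasure (gauss (sd i)) (A i))"
    using A J by (intro J.measure_times) auto
  also have "(\<Prod>i\<in>I. emeasure (gauss (sd i)) (?B i)) = (\<Prod>i\<in>I - J. emeasure (gauss (sd i)) (A i))"
  proof -
    have 1: "emeasure (gauss (sd i)) UNIV = 1" for i
      using M.emeasure_space_1[of i] by simp
    have "(\<Prod>i\<in>I. emeasure (gauss (sd i)) (?B i)) = (\<Prod>i\<in>I - J. emeasure (gauss (sd i)) (?B i)) * (\<Prod>i\<in>J. emeasure (gauss (sd i)) (?B i))"
      by (rule prod.subset_diff[OF J finite_I])
    also have "(\<Prod>i\<in>J. emeasure (gauss (sd i)) (?B i)) = 1"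
      by (rule prod.neutral) (simp add: 1)
    also have "(\<Prod>i\<in>I - J. emeasure (gauss (sd i)) (?B i)) = (\<Prod>i\<in>I - J. emeasure (gauss (sd i)) (A i))"
      by (rule prod.cong) auto
    finally show ?thesis by simp
  qed
  also have "\<dots> * (\<Prod>i\<in>J. emeasure (gauss (sd i)) (A i)) = (\<Prod>i\<in>I. emeasure (gauss (sd i)) (A i))"
    by (rule prod.subset_diff[OF J finite_I, symmetric])
  finally show "emeasure (distr (PG \<Otimes>\<^sub>M PGJ J) PG (\<lambda>p. override J (fst p) (snd p))) (Pi\<^sub>E I A)
    = (\<Prod>i\<in>I. emeasure (gauss (sd i)) (A i))" .
qed (simp_all add: finite_I)

text \<open>The tower property in the form in which all conditioning is done below: \<open>w\<close>
  supplies the coordinates outside \<open>J\<close>, and the inner integral is the conditional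
  expectation given them.\<close>

lemma nn_integral_resample:
  assumes J: "J \<subseteq> I" and [measurable]: "F \<in> borel_measurable PG"
  shows "(\<integral>\<^sup>+w. F w \<partial>PG) = (\<integral>\<^sup>+w. \<integral>\<^sup>+v. F (override J w v) \<partial>PGJ J \<partial>PG)"
proof -
  interpret J: gaussian_family sd J by (rule gaussian_family_subset[OF J])
  note [measurable] = measurable_override[OF J]
  have "(\<integral>\<^sup>+w. F w \<partial>PG) = (\<integral>\<^sup>+w. F w \<partial>distr (PG \<Otimes>\<^sub>M PGJ J) PG (\<lambda>p. override J (fst p) (snd p)))"
    by (simp add: distr_override[OF J])
  also have "\<dots> = (\<integral>\<^sup>+p. F (override J (fst p) (snd p)) \<partial>(PG \<Otimes>\<^sub>M PGJ J))"
    by (subst nn_integral_distr) auto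
  also have "\<dots> = (\<integral>\<^sup>+w. \<integral>\<^sup>+v. F (override J w v) \<partial>PGJ J \<partial>PG)"
    by (subst J.nn_integral_fst[symmetric]) auto
  finally show ?thesis .
qed

lemma integral_resample:
  fixes F :: "('i \<Rightarrow> real) \<Rightarrow> real"
  assumes J: "J \<subseteq> I" and F: "integrable PG F"
  shows "(\<integral>w. F w \<partial>PG) = (\<integral>w. \<integral>v. F (override J w v) \<partial>PGJ J \<partial>PG)"
proof -
  interpret J: gaussian_family sd J by (rule gaussian_family_subset[OF J])
  interpret PP: pair_sigma_finite PG "PGJ J" ..
  note m = measurable_override[OF J]
  have F': "integrable (distr (PG \<Otimes>\<^sub>M PGJ J) PG (\<lambda>p. override J (fst p) (snd p))) F"
    by (simp add: distr_override[OF J] F)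
  have [measurable]: "F \<in> borel_measurable PG" using F by auto
  have "integrable (PG \<Otimes>\<^sub>M PGJ J) (\<lambda>p. F (override J (fst p) (snd p)))"
    using F' by (subst (asm) integrable_distr_eq[OF m]) auto
  then have Fi: "integrable (PG \<Otimes>\<^sub>M PGJ J) (\<lambda>(w, v). F (override J w v))"
    by (simp add: case_prod_beta')
  have "(\<integral>w. F w \<partial>PG) = (\<integral>w. F w \<partial>distr (PG \<Otimes>\<^sub>M PGJ J) PG (\<lambda>p. override J (fst p) (snd p)))"
    by (simp add: distr_override[OF J])
  also have "\<dots> = (\<integral>p. F (override J (fst p) (snd p)) \<partial>(PG \<Otimes>\<^sub>M PGJ J))"
    by (subst integral_distr[OF m]) auto
  also have "\<dots> = (\<integral>w. \<integral>v. F (override J w v) \<partial>PGJ J \<partial>PG)"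
    using PP.integral_fst'[OF Fi] by (simp add: case_prod_beta')
  finally show ?thesis .
qed


lemma integral_uminus:
  fixes F :: "('i \<Rightarrow> real) \<Rightarrow> real"
  assumes F [measurable]: "F \<in> borel_measurable PG"
  shows "(\<integral>w. F (\<lambda>i\<in>I. - w i) \<partial>PG) = (\<integral>w. F w \<partial>PG)"
proof -
  have eq: "distr PG PG (compose I uminus) = PG"
    using distr_PiM_finite_prob_space'[OF finite_I, of "\<lambda>i. gauss (sd i)" "\<lambda>i. gauss (sd i)" uminus]
    by (simp add: distr_gauss_uminus prob_space_gauss sd_pos)
  have m: "compose I uminus \<in> measurable PG PG"
    unfolding compose_def by (rule measurable_restrict) simp
  have "(\<integral>w. F w \<partial>PG) = (\<integral>w. F w \<partial>distr PG PG (compose I uminus))"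
    by (simp add: eq)
  also have "\<dots> = (\<integral>w. F (compose I uminus w) \<partial>PG)"
    by (subst integral_distr[OF m]) auto
  finally show ?thesis by (simp add: compose_def)
qed

section \<open>Linear forms in independent Gaussians\<close>

lemma indep_vars_coord:
  assumes "I \<noteq> {}"
  shows "P.indep_vars (\<lambda>_. borel) (\<lambda>i w. w i) I"
proof (subst P.indep_vars_iff_distr_eq_PiM')
  have 1: "distr PG (Pi\<^sub>M I (\<lambda>_. borel)) (\<lambda>w. \<lambda>i\<in>I. w i) = PG"
  proof -
    have "distr PG (Pi\<^sub>M I (\<lambda>_. borel)) (\<lambda>w. \<lambda>i\<in>I. w i) = distr PG PG (\<lambda>w. w)"
      by (rule distr_cong) (auto intro!: sets_PiM_cong simp: space_PiM)
    then show ?thesis by (simp add: distr_id[unfolded id_def])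
  qed
  have 2: "Pi\<^sub>M I (\<lambda>i. distr PG borel (\<lambda>w. w i)) = PG"
  proof (rule PiM_cong)
    fix i assume i: "i \<in> I"
    have "distr PG borel (\<lambda>w. w i) = distr PG (gauss (sd i)) (\<lambda>w. w i)"
      by (rule distr_cong) auto
    then show "distr PG borel (\<lambda>w. w i) = gauss (sd i)"
      using distr_PiM_component[of I "\<lambda>i. gauss (sd i)" i] i by (simp add: prob_space_gauss sd_pos)
  qed simp
  show "distr PG (Pi\<^sub>M I (\<lambda>_. borel)) (\<lambda>w. \<lambda>i\<in>I. w i) = Pi\<^sub>M I (\<lambda>i. distr PG borel (\<lambda>w. w i))"
    using 1 2 by simp
qed (use assms in auto)

definition lin :: "('i \<Rightarrow> real) \<Rightarrow> ('i \<Rightarrow> real) \<Rightarrow> real" where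
  "lin y w = (\<Sum>i\<in>I. w i * y i)"

definition cov :: "('i \<Rightarrow> real) \<Rightarrow> ('i \<Rightarrow> real) \<Rightarrow> real" where
  "cov y z = (\<Sum>i\<in>I. (sd i)\<^sup>2 * (y i * z i))"

lemma measurable_lin [measurable]: "lin y \<in> borel_measurable PG"
  unfolding lin_def by measurable

lemma cov_nonneg: "0 \<le> cov y y"
  unfolding cov_def by (intro sum_nonneg) simp

lemma distributed_lin:
  assumes "0 < cov y y"
  shows "distributed PG lborel (lin y) (normal_density 0 (sqrt (cov y y)))"
proof -
  \<comment> \<open>Terms with coefficient 0 are dropped, since the addition theorem for independent
    normals needs every variance positive.\<close>
  define K where "K = {i \<in> I. y i \<noteq> 0}"
  have K: "finite K" "K \<subseteq> I" using finite_I by (auto simp: K_def)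
  have cK: "cov y y = (\<Sum>i\<in>K. (\<bar>y i\<bar> * sd i)\<^sup>2)"
    unfolding cov_def
    by (intro sum.mono_neutral_cong_right finite_I)
       (auto simp: K_def power2_eq_square power_mult_distrib)
  have lK: "lin y = (\<lambda>w. \<Sum>i\<in>K. 0 + y i * w i)"
    unfolding lin_def
    by (intro ext sum.mono_neutral_cong_right finite_I) (auto simp: K_def)
  have ne: "K \<noteq> {}" using assms unfolding cK by auto
  have "P.indep_vars (\<lambda>_. borel) (\<lambda>i w. w i) K"
    using P.indep_vars_subset[OF indep_vars_coord K(2)] ne K by auto
  then have ind: "P.indep_vars (\<lambda>_. borel) (\<lambda>i w. 0 + y i * w i) K"
    by (rule P.indep_vars_compose2[where Y="\<lambda>i x. 0 + y i * x"]) simp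
  have dist: "distributed PG lborel (\<lambda>w. 0 + y i * w i) (normal_density 0 (\<bar>y i\<bar> * sd i))" if "i \<in> K" for i
  proof -
    have iI: "i \<in> I" using that K by auto
    have "distributed PG lborel (\<lambda>w. w i) (normal_density 0 (sd i))"
      unfolding distributed_def
    proof (intro conjI)
      have "distr PG lborel (\<lambda>w. w i) = distr PG (gauss (sd i)) (\<lambda>w. w i)"
        by (rule distr_cong) auto
      then show "distr PG lborel (\<lambda>w. w i) = density lborel (\<lambda>x. ennreal (normal_density 0 (sd i) x))"
        using distr_PiM_component[of I "\<lambda>i. gauss (sd i)" i] iI
        by (simp add: prob_space_gauss sd_pos gauss_def[symmetric])
    qed (use iI in auto)
    from P.normal_density_affine[OF this sd_pos, of "y i" 0] that
    show ?thesis by (simp add: K_def)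
  qed
  have "distributed PG lborel (\<lambda>w. \<Sum>i\<in>K. 0 + y i * w i)
     (normal_density (\<Sum>i\<in>K. 0) (sqrt (\<Sum>i\<in>K. (\<bar>y i\<bar> * sd i)\<^sup>2)))"
    using sd_pos by (intro P.sum_indep_normal K ne ind dist) (auto simp: K_def)
  then show ?thesis by (simp add: lK cK)
qed

lemma lin_eq_0:
  assumes "cov y y = 0" shows "lin y w = 0"
proof -
  have "\<forall>i\<in>I. (sd i)\<^sup>2 * (y i * y i) = 0"
    using assms unfolding cov_def
    by (subst (asm) sum_nonneg_eq_0_iff) (auto simp: finite_I)
  moreover have "(sd i)\<^sup>2 \<noteq> 0" for i using sd_pos[of i] by simp
  ultimately have "\<forall>i\<in>I. y i = 0"
    by (metis mult_eq_0_iff)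
  then show ?thesis by (simp add: lin_def)
qed

text \<open>The factor is the double factorial of \<open>2 k - 1\<close>. A form of variance 0 has
  no density and is treated apart, as identically 0.\<close>

lemma has_integral_lin_even:
  "has_bochner_integral PG (\<lambda>w. lin y w ^ (2 * k)) (fact (2 * k) / (2 ^ k * fact k) * cov y y ^ k)"
proof (cases "cov y y = 0")
  case True
  show ?thesis
  proof (cases "k = 0")
    case True
    then show ?thesis by (simp add: has_bochner_integral_iff P.prob_space)
  next
    case False
    then show ?thesis using lin_eq_0[OF True] True
      by (simp add: power_0_left has_bochner_integral_zero)
  qed
next
  case False
  then have c: "0 < cov y y" using cov_nonneg[of y] by linarith
  note D = distributed_lin[OF c]
  have e: "fact (2 * k) / ((2 / (sqrt (cov y y))\<^sup>2) ^ k * fact k) = fact (2 * k) / (2 ^ k * fact k) * cov y y ^ k"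
    using c by (simp add: field_simps power_divide)
  have m: "has_bochner_integral lborel (\<lambda>x. normal_density 0 (sqrt (cov y y)) x * x ^ (2 * k))
      (fact (2 * k) / (2 ^ k * fact k) * cov y y ^ k)"
    using normal_moment_even[of "sqrt (cov y y)" 0 k] c unfolding e by simp
  show ?thesis
    unfolding has_bochner_integral_iff
  proof
    show "integrable PG (\<lambda>w. lin y w ^ (2 * k))"
      using distributed_integrable[OF D, of "\<lambda>x. x ^ (2 * k)"] m by (auto simp: has_bochner_integral_iff)
    show "(\<integral>w. lin y w ^ (2 * k) \<partial>PG) = fact (2 * k) / (2 ^ k * fact k) * cov y y ^ k"
      using distributed_integral[OF D, of "\<lambda>x. x ^ (2 * k)"] m by (auto simp: has_bochner_integral_iff)
  qed
qed

lemma lin_square: "integrable PG (\<lambda>w. (lin y w)\<^sup>2)" "(\<integral>w. (lin y w)\<^sup>2 \<partial>PG) = cov y y"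
  using has_integral_lin_even[of y 1] by (simp_all add: has_bochner_integral_iff numeral_2_eq_2)

lemma lin_fourth: "integrable PG (\<lambda>w. lin y w ^ 4)" "(\<integral>w. lin y w ^ 4 \<partial>PG) = 3 * (cov y y)\<^sup>2"
  using has_integral_lin_even[of y 2] by (simp_all add: has_bochner_integral_iff fact_numeral)

lemma lin_sum: "lin (\<lambda>i. \<Sum>k\<in>K. c k * y k i) w = (\<Sum>k\<in>K. c k * lin (y k) w)"
  unfolding lin_def sum_distrib_left by (subst sum.swap) (simp add: mult_ac)

section \<open>Shifted Gaussian measures\<close>

definition shift_density :: "('i \<Rightarrow> real) \<Rightarrow> ('i \<Rightarrow> real) \<Rightarrow> ennreal" where
  "shift_density u w = (\<Prod>i\<in>I. ennreal (exp (w i * u i / (sd i)\<^sup>2 - (u i)\<^sup>2 / (2 * (sd i)\<^sup>2))))"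

lemma measurable_shift_density [measurable]: "shift_density u \<in> borel_measurable PG"
  unfolding shift_density_def by measurable

lemma measurable_shift [measurable]: "(\<lambda>w. \<lambda>i\<in>I. w i + u i) \<in> measurable PG PG"
  by (rule measurable_restrict) simp

text \<open>Both sides agree with the product of the shifted one-dimensional laws, which reduces the
  claim to one coordinate at a time.\<close>

lemma distr_shift: "distr PG PG (\<lambda>w. \<lambda>i\<in>I. w i + u i) = density PG (shift_density u)"
proof -
  let ?g = "\<lambda>i x. ennreal (exp (x * u i / (sd i)\<^sup>2 - (u i)\<^sup>2 / (2 * (sd i)\<^sup>2)))"
  let ?D = "\<lambda>i. distr (gauss (sd i)) (gauss (sd i)) (\<lambda>x. x + u i)"
  have D: "prob_space (?D i)" for i
    by (intro prob_space.prob_space_distr prob_space_gauss sd_pos) simp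
  interpret Q: prob_space "?D i" for i by (rule D)
  interpret DD: product_sigma_finite ?D
    by standard
  have s: "sets (Pi\<^sub>M I ?D) = sets PG" by (intro sets_PiM_cong) auto
  have "distr PG PG (\<lambda>w. \<lambda>i\<in>I. w i + u i) = Pi\<^sub>M I ?D"
  proof (rule DD.PiM_eqI)
    fix A assume A: "\<And>i. i \<in> I \<Longrightarrow> A i \<in> sets (?D i)"
    have "emeasure (distr PG PG (\<lambda>w. \<lambda>i\<in>I. w i + u i)) (Pi\<^sub>E I A)
       = emeasure PG ((\<lambda>w. \<lambda>i\<in>I. w i + u i) -` Pi\<^sub>E I A \<inter> space PG)"
      using A by (intro emeasure_distr sets_PiM_I_finite finite_I measurable_shift) auto
    also have "(\<lambda>w. \<lambda>i\<in>I. w i + u i) -` Pi\<^sub>E I A \<inter> space PG = Pi\<^sub>E I (\<lambda>i. (\<lambda>x. x + u i) -` A i)"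
      by (auto simp: space_PiM PiE_iff)
    also have "emeasure PG \<dots> = (\<Prod>i\<in>I. emeasure (gauss (sd i)) ((\<lambda>x. x + u i) -` A i))"
    proof (rule measure_times)
      fix i assume "i \<in> I"
      then have "A i \<in> sets borel" using A[of i] by simp
      from measurable_sets[OF _ this, of "\<lambda>x. x + u i" borel]
      show "(\<lambda>x. x + u i) -` A i \<in> sets (gauss (sd i))" by simp
    qed
    also have "\<dots> = (\<Prod>i\<in>I. emeasure (?D i) (A i))"
      using A by (intro prod.cong refl) (subst emeasure_distr, auto)
    finally show "emeasure (distr PG PG (\<lambda>w. \<lambda>i\<in>I. w i + u i)) (Pi\<^sub>E I A) = (\<Prod>i\<in>I. emeasure (?D i) (A i))" .
  qed (simp_all add: finite_I s)
  also have "\<dots> = density PG (shift_density u)"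
  proof (rule DD.PiM_eqI[symmetric])
    fix A assume A: "\<And>i. i \<in> I \<Longrightarrow> A i \<in> sets (?D i)"
    then have A' [measurable]: "A i \<in> sets borel" if "i \<in> I" for i using that by simp
    have "emeasure (density PG (shift_density u)) (Pi\<^sub>E I A)
       = (\<integral>\<^sup>+w. shift_density u w * indicator (Pi\<^sub>E I A) w \<partial>PG)"
      using A by (intro emeasure_density measurable_shift_density sets_PiM_I_finite finite_I) auto
    also have "\<dots> = (\<integral>\<^sup>+w. (\<Prod>i\<in>I. ?g i (w i) * indicator (A i) (w i)) \<partial>PG)"
    proof (rule nn_integral_cong)
      fix w assume w: "w \<in> space PG"
      have "indicator (Pi\<^sub>E I A) w = (\<Prod>i\<in>I. indicator (A i) (w i) :: ennreal)"
        using w by (auto simp: indicator_def space_PiM PiE_iff finite_I prod_zero_iff)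
      then show "shift_density u w * indicator (Pi\<^sub>E I A) w = (\<Prod>i\<in>I. ?g i (w i) * indicator (A i) (w i))"
        by (simp add: shift_density_def prod.distrib)
    qed
    also have "\<dots> = (\<Prod>i\<in>I. \<integral>\<^sup>+x. ?g i x * indicator (A i) x \<partial>gauss (sd i))"
      by (rule product_nn_integral_prod[OF finite_I]) measurable
    also have "\<dots> = (\<Prod>i\<in>I. emeasure (?D i) (A i))"
    proof (rule prod.cong[OF refl])
      fix i assume i: "i \<in> I"
      have "(\<integral>\<^sup>+x. ?g i x * indicator (A i) x \<partial>gauss (sd i)) = (\<integral>\<^sup>+x. indicator (A i) (x + u i) \<partial>gauss (sd i))"
        using i by (intro nn_integral_gauss_shift[symmetric] sd_pos) auto
      also have "\<dots> = (\<integral>\<^sup>+x. indicator (A i) x \<partial>?D i)"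
        using i by (subst nn_integral_distr) auto
      finally show "(\<integral>\<^sup>+x. ?g i x * indicator (A i) x \<partial>gauss (sd i)) = emeasure (?D i) (A i)"
        using i by simp
    qed
    finally show "emeasure (density PG (shift_density u)) (Pi\<^sub>E I A) = (\<Prod>i\<in>I. emeasure (?D i) (A i))" .
  qed (simp_all add: finite_I s)
  finally show ?thesis .
qed

text \<open>Let \<open>r\<close> be the likelihood ratio of the shift. Integrating
  \<open>1 \<le> (t r + 1 / (t r)) / 2\<close> over \<open>B\<close> leaves two terms: the integral
  of \<open>r\<close> over \<open>B\<close> is the probability that the shifted point lies in
  \<open>B\<close>, hence at most that of \<open>C\<close>, and the integral of \<open>1 / r\<close>
  is the exponential of the squared length of the shift, measured in standard deviations.\<close>

lemma prob_shift_bound: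
  assumes [measurable]: "B \<in> sets PG" "C \<in> sets PG"
    and BC: "\<And>w. w \<in> space PG \<Longrightarrow> (\<lambda>i\<in>I. w i + u i) \<in> B \<Longrightarrow> w \<in> C"
    and t: "0 < t"
  shows "measure PG B \<le> (t * measure PG C + exp (\<Sum>i\<in>I. (u i)\<^sup>2 / (sd i)\<^sup>2) / t) / 2"
proof -
  define r where "r w = exp (\<Sum>i\<in>I. w i * u i / (sd i)\<^sup>2 - (u i)\<^sup>2 / (2 * (sd i)\<^sup>2))" for w
  define S where "S = (\<Sum>i\<in>I. (u i)\<^sup>2 / (sd i)\<^sup>2)"
  have rpos: "0 < r w" for w by (simp add: r_def)
  have sr: "shift_density u w = ennreal (r w)" for w
    unfolding shift_density_def r_def exp_sum[OF finite_I] by (rule prod_ennreal) simp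
  \<comment> \<open>Up to the constant \<open>exp S\<close>, the reciprocal \<open>1 / r\<close> is
    the density of the opposite shift, so its integral is \<open>exp S\<close>.\<close>
  have sr': "shift_density (\<lambda>i. - u i) w * ennreal (exp S) = ennreal (1 / r w)" for w
  proof -
    have "shift_density (\<lambda>i. - u i) w = ennreal (exp (\<Sum>i\<in>I. w i * - u i / (sd i)\<^sup>2 - (- u i)\<^sup>2 / (2 * (sd i)\<^sup>2)))"
      unfolding shift_density_def exp_sum[OF finite_I] by (rule prod_ennreal) simp
    also have "\<dots> * ennreal (exp S) = ennreal (exp ((\<Sum>i\<in>I. w i * - u i / (sd i)\<^sup>2 - (- u i)\<^sup>2 / (2 * (sd i)\<^sup>2)) + S))"
      by (simp add: ennreal_mult[symmetric] exp_add)
    also have "(\<Sum>i\<in>I. w i * - u i / (sd i)\<^sup>2 - (- u i)\<^sup>2 / (2 * (sd i)\<^sup>2)) + S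
       = - (\<Sum>i\<in>I. w i * u i / (sd i)\<^sup>2 - (u i)\<^sup>2 / (2 * (sd i)\<^sup>2))"
      unfolding S_def sum.distrib[symmetric] sum_negf[symmetric]
      by (intro sum.cong refl) (simp add: field_simps)
    finally show ?thesis by (simp add: r_def exp_minus inverse_eq_divide)
  qed
  have rm [measurable]: "r \<in> borel_measurable PG"
    unfolding r_def by measurable
  have int1: "(\<integral>\<^sup>+w. ennreal (r w) * indicator B w \<partial>PG) \<le> ennreal (measure PG C)"
  proof -
    have "(\<integral>\<^sup>+w. ennreal (r w) * indicator B w \<partial>PG) = emeasure (density PG (shift_density u)) B"
      by (simp add: emeasure_density sr)
    also have "\<dots> = emeasure PG ((\<lambda>w. \<lambda>i\<in>I. w i + u i) -` B \<inter> space PG)"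
      unfolding distr_shift[symmetric] by (rule emeasure_distr) auto
    also have "\<dots> \<le> emeasure PG C"
      using BC by (intro emeasure_mono) auto
    finally show ?thesis by (simp add: P.emeasure_eq_measure)
  qed
  have int2: "(\<integral>\<^sup>+w. ennreal (1 / r w) \<partial>PG) = ennreal (exp S)"
  proof -
    have "(\<integral>\<^sup>+w. ennreal (1 / r w) \<partial>PG) = (\<integral>\<^sup>+w. shift_density (\<lambda>i. - u i) w \<partial>PG) * ennreal (exp S)"
      unfolding sr'[symmetric] by (rule nn_integral_multc) measurable
    also have "(\<integral>\<^sup>+w. shift_density (\<lambda>i. - u i) w \<partial>PG)
       = (\<Prod>i\<in>I. \<integral>\<^sup>+x. ennreal (exp (x * - u i / (sd i)\<^sup>2 - (- u i)\<^sup>2 / (2 * (sd i)\<^sup>2))) \<partial>gauss (sd i))"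
      unfolding shift_density_def by (rule product_nn_integral_prod[OF finite_I]) measurable
    also have "\<dots> = 1"
      by (intro prod.neutral ballI nn_integral_gauss_exp sd_pos)
    finally show ?thesis by simp
  qed
  have amgm: "1 \<le> (t * r w + 1 / (t * r w)) / 2" for w
  proof -
    have "1 \<le> (q + 1 / q) / 2" if "0 < q" for q :: real
    proof -
      have "0 \<le> (q - 1)\<^sup>2" by simp
      then show ?thesis using that by (simp add: field_simps power2_eq_square)
    qed
    from this[of "t * r w"] show ?thesis using t rpos by simp
  qed
  have "ennreal (measure PG B) = (\<integral>\<^sup>+w. indicator B w \<partial>PG)"
    by (simp add: P.emeasure_eq_measure)
  also have "\<dots> \<le> (\<integral>\<^sup>+w. ennreal (t / 2) * (ennreal (r w) * indicator B w) + ennreal (1 / (2 * t)) * ennreal (1 / r w) \<partial>PG)"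
  proof (rule nn_integral_mono)
    fix w
    have "ennreal 1 \<le> ennreal (t / 2 * r w + 1 / (2 * t) * (1 / r w))"
      using amgm[of w] by (intro ennreal_leI) (simp add: field_simps)
    then show "indicator B w \<le> ennreal (t / 2) * (ennreal (r w) * indicator B w) + ennreal (1 / (2 * t)) * ennreal (1 / r w)"
      using t rpos[of w] by (auto simp: indicator_def ennreal_mult[symmetric] ennreal_plus[symmetric] simp del: ennreal_plus)
  qed
  also have "\<dots> = ennreal (t / 2) * (\<integral>\<^sup>+w. ennreal (r w) * indicator B w \<partial>PG) + ennreal (1 / (2 * t)) * (\<integral>\<^sup>+w. ennreal (1 / r w) \<partial>PG)"
    by (subst nn_integral_add) (auto simp: nn_integral_cmult)
  also have "\<dots> \<le> ennreal (t / 2) * ennreal (measure PG C) + ennreal (1 / (2 * t)) * ennreal (exp S)"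
    unfolding int2 by (intro add_mono mult_left_mono int1) auto
  also have "\<dots> = ennreal (t / 2 * measure PG C + 1 / (2 * t) * exp S)"
    using t by (simp add: ennreal_mult[symmetric] ennreal_plus[symmetric] del: ennreal_plus)
  finally have "measure PG B \<le> t / 2 * measure PG C + 1 / (2 * t) * exp S"
    using t by (subst (asm) ennreal_le_iff) auto
  then show ?thesis using t by (simp add: S_def field_simps)
qed


section \<open>Residuals with respect to the covariance form\<close>

lemma cov_diff_left: "cov (\<lambda>i. x i - b * z i) y = cov x y - b * cov z y"
  unfolding cov_def sum_distrib_left sum_subtractf[symmetric]
  by (intro sum.cong refl) (simp add: algebra_simps)

lemma cov_diff_right: "cov y (\<lambda>i. x i - b * z i) = cov y x - b * cov y z"
  unfolding cov_def sum_distrib_left sum_subtractf[symmetric]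
  by (intro sum.cong refl) (simp add: algebra_simps)

lemma cov_sum_right: "cov y (\<lambda>i. \<Sum>k\<in>K. c k * x k i) = (\<Sum>k\<in>K. c k * cov y (x k))"
  unfolding cov_def sum_distrib_left
  by (subst sum.swap) (auto intro!: sum.cong simp: mult_ac)

lemma cov_commute: "cov x y = cov y x"
  unfolding cov_def by (simp add: mult.commute)

lemma cov_null:
  assumes "cov y y = 0" shows "cov x y = 0"
proof -
  have "\<forall>i\<in>I. (sd i)\<^sup>2 * (y i * y i) = 0"
    using assms unfolding cov_def
    by (subst (asm) sum_nonneg_eq_0_iff) (auto simp: finite_I)
  moreover have "(sd i)\<^sup>2 \<noteq> 0" for i using sd_pos[of i] by simp
  ultimately have "\<forall>i\<in>I. y i = 0" by (metis mult_eq_0_iff)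
  then show ?thesis by (simp add: cov_def)
qed

text \<open>Gram-Schmidt for a family that may be linearly dependent: the new vector is first
  reduced to its own residual \<open>q\<close>, and then the component along \<open>q\<close> is
  removed from \<open>h\<close>.\<close>

lemma cov_residual:
  assumes "finite K"
  shows "\<exists>c. \<forall>k\<in>K. cov (\<lambda>i. h i - (\<Sum>k\<in>K. c k * y k i)) (y k) = 0"
  using assms
proof (induction K arbitrary: h rule: finite_induct)
  case (insert j K)
  obtain c where c: "\<forall>k\<in>K. cov (\<lambda>i. h i - (\<Sum>k\<in>K. c k * y k i)) (y k) = 0"
    using insert.IH by blast
  obtain b where b: "\<forall>k\<in>K. cov (\<lambda>i. y j i - (\<Sum>k\<in>K. b k * y k i)) (y k) = 0"
    using insert.IH by blast
  define r where "r i = h i - (\<Sum>k\<in>K. c k * y k i)" for i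
  define q where "q i = y j i - (\<Sum>k\<in>K. b k * y k i)" for i
  have r0: "cov r (y k) = 0" and q0: "cov q (y k) = 0" if "k \<in> K" for k
    using c b that by (auto simp: r_def[abs_def] q_def[abs_def])
  have yj: "cov x (y j) = cov x q" if "\<And>k. k \<in> K \<Longrightarrow> cov x (y k) = 0" for x
  proof -
    have "cov x q = cov x (\<lambda>i. y j i - 1 * (\<Sum>k\<in>K. b k * y k i))"
      by (simp add: q_def[abs_def])
    also have "\<dots> = cov x (y j)"
      by (subst cov_diff_right) (simp add: cov_sum_right that)
    finally show ?thesis by simp
  qed
  \<comment> \<open>If \<open>q\<close> has variance 0 there is nothing to remove, because it is
    uncorrelated with everything.\<close>
  define be where "be = (if cov q q = 0 then 0 else cov r q / cov q q)"
  have rq: "cov (\<lambda>i. r i - be * q i) (y k) = 0" if "k \<in> insert j K" for k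
  proof (cases "k \<in> K")
    case True
    then show ?thesis by (simp add: cov_diff_left r0 q0)
  next
    case False
    then have [simp]: "k = j" using that by auto
    have "cov r (y j) = cov r q" "cov q (y j) = cov q q"
      using yj r0 q0 by auto
    then show ?thesis
      using cov_null[of q r] by (auto simp: cov_diff_left be_def)
  qed
  define c' where "c' k = (if k = j then be else c k - be * b k)" for k
  have "(\<lambda>i. h i - (\<Sum>k\<in>insert j K. c' k * y k i)) = (\<lambda>i. r i - be * q i)"
  proof
    fix i
    have "(\<Sum>k\<in>insert j K. c' k * y k i) = be * y j i + (\<Sum>k\<in>K. c' k * y k i)"
      using insert.hyps by (simp add: c'_def)
    also have "(\<Sum>k\<in>K. c' k * y k i) = (\<Sum>k\<in>K. c k * y k i - be * (b k * y k i))"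
      using insert.hyps by (intro sum.cong) (auto simp: c'_def algebra_simps)
    finally show "h i - (\<Sum>k\<in>insert j K. c' k * y k i) = r i - be * q i"
      by (simp add: r_def q_def sum_subtractf sum_distrib_left algebra_simps)
  qed
  then show ?case using rq by (intro exI[of _ c']) simp
qed auto

text \<open>If the covariance matrix of the linear forms is bounded below, then each of them has a dual
  direction of bounded length. Shifting along it turns the event that all forms are nonnegative into
  events (only the \<open>k\<close>-th form is negative) which are disjoint for different \<open>k\<close>.\<close>

lemma prob_all_lin_nonneg:
  fixes H :: "nat \<Rightarrow> 'i \<Rightarrow> real"
  assumes a: "0 < a" and rho: "0 < \<rho>" and T: "0 < T" and m: "0 < m"
    and lower: "\<And>c. a * \<rho> * (\<Sum>k<m. (c k)\<^sup>2) \<le> cov (\<lambda>i. \<Sum>k<m. c k * H k i) (\<lambda>i. \<Sum>k<m. c k * H k i)"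
    and diag: "\<And>k. k < m \<Longrightarrow> cov (H k) (H k) \<le> 2 * \<rho>"
  shows "measure PG {w \<in> space PG. \<forall>k<m. 0 \<le> lin (H k) w} \<le> 2 / T\<^sup>2 + exp (T\<^sup>2 / (2 * a)) / sqrt m"
proof -
  define E where "E = {w \<in> space PG. \<forall>k<m. 0 \<le> lin (H k) w}"
  define B where "B k = {w \<in> space PG. (\<forall>k<m. 0 \<le> lin (H k) w) \<and> lin (H k) w < T * sqrt \<rho>}" for k
  define C where "C k = {w \<in> space PG. lin (H k) w < 0 \<and> (\<forall>j<m. j \<noteq> k \<longrightarrow> 0 \<le> lin (H j) w)}" for k
  have [measurable]: "E \<in> sets PG" "B k \<in> sets PG" "C k \<in> sets PG" for k
    unfolding E_def B_def C_def by measurable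
  \<comment> \<open>This \<open>t\<close> balances the two terms of the shift bound after summation
    over \<open>k\<close>: the \<open>C k\<close> have total probability at most 1, and
    \<open>t\<^sup>2 = m * exp (T\<^sup>2 / a)\<close> makes both terms equal to
    \<open>t\<close>.\<close>
  define t where "t = sqrt m * exp (T\<^sup>2 / (2 * a))"
  have t: "0 < t" using m by (simp add: t_def)
  have PB: "measure PG (B k) \<le> (t * measure PG (C k) + exp (T\<^sup>2 / a) / t) / 2" if k: "k < m" for k
  proof -
    obtain c where c: "\<forall>j\<in>{..<m} - {k}. cov (\<lambda>i. H k i - (\<Sum>j\<in>{..<m} - {k}. c j * H j i)) (H j) = 0"
      using cov_residual[of "{..<m} - {k}" "H k" H] by auto
    define r where "r i = H k i - (\<Sum>j\<in>{..<m} - {k}. c j * H j i)" for i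
    have r0: "cov r (H j) = 0" if "j < m" "j \<noteq> k" for j
      using c that by (auto simp: r_def[abs_def])
    have rk: "cov r (H k) = cov r r"
    proof -
      have "cov r r = cov r (\<lambda>i. H k i - 1 * (\<Sum>j\<in>{..<m} - {k}. c j * H j i))"
        by (simp add: r_def[abs_def])
      also have "\<dots> = cov r (H k)"
        by (subst cov_diff_right) (simp add: cov_sum_right r0)
      finally show ?thesis by simp
    qed
    \<comment> \<open>The residual has coefficient 1 at \<open>H k\<close>, so its coefficient
      vector has length at least 1 and \<open>lower\<close> bounds its variance below by
      \<open>a * \<rho>\<close>.\<close>
    define c' where "c' j = (if j = k then 1 else - c j)" for j
    have r': "r = (\<lambda>i. \<Sum>j<m. c' j * H j i)"
    proof
      fix i
      have "(\<Sum>j<m. c' j * H j i) = c' k * H k i + (\<Sum>j\<in>{..<m} - {k}. c' j * H j i)"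
        using k by (intro sum.remove) auto
      also have "(\<Sum>j\<in>{..<m} - {k}. c' j * H j i) = - (\<Sum>j\<in>{..<m} - {k}. c j * H j i)"
        unfolding sum_negf[symmetric] by (intro sum.cong) (auto simp: c'_def)
      finally show "r i = (\<Sum>j<m. c' j * H j i)" by (simp add: r_def c'_def)
    qed
    have "1 \<le> (\<Sum>j<m. (c' j)\<^sup>2)"
      using member_le_sum[of k "{..<m}" "\<lambda>j. (c' j)\<^sup>2"] k by (simp add: c'_def)
    then have "a * \<rho> * 1 \<le> a * \<rho> * (\<Sum>j<m. (c' j)\<^sup>2)"
      using a rho by (intro mult_left_mono) auto
    also have "\<dots> \<le> cov r r" unfolding r' by (rule lower)
    finally have rr: "a * \<rho> \<le> cov r r" by simp
    have rpos: "0 < cov r r" using rr a rho by (meson less_le_trans mult_pos_pos)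
    \<comment> \<open>The shift follows the residual \<open>r\<close>. Since \<open>r\<close> is
      uncorrelated with the other forms, these do not move, and the \<open>k\<close>-th form drops
      by exactly \<open>T * sqrt \<rho>\<close> when the shift is undone; on \<open>B k\<close> this
      makes it negative.\<close>
    define q where "q = T * sqrt \<rho> / cov r r"
    define u where "u i = q * ((sd i)\<^sup>2 * r i)" for i
    have lu: "lin (H j) (\<lambda>i\<in>I. w i + u i) = lin (H j) w + q * cov r (H j)" for j w
      unfolding lin_def cov_def sum_distrib_left sum.distrib[symmetric]
      by (intro sum.cong) (auto simp: u_def algebra_simps)
    have us: "(\<Sum>i\<in>I. (u i)\<^sup>2 / (sd i)\<^sup>2) = q\<^sup>2 * cov r r"
      unfolding cov_def sum_distrib_left
    proof (intro sum.cong refl)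
      fix i show "(u i)\<^sup>2 / (sd i)\<^sup>2 = q\<^sup>2 * ((sd i)\<^sup>2 * (r i * r i))"
        using sd_pos[of i] by (simp add: u_def field_simps power2_eq_square)
    qed
    have "q\<^sup>2 * cov r r = T\<^sup>2 * \<rho> / cov r r"
      using rho rpos by (simp add: q_def power_divide power_mult_distrib power2_eq_square)
    also have "\<dots> \<le> T\<^sup>2 * \<rho> / (a * \<rho>)"
      using rr a rho rpos by (intro divide_left_mono mult_pos_pos) auto
    also have "\<dots> = T\<^sup>2 / a" using rho by simp
    finally have us': "(\<Sum>i\<in>I. (u i)\<^sup>2 / (sd i)\<^sup>2) \<le> T\<^sup>2 / a" unfolding us .
    have qk: "q * cov r (H k) = T * sqrt \<rho>" using rpos by (simp add: rk q_def)
    have "measure PG (B k) \<le> (t * measure PG (C k) + exp (\<Sum>i\<in>I. (u i)\<^sup>2 / (sd i)\<^sup>2) / t) / 2"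
    proof (rule prob_shift_bound)
      fix w assume w: "w \<in> space PG" and wB: "(\<lambda>i\<in>I. w i + u i) \<in> B k"
      have "lin (H k) w < 0" using wB qk by (simp add: B_def lu)
      moreover have "0 \<le> lin (H j) w" if "j < m" "j \<noteq> k" for j
        using wB that r0[OF that] lu[of j w] by (auto simp: B_def)
      ultimately show "w \<in> C k" using w by (simp add: C_def)
    qed (auto simp: t)
    also have "\<dots> \<le> (t * measure PG (C k) + exp (T\<^sup>2 / a) / t) / 2"
      using us' t by (intro divide_right_mono add_left_mono) auto
    finally show ?thesis .
  qed
  have disj: "disjoint_family_on C {..<m}"
    by (fastforce simp: disjoint_family_on_def C_def)
  have "(\<Sum>k<m. measure PG (C k)) = measure PG (\<Union>k<m. C k)"
    by (rule P.finite_measure_finite_Union[symmetric]) (use disj in auto)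
  then have PC: "(\<Sum>k<m. measure PG (C k)) \<le> 1" by simp
  \<comment> \<open>Outside \<open>B k\<close> the \<open>k\<close>-th form is at least
    \<open>T * sqrt \<rho>\<close>, which Chebyshev makes unlikely because its variance is at most
    \<open>2 * \<rho>\<close>.\<close>
  have PE: "measure PG E \<le> measure PG (B k) + 2 / T\<^sup>2" if k: "k < m" for k
  proof -
    let ?D = "{w \<in> space PG. T\<^sup>2 * \<rho> \<le> (lin (H k) w)\<^sup>2}"
    have "E \<subseteq> B k \<union> ?D"
    proof
      fix w assume w: "w \<in> E"
      show "w \<in> B k \<union> ?D"
      proof (cases "lin (H k) w < T * sqrt \<rho>")
        case False
        then have "(T * sqrt \<rho>)\<^sup>2 \<le> (lin (H k) w)\<^sup>2"
          using T rho by (intro power_mono) auto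
        then show ?thesis using w rho by (auto simp: E_def power_mult_distrib)
      qed (use w in \<open>auto simp: E_def B_def\<close>)
    qed
    then have "measure PG E \<le> measure PG (B k \<union> ?D)"
      by (rule P.finite_measure_mono) measurable
    also have "\<dots> \<le> measure PG (B k) + measure PG ?D"
      by (rule measure_Un_le) measurable
    also have "measure PG ?D \<le> (\<integral>w. (lin (H k) w)\<^sup>2 \<partial>PG) / (T\<^sup>2 * \<rho>)"
      using T rho lin_square by (intro integral_Markov_inequality_measure[where A="{}"]) auto
    also have "\<dots> \<le> 2 * \<rho> / (T\<^sup>2 * \<rho>)"
      unfolding lin_square using diag[OF k] T rho by (intro divide_right_mono) auto
    also have "\<dots> = 2 / T\<^sup>2" using rho by simp
    finally show ?thesis by simp
  qed
  have "real m * measure PG E = (\<Sum>k<m. measure PG E)" by simp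
  also have "\<dots> \<le> (\<Sum>k<m. (t * measure PG (C k) + exp (T\<^sup>2 / a) / t) / 2 + 2 / T\<^sup>2)"
    using PE PB by (intro sum_mono) (meson add_right_mono lessThan_iff order_trans)
  also have "\<dots> = (t * (\<Sum>k<m. measure PG (C k)) + m * (exp (T\<^sup>2 / a) / t)) / 2 + m * (2 / T\<^sup>2)"
    by (simp add: sum.distrib sum_distrib_left sum_divide_distrib[symmetric])
  also have "\<dots> \<le> (t * 1 + m * (exp (T\<^sup>2 / a) / t)) / 2 + m * (2 / T\<^sup>2)"
    using PC t by (intro add_right_mono divide_right_mono mult_left_mono) auto
  also have "m * (exp (T\<^sup>2 / a) / t) = t"
  proof -
    have "t * t = m * exp (T\<^sup>2 / a)"
      by (simp add: t_def mult_ac exp_add[symmetric])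
    then show ?thesis using t by (simp add: field_simps)
  qed
  finally have "real m * measure PG E \<le> t + m * (2 / T\<^sup>2)" by simp
  then have "measure PG E \<le> (t + m * (2 / T\<^sup>2)) / m"
    using m by (simp add: field_simps)
  also have "\<dots> = 2 / T\<^sup>2 + t / m" using m by (simp add: field_simps)
  also have "t / m = exp (T\<^sup>2 / (2 * a)) / sqrt m"
    using m by (simp add: t_def field_simps real_div_sqrt)
  finally show ?thesis by (simp add: E_def)
qed

end

section \<open>The ReLU of Gaussian linear forms\<close>

lemma relu_nonneg: "0 \<le> relu x"
  and relu_le_abs: "relu x \<le> \<bar>x\<bar>"
  and relu_minus: "relu x - relu (- x) = x"
  by (auto simp: relu_def)

lemma measurable_relu [measurable]: "relu \<in> borel_measurable borel"
  unfolding relu_def[abs_def] by measurable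

lemma relu_power_le: "relu x ^ n \<le> \<bar>x\<bar> ^ n"
  by (intro power_mono relu_le_abs relu_nonneg)

context gaussian_family
begin

lemma integrable_relu_square: "integrable PG (\<lambda>w. (relu (lin y w))\<^sup>2)"
  by (rule Bochner_Integration.integrable_bound[OF lin_square(1)[of y]])
     (use relu_power_le[of _ 2] in auto)

lemma integrable_relu_mult: "integrable PG (\<lambda>w. relu (lin y w) * relu (lin z w))"
proof (rule Bochner_Integration.integrable_bound)
  show "integrable PG (\<lambda>w. (relu (lin y w))\<^sup>2 + (relu (lin z w))\<^sup>2)"
    by (intro Bochner_Integration.integrable_add integrable_relu_square)
  have "a * b \<le> a\<^sup>2 + b\<^sup>2" if "0 \<le> a" "0 \<le> b" for a b :: real
    using sum_squares_bound[of a b] mult_nonneg_nonneg[OF that] by linarith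
  then show "AE w in PG. norm (relu (lin y w) * relu (lin z w)) \<le> norm ((relu (lin y w))\<^sup>2 + (relu (lin z w))\<^sup>2)"
    by (simp add: relu_nonneg abs_mult)
qed auto

lemma integral_relu_square_le: "(\<integral>w. relu (lin y w) * relu (lin y w) \<partial>PG) \<le> cov y y"
proof -
  have "(\<integral>w. (relu (lin y w))\<^sup>2 \<partial>PG) \<le> (\<integral>w. (lin y w)\<^sup>2 \<partial>PG)"
    using relu_power_le[of _ 2] by (intro integral_mono integrable_relu_square lin_square) auto
  then show ?thesis unfolding lin_square by (simp add: power2_eq_square)
qed

lemma nn_integral_relu_fourth_le:
  "(\<integral>\<^sup>+w. ennreal (relu (lin y w) ^ 4) \<partial>PG) \<le> ennreal (3 * (cov y y)\<^sup>2)"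
proof -
  have "(\<integral>\<^sup>+w. ennreal (relu (lin y w) ^ 4) \<partial>PG) \<le> (\<integral>\<^sup>+w. ennreal (lin y w ^ 4) \<partial>PG)"
    using relu_power_le[of _ 4] by (intro nn_integral_mono ennreal_leI) auto
  also have "\<dots> = ennreal (\<integral>w. lin y w ^ 4 \<partial>PG)"
    by (intro nn_integral_eq_integral lin_fourth) auto
  finally show ?thesis by (simp add: lin_fourth)
qed

lemma lin_uminus: "lin y (\<lambda>i\<in>I. - w i) = - lin y w"
  unfolding lin_def sum_negf[symmetric] by (intro sum.cong) auto

text \<open>Since \<open>relu z - relu (- z) = z\<close> and the law of the weights is symmetric, a ReLU layer
  loses at most a factor 4 of any quadratic form in the covariance.\<close>

lemma relu_quadratic_form_ge:
  fixes c :: "'k \<Rightarrow> real"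
  assumes K: "finite K"
  shows "cov (\<lambda>i. \<Sum>k\<in>K. c k * y k i) (\<lambda>i. \<Sum>k\<in>K. c k * y k i) / 4
    \<le> (\<Sum>k\<in>K. \<Sum>k'\<in>K. c k * c k' * (\<integral>w. relu (lin (y k) w) * relu (lin (y k') w) \<partial>PG))"
proof -
  define F where "F w = (\<Sum>k\<in>K. c k * relu (lin (y k) w))\<^sup>2" for w
  have Fe: "F w = (\<Sum>k\<in>K. \<Sum>k'\<in>K. c k * c k' * (relu (lin (y k) w) * relu (lin (y k') w)))" for w
    unfolding F_def power2_eq_square sum_product by (simp add: mult_ac)
  have Fi: "integrable PG F"
    unfolding Fe[abs_def] by (intro Bochner_Integration.integrable_sum Bochner_Integration.integrable_mult_right integrable_relu_mult)
  then have [measurable]: "F \<in> borel_measurable PG" by auto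
  have Fu: "F (\<lambda>i\<in>I. - w i) = (\<Sum>k\<in>K. c k * relu (- lin (y k) w))\<^sup>2" for w
    by (simp add: F_def lin_uminus)
  let ?L = "\<lambda>i. \<Sum>k\<in>K. c k * y k i"
  have sq_le: "(a - b)\<^sup>2 \<le> 2 * a\<^sup>2 + 2 * b\<^sup>2" for a b :: real
    using zero_le_power2[of "a + b"] by (simp add: power2_eq_square algebra_simps)
  \<comment> \<open>Integrability of the reflected square follows by domination: reflecting changes
    the sum inside by the linear form \<open>lin ?L\<close>.\<close>
  have Fi': "integrable PG (\<lambda>w. F (\<lambda>i\<in>I. - w i))"
  proof (rule Bochner_Integration.integrable_bound)
    show "integrable PG (\<lambda>w. 2 * F w + 2 * (lin ?L w)\<^sup>2)"
      using Fi lin_square(1)[of ?L] by auto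
    have "(\<lambda>w. \<lambda>i\<in>I. - w i) \<in> measurable PG PG"
      by (rule measurable_restrict) simp
    then show "(\<lambda>w. F (\<lambda>i\<in>I. - w i)) \<in> borel_measurable PG" by measurable
    show "AE w in PG. norm (F (\<lambda>i\<in>I. - w i)) \<le> norm (2 * F w + 2 * (lin ?L w)\<^sup>2)"
    proof (rule AE_I2)
      fix w
      have "(\<Sum>k\<in>K. c k * relu (- lin (y k) w)) = (\<Sum>k\<in>K. c k * relu (lin (y k) w)) - lin ?L w"
        unfolding lin_sum sum_subtractf[symmetric] right_diff_distrib[symmetric]
        using relu_minus by (intro sum.cong refl arg_cong2[where f="(*)"]) (simp add: relu_def)
      then have "F (\<lambda>i\<in>I. - w i) = ((\<Sum>k\<in>K. c k * relu (lin (y k) w)) - lin ?L w)\<^sup>2"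
        by (simp add: Fu)
      also have "\<dots> \<le> 2 * F w + 2 * (lin ?L w)\<^sup>2"
        unfolding F_def using sq_le .
      finally show "norm (F (\<lambda>i\<in>I. - w i)) \<le> norm (2 * F w + 2 * (lin ?L w)\<^sup>2)"
        by (simp add: Fu F_def)
    qed
  qed
  \<comment> \<open>One factor 2 is lost here, in
    \<open>(a - b)\<^sup>2 \<le> 2 a\<^sup>2 + 2 b\<^sup>2\<close>; the other comes from the two
    summands on the right having the same integral.\<close>
  have pt: "(lin ?L w)\<^sup>2 / 2 \<le> F w + F (\<lambda>i\<in>I. - w i)" for w
  proof -
    have "lin ?L w = (\<Sum>k\<in>K. c k * relu (lin (y k) w)) - (\<Sum>k\<in>K. c k * relu (- lin (y k) w))"
      unfolding lin_sum sum_subtractf[symmetric] right_diff_distrib[symmetric] relu_minus ..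
    moreover have "(a - b)\<^sup>2 / 2 \<le> a\<^sup>2 + b\<^sup>2" for a b :: real
      using zero_le_power2[of "a + b"] by (simp add: power2_eq_square algebra_simps)
    ultimately show ?thesis by (simp add: F_def lin_uminus)
  qed
  have "cov ?L ?L / 2 = (\<integral>w. (lin ?L w)\<^sup>2 / 2 \<partial>PG)"
    by (simp add: lin_square)
  also have "\<dots> \<le> (\<integral>w. F w + F (\<lambda>i\<in>I. - w i) \<partial>PG)"
    using lin_square(1)[of ?L] Fi Fi' pt by (intro integral_mono) auto
  also have "\<dots> = 2 * (\<integral>w. F w \<partial>PG)"
    using Fi Fi' by (simp add: integral_uminus)
  finally have "cov ?L ?L / 4 \<le> (\<integral>w. F w \<partial>PG)" by simp
  also have "\<dots> = (\<Sum>k\<in>K. \<Sum>k'\<in>K. c k * c k' * (\<integral>w. relu (lin (y k) w) * relu (lin (y k') w) \<partial>PG))"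
    unfolding Fe
    by (simp add: Bochner_Integration.integral_sum Bochner_Integration.integrable_sum integrable_relu_mult)
  finally show ?thesis .
qed

end

section \<open>The random network\<close>

lemma finite_weight_index: "finite (weight_index l dims ws)"
proof -
  have "weight_index l dims ws \<subseteq> {..l} \<times> (\<Union>v\<le>l. {..<dims v}) \<times> (\<Union>v\<le>l. {..<dims (v - 1) * ws v})"
    by (auto simp: weight_index_def)
  then show ?thesis by (rule finite_subset) auto
qed

lemma sum_window:
  "(\<Sum>p<w. \<Sum>k<d. F (p * d + k)) = (\<Sum>c<d * w. F c)" for F :: "nat \<Rightarrow> 'a::comm_monoid_add"
proof -
  have "sum F {p * d..<p * d + d} = (\<Sum>k<d. F (p * d + k))" for p
    using sum.atLeastLessThan_shift_0[of F "p * d" "p * d + d"] by (simp add: lessThan_atLeast0 comp_def)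
  then have "(\<Sum>c<w * d. F c) = (\<Sum>p<w. \<Sum>k<d. F (p * d + k))"
    by (simp add: sum.nat_group[symmetric])
  then show ?thesis by (simp add: mult.commute)
qed

locale xavier_net =
  fixes l :: nat and dims ns ws ss :: "nat \<Rightarrow> nat"
  assumes l_pos: "1 \<le> l" and arch: "conv_arch l dims ns ws ss"
begin

lemma dims_pos: "v \<le> l \<Longrightarrow> 0 < dims v"
  and ns_pos: "v \<le> l \<Longrightarrow> 0 < ns v"
  and dims_last: "dims l = 1"
  and ns_last: "ns l = 1"
  and ws_pos: "1 \<le> v \<Longrightarrow> v \<le> l \<Longrightarrow> 0 < ws v"
  using arch by (auto simp: conv_arch_def Suc_le_eq)

lemma window_bound:
  assumes "1 \<le> v" "v \<le> l" "i < ns v" "p < ws v"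
  shows "i * ss v + p < ns (v - 1)"
proof -
  have a: "1 \<le> ss v" "ws v \<le> ns (v - 1)" "ns v = (ns (v - 1) - ws v) div ss v + 1"
    using arch assms(1,2) by (auto simp: conv_arch_def)
  have "i \<le> (ns (v - 1) - ws v) div ss v" using assms(3) a(3) by simp
  then have "i * ss v \<le> (ns (v - 1) - ws v) div ss v * ss v" by simp
  also have "\<dots> \<le> ns (v - 1) - ws v" by simp
  finally show ?thesis using assms(4) a(2) by linarith
qed

abbreviation "WI \<equiv> weight_index l dims ws"

text \<open>The value 1 off the index set is a default that keeps every deviation positive. On it
  the value is the square root of the Xavier variance.\<close>

definition sd :: "nat \<times> nat \<times> nat \<Rightarrow> real" where
  "sd = (\<lambda>(v, r, c). if (v, r, c) \<in> WI then sqrt (1 / real (dims (v - 1) * ws v)) else 1)"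

lemma sd_pos: "0 < sd i"
proof (cases i)
  case (fields v r c)
  have "0 < dims (v - 1) * ws v" if "(v, r, c) \<in> WI"
    using that dims_pos[of "v - 1"] ws_pos[of v] by (auto simp: weight_index_def)
  then show ?thesis by (simp add: fields sd_def)
qed

sublocale gaussian_family sd WI
  by standard (auto simp: sd_pos finite_weight_index)

lemma xavier_eq: "xavier_measure l dims ws = PG"
  unfolding xavier_measure_def
  by (rule PiM_cong) (auto simp: gauss_def sd_def split: prod.splits)

definition H :: "nat \<Rightarrow> (nat \<Rightarrow> nat \<Rightarrow> real) \<Rightarrow> (nat \<times> nat \<times> nat \<Rightarrow> real) \<Rightarrow> nat \<Rightarrow> nat \<Rightarrow> real" where
  "H v x w = net_layers l dims ws ss (weights_of w) v x"

lemma H_0: "H 0 x w = x" by (simp add: H_def)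

lemma H_Suc: "H (Suc u) x w i r = (if Suc u = l then id else relu)
   (\<Sum>p<ws (Suc u). \<Sum>k<dims u. w (Suc u, r, p * dims u + k) * H u x w (i * ss (Suc u) + p) k)"
  by (simp add: H_def conv_layer_def weights_of_def)

lemma window_index: "p < ws v \<Longrightarrow> k < dims (v - 1) \<Longrightarrow> p * dims (v - 1) + k < dims (v - 1) * ws v"
proof -
  assume "p < ws v" "k < dims (v - 1)"
  then have "p * dims (v - 1) + k < Suc p * dims (v - 1)" by simp
  also have "\<dots> \<le> ws v * dims (v - 1)" using \<open>p < ws v\<close> by (intro mult_right_mono) auto
  finally show ?thesis by (simp add: mult.commute)
qed

lemma measurable_H:
  "v \<le> l \<Longrightarrow> r < dims v \<Longrightarrow> (\<lambda>w. H v x w i r) \<in> borel_measurable PG"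
proof (induction v arbitrary: i r)
  case 0
  then show ?case by (simp add: H_0)
next
  case (Suc u)
  have Hm: "(\<lambda>w. H u x w i k) \<in> borel_measurable PG" if "k < dims u" for i k
    using Suc that by simp
  have wm: "(\<lambda>w. w (Suc u, r, p * dims u + k)) \<in> borel_measurable PG" if "p < ws (Suc u)" "k < dims u" for p k
  proof -
    have "(Suc u, r, p * dims u + k) \<in> WI"
      using Suc.prems window_index[of p "Suc u" k] that by (simp add: weight_index_def)
    then show ?thesis by measurable
  qed
  have sm: "(\<lambda>w. \<Sum>p<ws (Suc u). \<Sum>k<dims u. w (Suc u, r, p * dims u + k) * H u x w (i * ss (Suc u) + p) k) \<in> borel_measurable PG"
    by (intro borel_measurable_sum borel_measurable_times) (auto intro!: Hm wm)
  have "(if Suc u = l then id else relu) \<in> borel_measurable borel" by simp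
  from measurable_compose[OF sm this] show ?case unfolding H_Suc .
qed

lemma H_cong:
  assumes "\<And>u r c. u \<le> v \<Longrightarrow> w (u, r, c) = w' (u, r, c)"
  shows "H v x w i r = H v x w' i r"
  using assms
proof (induction v arbitrary: i r)
  case (Suc u)
  have IH: "H u x w i r = H u x w' i r" for i r
    by (rule Suc.IH) (simp add: Suc.prems)
  have w: "w (Suc u, r, c) = w' (Suc u, r, c)" for r c by (simp add: Suc.prems)
  show ?case by (simp only: H_Suc IH w)
qed (simp add: H_0)

text \<open>The weights that produce channel \<open>r\<close> of layer \<open>v\<close>, shared by
  all positions. Resampling one row leaves earlier layers and the other channels of the layer
  untouched.\<close>

definition row :: "nat \<Rightarrow> nat \<Rightarrow> (nat \<times> nat \<times> nat) set" where
  "row v r = (\<lambda>c. (v, r, c)) ` {..<dims (v - 1) * ws v}"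

lemma row_subset: "1 \<le> v \<Longrightarrow> v \<le> l \<Longrightarrow> r < dims v \<Longrightarrow> row v r \<subseteq> WI"
  by (auto simp: row_def weight_index_def)

text \<open>The window at position \<open>i\<close>, written as a coefficient vector on weight
  indices. Only the column component is read, so the same vector serves every row of the next
  layer.\<close>

definition inp :: "nat \<Rightarrow> (nat \<Rightarrow> nat \<Rightarrow> real) \<Rightarrow> (nat \<times> nat \<times> nat \<Rightarrow> real) \<Rightarrow> nat \<Rightarrow> nat \<times> nat \<times> nat \<Rightarrow> real" where
  "inp u x w i = (\<lambda>(_, _, c). H u x w (i * ss (Suc u) + c div dims u) (c mod dims u))"

lemma H_override_row:
  assumes "u < v"
  shows "H u x (override (row v r) w z) i k = H u x w i k"
  using assms by (intro H_cong) (auto simp: override_def row_def)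

lemma sum_row: "(\<Sum>j\<in>row v r. F j) = (\<Sum>c<dims (v - 1) * ws v. F (v, r, c))"
  unfolding row_def by (subst sum.reindex) (auto simp: inj_on_def)

text \<open>The window values depend only on earlier layers, so after the row is resampled the
  preactivation is a linear form in fresh Gaussians with frozen coefficients.\<close>

lemma preact_override:
  assumes "Suc u \<le> l"
  shows "(\<Sum>p<ws (Suc u). \<Sum>k<dims u. override (row (Suc u) r) w z (Suc u, r, p * dims u + k) *
       H u x (override (row (Suc u) r) w z) (i * ss (Suc u) + p) k)
    = gaussian_family.lin (row (Suc u) r) (inp u x w i) z"
proof -
  have d: "0 < dims u" using assms by (intro dims_pos) simp
  interpret R: gaussian_family sd "row (Suc u) r"
    by standard (auto simp: sd_pos row_def)
  have "R.lin (inp u x w i) z = (\<Sum>c<dims u * ws (Suc u). z (Suc u, r, c) * H u x w (i * ss (Suc u) + c div dims u) (c mod dims u))"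
    unfolding R.lin_def sum_row by (simp add: inp_def)
  also have "\<dots> = (\<Sum>p<ws (Suc u). \<Sum>k<dims u. z (Suc u, r, p * dims u + k) * H u x w (i * ss (Suc u) + p) k)"
    using d by (subst sum_window[symmetric]) simp
  also have "\<dots> = (\<Sum>p<ws (Suc u). \<Sum>k<dims u. override (row (Suc u) r) w z (Suc u, r, p * dims u + k) *
       H u x (override (row (Suc u) r) w z) (i * ss (Suc u) + p) k)"
    using window_index[of _ "Suc u"]
    by (intro sum.cong refl) (simp add: H_override_row, simp add: override_def row_def)
  finally show ?thesis by simp
qed

lemma H_Suc_override:
  assumes "Suc u < l"
  shows "H (Suc u) x (override (row (Suc u) r) w z) i r = relu (gaussian_family.lin (row (Suc u) r) (inp u x w i) z)"
  unfolding H_Suc using assms by (subst preact_override) auto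

lemma output_override:
  "H l x (override (row l 0) w z) 0 0 = gaussian_family.lin (row l 0) (inp (l - 1) x w 0) z"
proof -
  obtain u where u: "l = Suc u" using l_pos by (cases l) auto
  have "H (Suc u) x (override (row (Suc u) 0) w z) 0 0 = gaussian_family.lin (row (Suc u) 0) (inp u x w 0) z"
    unfolding H_Suc using u by (subst preact_override) auto
  then show ?thesis using u by simp
qed

lemma H_Suc_override_other:
  assumes "r \<noteq> r'"
  shows "H (Suc u) x (override (row (Suc u) r) w z) i r' = H (Suc u) x w i r'"
proof -
  have "override (row (Suc u) r) w z (Suc u, r', c) = w (Suc u, r', c)" for c
    using assms by (auto simp: override_def row_def)
  then show ?thesis unfolding H_Suc by (simp add: H_override_row)
qed

text \<open>The Xavier variance turns the covariance of two preactivations at one position into the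
  mean, over the window, of the normalised inner products of tokens.\<close>

lemma cov_row:
  assumes "Suc u \<le> l" "r < dims (Suc u)"
  shows "gaussian_family.cov sd (row (Suc u) r) (inp u x w i) (inp u x' w i)
    = (\<Sum>p<ws (Suc u). (\<Sum>k<dims u. H u x w (i * ss (Suc u) + p) k * H u x' w (i * ss (Suc u) + p) k) / dims u) / ws (Suc u)"
proof -
  have d: "0 < dims u" using assms by (intro dims_pos) simp
  interpret R: gaussian_family sd "row (Suc u) r"
    by standard (auto simp: sd_pos row_def)
  have sd2: "(sd (Suc u, r, c))\<^sup>2 = 1 / (dims u * ws (Suc u))" if "c < dims u * ws (Suc u)" for c
    using that assms by (simp add: sd_def weight_index_def)
  have "R.cov (inp u x w i) (inp u x' w i)
     = (\<Sum>c<dims u * ws (Suc u). 1 / (dims u * ws (Suc u)) * (H u x w (i * ss (Suc u) + c div dims u) (c mod dims u) * H u x' w (i * ss (Suc u) + c div dims u) (c mod dims u)))"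
    unfolding R.cov_def sum_row by (intro sum.cong) (auto simp: inp_def sd2)
  also have "\<dots> = (\<Sum>p<ws (Suc u). \<Sum>k<dims u. 1 / (dims u * ws (Suc u)) * (H u x w (i * ss (Suc u) + p) k * H u x' w (i * ss (Suc u) + p) k))"
    using d by (subst sum_window[symmetric]) simp
  also have "\<dots> = (\<Sum>p<ws (Suc u). (\<Sum>k<dims u. H u x w (i * ss (Suc u) + p) k * H u x' w (i * ss (Suc u) + p) k) / dims u) / ws (Suc u)"
    by (simp add: sum_divide_distrib)
  finally show ?thesis .
qed

end

section \<open>Resampling\<close>

lemma integrable_square_iff_nn:
  assumes [measurable]: "f \<in> borel_measurable M" and b: "(\<integral>\<^sup>+x. ennreal ((f x)\<^sup>2) \<partial>M) \<le> ennreal B"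
  shows "integrable M (\<lambda>x. (f x)\<^sup>2 :: real)"
  by (rule integrableI_nonneg) (use b in \<open>auto simp: top_unique less_top[symmetric]\<close>)

lemma integrable_mult_square:
  fixes f g :: "'a \<Rightarrow> real"
  assumes [measurable]: "f \<in> borel_measurable M" "g \<in> borel_measurable M"
    and "integrable M (\<lambda>x. (f x)\<^sup>2)" "integrable M (\<lambda>x. (g x)\<^sup>2)"
  shows "integrable M (\<lambda>x. f x * g x)"
proof (rule Bochner_Integration.integrable_bound)
  show "integrable M (\<lambda>x. (f x)\<^sup>2 + (g x)\<^sup>2)" using assms by auto
  have "\<bar>a * b\<bar> \<le> a\<^sup>2 + b\<^sup>2" for a b :: real
  proof -
    have "0 \<le> \<bar>a\<bar> * \<bar>b\<bar>" by simp
    with sum_squares_bound[of "\<bar>a\<bar>" "\<bar>b\<bar>"] show ?thesis unfolding abs_mult power2_abs by linarith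
  qed
  then show "AE x in M. norm (f x * g x) \<le> norm ((f x)\<^sup>2 + (g x)\<^sup>2)" by simp
qed auto

context gaussian_family
begin

text \<open>The conditional expectation of \<open>F\<close> given the coordinates outside
  \<open>J\<close>, as a concrete function of \<open>w\<close>.\<close>

definition resample_mean :: "'i set \<Rightarrow> (('i \<Rightarrow> real) \<Rightarrow> real) \<Rightarrow> ('i \<Rightarrow> real) \<Rightarrow> real" where
  "resample_mean J F w = (\<integral>z. F (override J w z) \<partial>PGJ J)"

lemma override_commute: "J \<inter> K = {} \<Longrightarrow> override J (override K w z) z' = override K (override J w z') z"
  by (auto simp: override_def fun_eq_iff)

lemma resample_mean_override_other:
  assumes "J \<inter> K = {}" "\<And>w z. F (override K w z) = F w"
  shows "resample_mean J F (override K w z) = resample_mean J F w"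
  by (simp add: resample_mean_def override_commute[OF assms(1)] assms(2))

lemma measurable_override_comp:
  assumes J: "J \<subseteq> I" and [measurable]: "F \<in> borel_measurable PG"
  shows "(\<lambda>(w, z). F (override J w z)) \<in> borel_measurable (PG \<Otimes>\<^sub>M PGJ J)"
  using measurable_compose[OF measurable_override[OF J], of F borel] by (simp add: case_prod_beta')

lemma measurable_rex [measurable]:
  assumes J: "J \<subseteq> I" and F: "F \<in> borel_measurable PG"
  shows "resample_mean J F \<in> borel_measurable PG"
proof -
  interpret J: gaussian_family sd J by (rule gaussian_family_subset[OF J])
  show ?thesis unfolding resample_mean_def[abs_def]
    by (rule J.borel_measurable_lebesgue_integral[OF measurable_override_comp[OF J F]])
qed

lemma measurable_override_section:
  assumes J: "J \<subseteq> I" and F: "F \<in> borel_measurable PG" and w: "w \<in> space PG"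
  shows "(\<lambda>z. F (override J w z)) \<in> borel_measurable (PGJ J)"
  using measurable_compose[OF measurable_Pair1'[OF w] measurable_override_comp[OF J F]] by simp

text \<open>Conditional expectation contracts the second moment, because the conditional variance is
  nonnegative. Where the conditional second moment is infinite there is nothing to show.\<close>

lemma nn_integral_rex_square_le:
  assumes J: "J \<subseteq> I" and F [measurable]: "F \<in> borel_measurable PG"
  shows "(\<integral>\<^sup>+w. ennreal ((resample_mean J F w)\<^sup>2) \<partial>PG) \<le> (\<integral>\<^sup>+w. ennreal ((F w)\<^sup>2) \<partial>PG)"
proof -
  interpret J: gaussian_family sd J by (rule gaussian_family_subset[OF J])
  have "ennreal ((resample_mean J F w)\<^sup>2) \<le> (\<integral>\<^sup>+z. ennreal ((F (override J w z))\<^sup>2) \<partial>PGJ J)" if w: "w \<in> space PG" for w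
  proof (cases "(\<integral>\<^sup>+z. ennreal ((F (override J w z))\<^sup>2) \<partial>PGJ J) = \<infinity>")
    case False
    note m [measurable] = measurable_override_section[OF J F w]
    have i2: "integrable (PGJ J) (\<lambda>z. (F (override J w z))\<^sup>2)"
      by (rule integrableI_nonneg) (use False in \<open>auto simp: less_top[symmetric]\<close>)
    have "0 \<le> J.variance (\<lambda>z. F (override J w z))" by (rule J.variance_positive)
    also have "J.variance (\<lambda>z. F (override J w z)) = (\<integral>z. (F (override J w z))\<^sup>2 \<partial>PGJ J) - (resample_mean J F w)\<^sup>2"
      unfolding resample_mean_def
      by (intro J.variance_eq i2 J.square_integrable_imp_integrable[OF m i2])
    finally have "ennreal ((resample_mean J F w)\<^sup>2) \<le> ennreal (\<integral>z. (F (override J w z))\<^sup>2 \<partial>PGJ J)"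
      by (intro ennreal_leI) simp
    also have "\<dots> = (\<integral>\<^sup>+z. ennreal ((F (override J w z))\<^sup>2) \<partial>PGJ J)"
      by (rule nn_integral_eq_integral[symmetric, OF i2]) simp
    finally show ?thesis .
  qed simp
  then have "(\<integral>\<^sup>+w. ennreal ((resample_mean J F w)\<^sup>2) \<partial>PG) \<le> (\<integral>\<^sup>+w. \<integral>\<^sup>+z. ennreal ((F (override J w z))\<^sup>2) \<partial>PGJ J \<partial>PG)"
    by (rule nn_integral_mono)
  also have "\<dots> = (\<integral>\<^sup>+w. ennreal ((F w)\<^sup>2) \<partial>PG)"
    by (rule nn_integral_resample[OF J, symmetric]) measurable
  finally show ?thesis .
qed

text \<open>Given the coordinates outside \<open>J\<close> the factor \<open>G\<close> is constant,
  while the other factor has conditional mean 0.\<close>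

lemma integral_rex_centered:
  assumes J: "J \<subseteq> I" and [measurable]: "F \<in> borel_measurable PG" "G \<in> borel_measurable PG"
    and F2: "integrable PG (\<lambda>w. (F w)\<^sup>2)" and G2: "integrable PG (\<lambda>w. (G w)\<^sup>2)"
    and R2: "integrable PG (\<lambda>w. (resample_mean J F w)\<^sup>2)"
    and G: "\<And>w z. G (override J w z) = G w"
  shows "(\<integral>w. (F w - resample_mean J F w) * G w \<partial>PG) = 0"
proof -
  interpret J: gaussian_family sd J by (rule gaussian_family_subset[OF J])
  note [measurable] = measurable_rex[OF J]
  have i1: "integrable PG (\<lambda>w. F w * G w)" by (rule integrable_mult_square) (use F2 G2 in auto)
  have i2: "integrable PG (\<lambda>w. resample_mean J F w * G w)" by (rule integrable_mult_square) (use R2 G2 in auto)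
  have "(\<integral>w. F w * G w \<partial>PG) = (\<integral>w. \<integral>z. F (override J w z) * G (override J w z) \<partial>PGJ J \<partial>PG)"
    by (rule integral_resample[OF J i1])
  also have "\<dots> = (\<integral>w. resample_mean J F w * G w \<partial>PG)"
    by (simp add: G resample_mean_def)
  finally show ?thesis using i1 i2 by (simp add: left_diff_distrib)
qed

text \<open>The centred terms \<open>D r\<close> are pairwise orthogonal, since \<open>D r'\<close>
  does not see the block \<open>J r\<close>. The second moment of their average is therefore the sum
  of the individual ones over \<open>n\<^sup>2\<close>. The constant 4 comes from bounding the
  square of the difference by twice each square.\<close>

lemma resample_variance:
  fixes J :: "nat \<Rightarrow> 'i set" and F :: "nat \<Rightarrow> ('i \<Rightarrow> real) \<Rightarrow> real"
  assumes J: "\<And>r. r < n \<Longrightarrow> J r \<subseteq> I" and disj: "\<And>r r'. r < n \<Longrightarrow> r' < n \<Longrightarrow> r \<noteq> r' \<Longrightarrow> J r \<inter> J r' = {}"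
    and F [measurable]: "\<And>r. r < n \<Longrightarrow> F r \<in> borel_measurable PG"
    and other: "\<And>r r' w z. r < n \<Longrightarrow> r' < n \<Longrightarrow> r \<noteq> r' \<Longrightarrow> F r' (override (J r) w z) = F r' w"
    and bound: "\<And>r. r < n \<Longrightarrow> (\<integral>\<^sup>+w. ennreal ((F r w)\<^sup>2) \<partial>PG) \<le> ennreal B"
    and B: "0 \<le> B" and n: "0 < n"
  shows "integrable PG (\<lambda>w. ((\<Sum>r<n. F r w) / n - (\<Sum>r<n. resample_mean (J r) (F r) w) / n)\<^sup>2)"
    and "(\<integral>w. ((\<Sum>r<n. F r w) / n - (\<Sum>r<n. resample_mean (J r) (F r) w) / n)\<^sup>2 \<partial>PG) \<le> 4 * B / n"
proof -
  define D where "D r w = F r w - resample_mean (J r) (F r) w" for r w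
  have rm [measurable]: "resample_mean (J r) (F r) \<in> borel_measurable PG" if "r < n" for r
    using that J F by (intro measurable_rex)
  have Dm [measurable]: "D r \<in> borel_measurable PG" if "r < n" for r
    unfolding D_def[abs_def] using that by measurable
  have F2: "integrable PG (\<lambda>w. (F r w)\<^sup>2)" if "r < n" for r
    using that by (intro integrable_square_iff_nn[OF _ bound]) auto
  have rb: "(\<integral>\<^sup>+w. ennreal ((resample_mean (J r) (F r) w)\<^sup>2) \<partial>PG) \<le> ennreal B" if "r < n" for r
    using nn_integral_rex_square_le[OF J F] bound that by (meson order_trans)
  have R2: "integrable PG (\<lambda>w. (resample_mean (J r) (F r) w)\<^sup>2)" if "r < n" for r
    using that by (intro integrable_square_iff_nn[OF _ rb]) auto
  have Dle: "(D r w)\<^sup>2 \<le> 2 * (F r w)\<^sup>2 + 2 * (resample_mean (J r) (F r) w)\<^sup>2" for r w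
    unfolding D_def using zero_le_power2[of "F r w + resample_mean (J r) (F r) w"]
    by (simp add: power2_eq_square algebra_simps)
  have D2: "integrable PG (\<lambda>w. (D r w)\<^sup>2)" if "r < n" for r
    by (rule Bochner_Integration.integrable_bound[where f="\<lambda>w. 2 * (F r w)\<^sup>2 + 2 * (resample_mean (J r) (F r) w)\<^sup>2"])
       (use that F2 R2 Dle in auto)
  have leB: "(\<integral>w. (f w)\<^sup>2 \<partial>PG) \<le> B" if "integrable PG (\<lambda>w. (f w)\<^sup>2)" "(\<integral>\<^sup>+w. ennreal ((f w)\<^sup>2) \<partial>PG) \<le> ennreal B" for f
    using that B by (subst (asm) nn_integral_eq_integral) auto
  have DB: "(\<integral>w. (D r w)\<^sup>2 \<partial>PG) \<le> 4 * B" if r: "r < n" for r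
  proof -
    have "(\<integral>w. (D r w)\<^sup>2 \<partial>PG) \<le> (\<integral>w. 2 * (F r w)\<^sup>2 + 2 * (resample_mean (J r) (F r) w)\<^sup>2 \<partial>PG)"
      using r F2 R2 D2 Dle by (intro integral_mono) auto
    also have "\<dots> = 2 * (\<integral>w. (F r w)\<^sup>2 \<partial>PG) + 2 * (\<integral>w. (resample_mean (J r) (F r) w)\<^sup>2 \<partial>PG)"
      using r F2 R2 by simp
    also have "\<dots> \<le> 4 * B"
      using leB[OF F2 bound] leB[OF R2 rb] r by fastforce
    finally show ?thesis .
  qed
  have DD: "integrable PG (\<lambda>w. D r w * D r' w)" if "r < n" "r' < n" for r r'
    using that D2 by (intro integrable_mult_square) auto
  have D0: "(\<integral>w. D r w * D r' w \<partial>PG) = 0" if r: "r < n" "r' < n" "r \<noteq> r'" for r r'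
  proof -
    have "D r' (override (J r) w z) = D r' w" for w z
      using resample_mean_override_other[of "J r'" "J r" "F r'"] disj[of r' r] other[of r r'] r
      by (simp add: D_def)
    then have "(\<integral>w. (F r w - resample_mean (J r) (F r) w) * D r' w \<partial>PG) = 0"
      using r J F2 R2 D2 by (intro integral_rex_centered) auto
    then show ?thesis by (simp add: D_def)
  qed
  have sq: "((\<Sum>r<n. F r w) / n - (\<Sum>r<n. resample_mean (J r) (F r) w) / n)\<^sup>2 = (\<Sum>r<n. \<Sum>r'<n. D r w * D r' w) / n\<^sup>2" for w
  proof -
    have "(\<Sum>r<n. F r w) / n - (\<Sum>r<n. resample_mean (J r) (F r) w) / n = (\<Sum>r<n. D r w) / n"
      by (simp add: D_def sum_subtractf diff_divide_distrib)
    then show ?thesis by (simp add: power_divide) (simp add: power2_eq_square sum_product)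
  qed
  show "integrable PG (\<lambda>w. ((\<Sum>r<n. F r w) / n - (\<Sum>r<n. resample_mean (J r) (F r) w) / n)\<^sup>2)"
    unfolding sq using DD
    by (intro Bochner_Integration.integrable_divide Bochner_Integration.integrable_sum) auto
  have "(\<integral>w. ((\<Sum>r<n. F r w) / n - (\<Sum>r<n. resample_mean (J r) (F r) w) / n)\<^sup>2 \<partial>PG)
     = (\<Sum>r<n. \<Sum>r'<n. (\<integral>w. D r w * D r' w \<partial>PG)) / n\<^sup>2"
  proof -
    have "(\<integral>w. (\<Sum>r<n. \<Sum>r'<n. D r w * D r' w) \<partial>PG) = (\<Sum>r<n. \<integral>w. (\<Sum>r'<n. D r w * D r' w) \<partial>PG)"
      using DD by (intro Bochner_Integration.integral_sum Bochner_Integration.integrable_sum) auto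
    also have "\<dots> = (\<Sum>r<n. \<Sum>r'<n. (\<integral>w. D r w * D r' w \<partial>PG))"
      using DD by (intro sum.cong refl Bochner_Integration.integral_sum) auto
    finally show ?thesis unfolding sq by simp
  qed
  also have "(\<Sum>r<n. \<Sum>r'<n. (\<integral>w. D r w * D r' w \<partial>PG)) = (\<Sum>r<n. (\<integral>w. (D r w)\<^sup>2 \<partial>PG))"
  proof (rule sum.cong[OF refl])
    fix r assume r: "r \<in> {..<n}"
    have "(\<Sum>r'<n. (\<integral>w. D r w * D r' w \<partial>PG)) = (\<Sum>r'<n. if r' = r then (\<integral>w. (D r w)\<^sup>2 \<partial>PG) else 0)"
      using r D0 by (intro sum.cong refl) (auto simp: power2_eq_square)
    then show "(\<Sum>r'<n. (\<integral>w. D r w * D r' w \<partial>PG)) = (\<integral>w. (D r w)\<^sup>2 \<partial>PG)"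
      using r by simp
  qed
  also have "\<dots> \<le> (\<Sum>r<n. 4 * B)" using DB by (intro sum_mono) auto
  also have "(\<Sum>r<n. 4 * B) / n\<^sup>2 = 4 * B / n" using n by (simp add: power2_eq_square)
  finally show "(\<integral>w. ((\<Sum>r<n. F r w) / n - (\<Sum>r<n. resample_mean (J r) (F r) w) / n)\<^sup>2 \<partial>PG) \<le> 4 * B / n"
    by (simp add: divide_right_mono)
qed

end

section \<open>Covariances across the layers\<close>

lemma weighted_square_le:
  fixes a y :: "'a \<Rightarrow> real"
  assumes "finite A" "\<And>i. i \<in> A \<Longrightarrow> 0 \<le> a i" "sum a A = 1"
  shows "(\<Sum>i\<in>A. a i * y i)\<^sup>2 \<le> (\<Sum>i\<in>A. a i * (y i)\<^sup>2)"
proof -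
  let ?m = "\<Sum>i\<in>A. a i * y i"
  have "0 \<le> (\<Sum>i\<in>A. a i * (y i - ?m)\<^sup>2)"
    using assms by (intro sum_nonneg) auto
  also have "\<dots> = (\<Sum>i\<in>A. a i * (y i)\<^sup>2 - 2 * ?m * (a i * y i) + ?m\<^sup>2 * a i)"
    by (intro sum.cong) (auto simp: power2_eq_square algebra_simps)
  also have "\<dots> = (\<Sum>i\<in>A. a i * (y i)\<^sup>2) - 2 * ?m * ?m + ?m\<^sup>2 * sum a A"
    by (simp only: sum.distrib sum_subtractf sum_distrib_left)
  finally show ?thesis using assms(3) by (simp add: power2_eq_square)
qed

context xavier_net
begin

text \<open>The weight of a token of layer \<open>l - t\<close> in the output: the top token has weight 1, and each
  token distributes its weight uniformly over the window it is computed from.\<close>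

primrec topdown :: "nat \<Rightarrow> nat \<Rightarrow> real" where
  "topdown 0 = (\<lambda>i. if i = 0 then 1 else 0)"
| "topdown (Suc t) = (\<lambda>j. \<Sum>i<ns (l - t). \<Sum>p<ws (l - t).
     if i * ss (l - t) + p = j then topdown t i / ws (l - t) else 0)"

definition token_weight :: "nat \<Rightarrow> nat \<Rightarrow> real" where
  "token_weight v = topdown (l - v)"

text \<open>A weighted mean over a layer is a weighted mean, over the positions of the next layer,
  of window means. Together with \<open>cov_row\<close> this makes one scalar per layer sufficient,
  without tracking individual tokens.\<close>

lemma token_weight_avg:
  assumes "Suc u \<le> l"
  shows "(\<Sum>j<ns u. token_weight u j * q j) =
    (\<Sum>i<ns (Suc u). token_weight (Suc u) i * ((\<Sum>p<ws (Suc u). q (i * ss (Suc u) + p)) / ws (Suc u)))"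
proof -
  have e: "l - u = Suc (l - Suc u)" "l - (l - Suc u) = Suc u" using assms by auto
  have "(\<Sum>j<ns u. token_weight u j * q j) = (\<Sum>j<ns u. \<Sum>i<ns (Suc u). \<Sum>p<ws (Suc u).
     if i * ss (Suc u) + p = j then token_weight (Suc u) i / ws (Suc u) * q j else 0)"
    unfolding token_weight_def e(1) by (simp add: e(2) sum_distrib_right if_distrib[of "\<lambda>x. x * q _"] cong: if_cong)
  also have "\<dots> = (\<Sum>i<ns (Suc u). \<Sum>j<ns u. \<Sum>p<ws (Suc u).
     if i * ss (Suc u) + p = j then token_weight (Suc u) i / ws (Suc u) * q j else 0)"
    by (rule sum.swap)
  also have "\<dots> = (\<Sum>i<ns (Suc u). \<Sum>p<ws (Suc u). \<Sum>j<ns u.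
     if i * ss (Suc u) + p = j then token_weight (Suc u) i / ws (Suc u) * q j else 0)"
    by (rule sum.cong[OF refl]) (rule sum.swap)
  also have "\<dots> = (\<Sum>i<ns (Suc u). \<Sum>p<ws (Suc u). token_weight (Suc u) i / ws (Suc u) * q (i * ss (Suc u) + p))"
    using window_bound[of "Suc u"] assms by (intro sum.cong refl) auto
  also have "\<dots> = (\<Sum>i<ns (Suc u). token_weight (Suc u) i * ((\<Sum>p<ws (Suc u). q (i * ss (Suc u) + p)) / ws (Suc u)))"
    by (simp add: sum_distrib_left sum_divide_distrib)
  finally show ?thesis .
qed

lemma token_weight_nonneg: "0 \<le> token_weight v i"
proof -
  have "0 \<le> topdown t i" for t
    by (induction t arbitrary: i) (auto intro!: sum_nonneg)
  then show ?thesis by (simp add: token_weight_def)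
qed

lemma token_weight_last: "(\<Sum>i<ns l. token_weight l i * q i) = q 0"
  by (simp add: token_weight_def ns_last)

lemma token_weight_sum: "v \<le> l \<Longrightarrow> (\<Sum>i<ns v. token_weight v i) = 1"
proof (induction rule: inc_induct)
  case base
  show ?case using token_weight_last[of "\<lambda>_. 1"] by simp
next
  case (step u)
  have "(\<Sum>j<ns u. token_weight u j) = (\<Sum>i<ns (Suc u). token_weight (Suc u) i * ((\<Sum>p<ws (Suc u). 1) / ws (Suc u)))"
    using token_weight_avg[of u "\<lambda>_. 1"] step by simp
  also have "\<dots> = (\<Sum>i<ns (Suc u). token_weight (Suc u) i)"
    using ws_pos[of "Suc u"] step by simp
  finally show ?case using step by simp
qed

section \<open>Averaged Gram entries and their conditional means\<close>

text \<open>At \<open>v = l - 1\<close> this is exactly the covariance of the two outputs given the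
  hidden layers.\<close>

definition gram :: "nat \<Rightarrow> (nat \<Rightarrow> nat \<Rightarrow> real) \<Rightarrow> (nat \<Rightarrow> nat \<Rightarrow> real) \<Rightarrow> (nat \<times> nat \<times> nat \<Rightarrow> real) \<Rightarrow> real" where
  "gram v x x' w = (\<Sum>i<ns v. token_weight v i * ((\<Sum>r<dims v. H v x w i r * H v x' w i r) / dims v))"

definition gram_row :: "nat \<Rightarrow> (nat \<Rightarrow> nat \<Rightarrow> real) \<Rightarrow> (nat \<Rightarrow> nat \<Rightarrow> real) \<Rightarrow> nat \<Rightarrow> (nat \<times> nat \<times> nat \<Rightarrow> real) \<Rightarrow> real" where
  "gram_row v x x' r w = (\<Sum>i<ns v. token_weight v i * (H v x w i r * H v x' w i r))"

text \<open>The mean of \<open>gram v\<close> over the weights of layer \<open>v\<close>, given the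
  earlier layers. It is computed row by row because each summand uses only one row of that
  layer.\<close>

definition egram :: "nat \<Rightarrow> (nat \<Rightarrow> nat \<Rightarrow> real) \<Rightarrow> (nat \<Rightarrow> nat \<Rightarrow> real) \<Rightarrow> (nat \<times> nat \<times> nat \<Rightarrow> real) \<Rightarrow> real" where
  "egram v x x' w = (\<Sum>r<dims v. resample_mean (row v r) (gram_row v x x' r) w) / dims v"

lemma gram_eq: "gram v x x' w = (\<Sum>r<dims v. gram_row v x x' r w) / dims v"
  unfolding gram_def gram_row_def
  by (subst sum.swap) (simp add: sum_distrib_left sum_divide_distrib)

lemma measurable_gram_row [measurable]:
  assumes "v \<le> l" "r < dims v" shows "gram_row v x x' r \<in> borel_measurable PG"
proof -
  have [measurable]: "(\<lambda>w. H v x w i r) \<in> borel_measurable PG" for x i by (rule measurable_H[OF assms])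
  show ?thesis unfolding gram_row_def[abs_def] by measurable
qed

lemma measurable_gram: "v \<le> l \<Longrightarrow> gram v x x' \<in> borel_measurable PG"
  unfolding gram_eq[abs_def] by measurable

lemma measurable_egram: "1 \<le> v \<Longrightarrow> v \<le> l \<Longrightarrow> egram v x x' \<in> borel_measurable PG"
  unfolding egram_def[abs_def]
  by (intro borel_measurable_divide borel_measurable_sum measurable_rex row_subset measurable_gram_row) auto

lemma row_family: "Suc u \<le> l \<Longrightarrow> r < dims (Suc u) \<Longrightarrow> gaussian_family sd (row (Suc u) r)"
  by (rule gaussian_family_subset) (simp add: row_subset)

text \<open>Normalised by the dimension: for tokens of norm \<open>R\<close> the parameter is
  \<open>\<rho> = R\<^sup>2 / d\<close>.\<close>

definition on_sphere :: "real \<Rightarrow> (nat \<Rightarrow> nat \<Rightarrow> real) \<Rightarrow> bool" where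
  "on_sphere \<rho> x \<longleftrightarrow> (\<forall>j<ns 0. (\<Sum>k<dims 0. (x j k)\<^sup>2) / dims 0 = \<rho>)"

text \<open>Given the previous layer, the fourth moment of a preactivation is 3 times its squared
  variance, and the ReLU does not increase it. By Jensen the squared variance is at most the mean of
  the fourth powers in the window, so each layer costs a factor 3.\<close>

lemma fourth_moment:
  assumes x: "on_sphere \<rho> x"
  shows "Suc u < l \<Longrightarrow> i < ns (Suc u) \<Longrightarrow> r < dims (Suc u) \<Longrightarrow>
    (\<integral>\<^sup>+w. ennreal (H (Suc u) x w i r ^ 4) \<partial>PG) \<le> ennreal (3 ^ Suc u * \<rho>\<^sup>2)"
proof (induction u arbitrary: i r)
  case (0 i r)
  interpret R: gaussian_family sd "row 1 r" using row_family[of 0] 0 by simp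
  note m = measurable_H[of 1 r x i]
  have c: "R.cov (inp 0 x w i) (inp 0 x w i) = \<rho>" for w
  proof -
    have "R.cov (inp 0 x w i) (inp 0 x w i)
       = (\<Sum>p<ws 1. (\<Sum>k<dims 0. x (i * ss 1 + p) k * x (i * ss 1 + p) k) / dims 0) / ws 1"
      using cov_row[of 0 r x w i x] 0 by (simp add: H_0)
    also have "(\<Sum>p<ws 1. (\<Sum>k<dims 0. x (i * ss 1 + p) k * x (i * ss 1 + p) k) / dims 0) = (\<Sum>p<ws 1. \<rho>)"
      using x window_bound[of 1 i] 0 by (intro sum.cong refl) (auto simp: on_sphere_def power2_eq_square)
    finally show ?thesis using ws_pos[of 1] 0 by simp
  qed
  have "(\<integral>\<^sup>+w. ennreal (H 1 x w i r ^ 4) \<partial>PG)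
     = (\<integral>\<^sup>+w. \<integral>\<^sup>+z. ennreal (H 1 x (override (row 1 r) w z) i r ^ 4) \<partial>PGJ (row 1 r) \<partial>PG)"
    using m 0 row_subset[of 1 r] by (intro nn_integral_resample) auto
  also have "\<dots> = (\<integral>\<^sup>+w. \<integral>\<^sup>+z. ennreal (relu (R.lin (inp 0 x w i) z) ^ 4) \<partial>PGJ (row 1 r) \<partial>PG)"
    using H_Suc_override[of 0 x r] 0 by simp
  also have "\<dots> \<le> (\<integral>\<^sup>+w. ennreal (3 * \<rho>\<^sup>2) \<partial>PG)"
    using R.nn_integral_relu_fourth_le[of "inp 0 x _ i"] unfolding c by (intro nn_integral_mono) auto
  also have "\<dots> = ennreal (3 * \<rho>\<^sup>2)" by (simp add: P.emeasure_space_1)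
  finally show ?case by simp
next
  case (Suc u i r)
  let ?v = "Suc u" let ?J = "row (Suc ?v) r"
  interpret R: gaussian_family sd ?J using row_family[of ?v] Suc.prems by simp
  have d: "0 < dims ?v" "0 < ws (Suc ?v)" using dims_pos[of ?v] ws_pos[of "Suc ?v"] Suc.prems by simp_all
  let ?D = "real (dims ?v * ws (Suc ?v))"
  \<comment> \<open>Jensen for the uniform weights \<open>1 / ?D\<close> on all coordinates of the
    window.\<close>
  have c: "(R.cov (inp ?v x w i) (inp ?v x w i))\<^sup>2
     \<le> (\<Sum>p<ws (Suc ?v). \<Sum>k<dims ?v. H ?v x w (i * ss (Suc ?v) + p) k ^ 4 / ?D)" for w
  proof -
    let ?A = "{..<ws (Suc ?v)} \<times> {..<dims ?v}"
    define h where "h p k = H ?v x w (i * ss (Suc ?v) + p) k" for p k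
    have "R.cov (inp ?v x w i) (inp ?v x w i) = (\<Sum>p<ws (Suc ?v). (\<Sum>k<dims ?v. h p k * h p k) / dims ?v) / ws (Suc ?v)"
      unfolding h_def by (rule cov_row) (use Suc.prems in simp_all)
    also have "\<dots> = (\<Sum>p<ws (Suc ?v). \<Sum>k<dims ?v. 1 / ?D * (h p k)\<^sup>2)"
      by (simp add: sum_divide_distrib power2_eq_square)
    also have "\<dots> = (\<Sum>q\<in>?A. 1 / ?D * (h (fst q) (snd q))\<^sup>2)"
      by (simp add: sum.cartesian_product case_prod_beta')
    finally have "(R.cov (inp ?v x w i) (inp ?v x w i))\<^sup>2 = (\<Sum>q\<in>?A. 1 / ?D * (h (fst q) (snd q))\<^sup>2)\<^sup>2"
      by simp
    also have "\<dots> \<le> (\<Sum>q\<in>?A. 1 / ?D * ((h (fst q) (snd q))\<^sup>2)\<^sup>2)"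
    proof (rule weighted_square_le)
      show "(\<Sum>q\<in>?A. 1 / ?D) = 1" using d by simp
    qed simp_all
    also have "\<dots> = (\<Sum>p<ws (Suc ?v). \<Sum>k<dims ?v. h p k ^ 4 / ?D)"
      by (simp add: sum.cartesian_product case_prod_beta')
    also have "\<dots> = (\<Sum>p<ws (Suc ?v). \<Sum>k<dims ?v. H ?v x w (i * ss (Suc ?v) + p) k ^ 4 / ?D)"
      by (simp only: h_def)
    finally show ?thesis .
  qed
  have dsum: "ennreal (\<Sum>p<a. \<Sum>k<b. e * f p k) = (\<Sum>p<a. \<Sum>k<b. ennreal e * ennreal (f p k))"
    if "0 \<le> e" "\<And>p k. 0 \<le> f p k" for a b :: nat and e and f :: "nat \<Rightarrow> nat \<Rightarrow> real"
  proof -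
    have "(\<Sum>p<a. \<Sum>k<b. ennreal e * ennreal (f p k)) = (\<Sum>p<a. \<Sum>k<b. ennreal (e * f p k))"
      using that by (intro sum.cong refl ennreal_mult[symmetric]) auto
    also have "\<dots> = (\<Sum>p<a. ennreal (\<Sum>k<b. e * f p k))"
      using that by (intro sum.cong refl sum_ennreal) auto
    also have "\<dots> = ennreal (\<Sum>p<a. \<Sum>k<b. e * f p k)"
      using that by (intro sum_ennreal sum_nonneg) auto
    finally show ?thesis by simp
  qed
  note m = measurable_H[of "Suc ?v" r x i]
  have mH: "(\<lambda>w. H ?v x w j k) \<in> borel_measurable PG" if "k < dims ?v" for j k
    using Suc.prems that by (intro measurable_H) auto
  have "(\<integral>\<^sup>+w. ennreal (H (Suc ?v) x w i r ^ 4) \<partial>PG)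
     = (\<integral>\<^sup>+w. \<integral>\<^sup>+z. ennreal (H (Suc ?v) x (override ?J w z) i r ^ 4) \<partial>PGJ ?J \<partial>PG)"
    using m Suc.prems row_subset[of "Suc ?v" r] by (intro nn_integral_resample) auto
  also have "\<dots> = (\<integral>\<^sup>+w. \<integral>\<^sup>+z. ennreal (relu (R.lin (inp ?v x w i) z) ^ 4) \<partial>PGJ ?J \<partial>PG)"
    using H_Suc_override[of ?v x r] Suc.prems by simp
  also have "\<dots> \<le> (\<integral>\<^sup>+w. ennreal (3 * (\<Sum>p<ws (Suc ?v). \<Sum>k<dims ?v. H ?v x w (i * ss (Suc ?v) + p) k ^ 4 / ?D)) \<partial>PG)"
  proof (rule nn_integral_mono)
    fix w
    show "(\<integral>\<^sup>+z. ennreal (relu (R.lin (inp ?v x w i) z) ^ 4) \<partial>PGJ ?J)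
      \<le> ennreal (3 * (\<Sum>p<ws (Suc ?v). \<Sum>k<dims ?v. H ?v x w (i * ss (Suc ?v) + p) k ^ 4 / ?D))"
      using c[of w] by (intro order_trans[OF R.nn_integral_relu_fourth_le] ennreal_leI) simp
  qed
  also have "\<dots> = (\<integral>\<^sup>+w. (\<Sum>p<ws (Suc ?v). \<Sum>k<dims ?v. ennreal (3 / ?D) * ennreal (H ?v x w (i * ss (Suc ?v) + p) k ^ 4)) \<partial>PG)"
  proof (rule nn_integral_cong)
    fix w
    show "ennreal (3 * (\<Sum>p<ws (Suc ?v). \<Sum>k<dims ?v. H ?v x w (i * ss (Suc ?v) + p) k ^ 4 / ?D))
      = (\<Sum>p<ws (Suc ?v). \<Sum>k<dims ?v. ennreal (3 / ?D) * ennreal (H ?v x w (i * ss (Suc ?v) + p) k ^ 4))"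
    proof -
      have "3 * (\<Sum>p<ws (Suc ?v). \<Sum>k<dims ?v. H ?v x w (i * ss (Suc ?v) + p) k ^ 4 / ?D)
        = (\<Sum>p<ws (Suc ?v). \<Sum>k<dims ?v. 3 / ?D * H ?v x w (i * ss (Suc ?v) + p) k ^ 4)"
        by (simp add: sum_distrib_left)
      then show ?thesis
        using dsum[of "3 / ?D" "\<lambda>p k. H ?v x w (i * ss (Suc ?v) + p) k ^ 4"] by simp
    qed
  qed
  also have "\<dots> = (\<Sum>p<ws (Suc ?v). \<Sum>k<dims ?v. ennreal (3 / ?D) * (\<integral>\<^sup>+w. ennreal (H ?v x w (i * ss (Suc ?v) + p) k ^ 4) \<partial>PG))"
  proof -
    have mm: "(\<lambda>w. ennreal (H ?v x w j k ^ 4)) \<in> borel_measurable PG" if "k < dims ?v" for j k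
      using mH[OF that] by simp
    have "(\<integral>\<^sup>+w. (\<Sum>p<ws (Suc ?v). \<Sum>k<dims ?v. ennreal (3 / ?D) * ennreal (H ?v x w (i * ss (Suc ?v) + p) k ^ 4)) \<partial>PG)
       = (\<Sum>p<ws (Suc ?v). \<integral>\<^sup>+w. (\<Sum>k<dims ?v. ennreal (3 / ?D) * ennreal (H ?v x w (i * ss (Suc ?v) + p) k ^ 4)) \<partial>PG)"
      by (rule nn_integral_sum) (auto intro!: borel_measurable_sum borel_measurable_times_ennreal mm)
    also have "\<dots> = (\<Sum>p<ws (Suc ?v). \<Sum>k<dims ?v. \<integral>\<^sup>+w. ennreal (3 / ?D) * ennreal (H ?v x w (i * ss (Suc ?v) + p) k ^ 4) \<partial>PG)"
      by (rule sum.cong[OF refl], rule nn_integral_sum) (auto intro!: borel_measurable_times_ennreal mm)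
    also have "\<dots> = (\<Sum>p<ws (Suc ?v). \<Sum>k<dims ?v. ennreal (3 / ?D) * (\<integral>\<^sup>+w. ennreal (H ?v x w (i * ss (Suc ?v) + p) k ^ 4) \<partial>PG))"
      by (rule sum.cong[OF refl], rule sum.cong[OF refl], rule nn_integral_cmult) (auto intro!: borel_measurable_power mH)
    finally show ?thesis .
  qed
  also have "\<dots> \<le> (\<Sum>p<ws (Suc ?v). \<Sum>k<dims ?v. ennreal (3 / ?D) * ennreal (3 ^ ?v * \<rho>\<^sup>2))"
  proof (intro sum_mono mult_left_mono)
    fix p k assume "p \<in> {..<ws (Suc ?v)}" "k \<in> {..<dims ?v}"
    then show "(\<integral>\<^sup>+w. ennreal (H ?v x w (i * ss (Suc ?v) + p) k ^ 4) \<partial>PG) \<le> ennreal (3 ^ ?v * \<rho>\<^sup>2)"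
      using Suc.prems window_bound[of "Suc ?v" i p] by (intro Suc.IH) simp_all
  qed simp
  also have "\<dots> = ennreal (\<Sum>p<ws (Suc ?v). \<Sum>k<dims ?v. 3 / ?D * (3 ^ ?v * \<rho>\<^sup>2))"
    by (rule dsum[of "3 / ?D" "\<lambda>_ _. 3 ^ ?v * \<rho>\<^sup>2", symmetric]) simp_all
  also have "(\<Sum>p<ws (Suc ?v). \<Sum>k<dims ?v. 3 / ?D * (3 ^ ?v * \<rho>\<^sup>2)) = 3 ^ Suc ?v * \<rho>\<^sup>2"
    using d by simp
  finally show ?case .
qed

text \<open>Jensen over the tokens and \<open>2 a b \<le> a\<^sup>2 + b\<^sup>2\<close> reduce the
  second moment of a product of two activations to the fourth moments of each.\<close>

lemma gram_row_square:
  assumes x: "on_sphere \<rho> x" "on_sphere \<rho> x'" and v: "1 \<le> v" "v < l" and r: "r < dims v"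
  shows "(\<integral>\<^sup>+w. ennreal ((gram_row v x x' r w)\<^sup>2) \<partial>PG) \<le> ennreal (3 ^ v * \<rho>\<^sup>2)"
proof -
  have H4: "(\<integral>\<^sup>+w. ennreal (H v x w i r ^ 4) \<partial>PG) \<le> ennreal (3 ^ v * \<rho>\<^sup>2)"
    if "on_sphere \<rho> x" "i < ns v" for x i
    using fourth_moment[OF that(1), of "v - 1" i r] that v r by simp
  have [measurable]: "(\<lambda>w. H v x w i r) \<in> borel_measurable PG" for x i
    using v r by (intro measurable_H) auto
  have pt: "(gram_row v x x' r w)\<^sup>2 \<le> (\<Sum>i<ns v. token_weight v i / 2 * H v x w i r ^ 4 + token_weight v i / 2 * H v x' w i r ^ 4)" for w
  proof -
    have "(gram_row v x x' r w)\<^sup>2 \<le> (\<Sum>i<ns v. token_weight v i * (H v x w i r * H v x' w i r)\<^sup>2)"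
      unfolding gram_row_def using token_weight_nonneg token_weight_sum v by (intro weighted_square_le) auto
    also have "\<dots> \<le> (\<Sum>i<ns v. token_weight v i * (H v x w i r ^ 4 / 2 + H v x' w i r ^ 4 / 2))"
    proof (intro sum_mono mult_left_mono token_weight_nonneg)
      fix i
      have "2 * ((H v x w i r)\<^sup>2) * ((H v x' w i r)\<^sup>2) \<le> ((H v x w i r)\<^sup>2)\<^sup>2 + ((H v x' w i r)\<^sup>2)\<^sup>2"
        by (rule sum_squares_bound)
      then show "(H v x w i r * H v x' w i r)\<^sup>2 \<le> H v x w i r ^ 4 / 2 + H v x' w i r ^ 4 / 2"
        by (simp add: power_mult_distrib)
    qed
    finally show ?thesis by (simp add: algebra_simps)
  qed
  have splt: "ennreal (a * b + a * c) = ennreal a * ennreal b + ennreal a * ennreal c"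
    if "0 \<le> a" "0 \<le> b" "0 \<le> c" for a b c
    using that by (simp add: ennreal_mult)
  have "(\<integral>\<^sup>+w. ennreal ((gram_row v x x' r w)\<^sup>2) \<partial>PG)
     \<le> (\<integral>\<^sup>+w. (\<Sum>i<ns v. ennreal (token_weight v i / 2) * ennreal (H v x w i r ^ 4) + ennreal (token_weight v i / 2) * ennreal (H v x' w i r ^ 4)) \<partial>PG)"
  proof (rule nn_integral_mono)
    fix w
    have "ennreal ((gram_row v x x' r w)\<^sup>2) \<le> ennreal (\<Sum>i<ns v. token_weight v i / 2 * H v x w i r ^ 4 + token_weight v i / 2 * H v x' w i r ^ 4)"
      by (rule ennreal_leI[OF pt])
    also have "\<dots> = (\<Sum>i<ns v. ennreal (token_weight v i / 2 * H v x w i r ^ 4 + token_weight v i / 2 * H v x' w i r ^ 4))"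
      using token_weight_nonneg by (intro sum_ennreal[symmetric]) auto
    also have "\<dots> = (\<Sum>i<ns v. ennreal (token_weight v i / 2) * ennreal (H v x w i r ^ 4) + ennreal (token_weight v i / 2) * ennreal (H v x' w i r ^ 4))"
      by (intro sum.cong refl splt) (auto simp: token_weight_nonneg)
    finally show "ennreal ((gram_row v x x' r w)\<^sup>2) \<le> \<dots>" .
  qed
  also have "\<dots> = (\<Sum>i<ns v. ennreal (token_weight v i / 2) * (\<integral>\<^sup>+w. ennreal (H v x w i r ^ 4) \<partial>PG)
      + ennreal (token_weight v i / 2) * (\<integral>\<^sup>+w. ennreal (H v x' w i r ^ 4) \<partial>PG))"
    by (subst nn_integral_sum) (auto simp: nn_integral_add nn_integral_cmult)
  also have "\<dots> \<le> (\<Sum>i<ns v. ennreal (token_weight v i / 2) * ennreal (3 ^ v * \<rho>\<^sup>2) + ennreal (token_weight v i / 2) * ennreal (3 ^ v * \<rho>\<^sup>2))"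
    using H4 x by (intro sum_mono add_mono mult_left_mono) auto
  also have "\<dots> = (\<Sum>i<ns v. ennreal (token_weight v i * (3 ^ v * \<rho>\<^sup>2)))"
    using token_weight_nonneg by (intro sum.cong refl) (simp add: ennreal_mult[symmetric] ennreal_plus[symmetric] del: ennreal_plus)
  also have "\<dots> = ennreal (\<Sum>i<ns v. token_weight v i * (3 ^ v * \<rho>\<^sup>2))"
    using token_weight_nonneg by (intro sum_ennreal) auto
  also have "(\<Sum>i<ns v. token_weight v i * (3 ^ v * \<rho>\<^sup>2)) = 3 ^ v * \<rho>\<^sup>2"
    using token_weight_sum[of v] v by (simp add: sum_distrib_right[symmetric])
  finally show ?thesis .
qed

text \<open>The rows of a layer are disjoint weight blocks, so \<open>resample_variance\<close>
  applies with the number of channels in the role of \<open>n\<close>. The hidden widths enter the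
  estimates through this bound.\<close>

lemma gram_variance:
  assumes x: "on_sphere \<rho> x" "on_sphere \<rho> x'" and v: "1 \<le> v" "v < l"
  shows "integrable PG (\<lambda>w. (gram v x x' w - egram v x x' w)\<^sup>2)"
    and "(\<integral>w. (gram v x x' w - egram v x x' w)\<^sup>2 \<partial>PG) \<le> 4 * (3 ^ v * \<rho>\<^sup>2) / dims v"
proof -
  obtain u where u: "v = Suc u" using v by (cases v) auto
  have other: "gram_row v x x' r' (override (row v r) w z) = gram_row v x x' r' w" if "r \<noteq> r'" for r r' w z
    unfolding gram_row_def u using H_Suc_override_other[OF that] by simp
  have disj: "row v r \<inter> row v r' = {}" if "r \<noteq> r'" for r r'
    using that by (auto simp: row_def)
  have dp: "0 < dims v" using v by (intro dims_pos) auto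
  show "integrable PG (\<lambda>w. (gram v x x' w - egram v x x' w)\<^sup>2)"
    unfolding gram_eq egram_def
    by (rule resample_variance(1)[where B="3 ^ v * \<rho>\<^sup>2"])
       (use gram_row_square[OF x v] v other disj dp row_subset in auto)
  show "(\<integral>w. (gram v x x' w - egram v x x' w)\<^sup>2 \<partial>PG) \<le> 4 * (3 ^ v * \<rho>\<^sup>2) / dims v"
    unfolding gram_eq egram_def
    by (rule resample_variance(2))
       (use gram_row_square[OF x v] v other disj dp row_subset in auto)
qed

lemma resample_mean_gram_row:
  assumes "Suc u < l" "r < dims (Suc u)"
  shows "resample_mean (row (Suc u) r) (gram_row (Suc u) x x' r) w = (\<Sum>i<ns (Suc u). token_weight (Suc u) i *
    (\<integral>z. relu (gaussian_family.lin (row (Suc u) r) (inp u x w i) z) *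
          relu (gaussian_family.lin (row (Suc u) r) (inp u x' w i) z) \<partial>PGJ (row (Suc u) r)))"
proof -
  interpret R: gaussian_family sd "row (Suc u) r" using row_family assms by simp
  show ?thesis
    unfolding resample_mean_def gram_row_def H_Suc_override[OF assms(1)]
    by (subst Bochner_Integration.integral_sum) (auto intro!: R.integrable_relu_mult)
qed

lemma gram_cov_avg:
  assumes "Suc u \<le> l" "r < dims (Suc u)"
  shows "(\<Sum>i<ns (Suc u). token_weight (Suc u) i * gaussian_family.cov sd (row (Suc u) r) (inp u x w i) (inp u x' w i)) = gram u x x' w"
  unfolding gram_def token_weight_avg[OF assms(1)] by (simp add: cov_row[OF assms])

lemma cov_combination:
  assumes "gaussian_family sd J"
  shows "gaussian_family.cov sd J (\<lambda>i. \<Sum>k\<in>K. c k * y k i) (\<lambda>i. \<Sum>k\<in>K. c k * y k i)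
    = (\<Sum>k\<in>K. \<Sum>k'\<in>K. c k * c k' * gaussian_family.cov sd J (y k) (y k'))"
proof -
  interpret R: gaussian_family sd J by fact
  show ?thesis
    by (simp add: R.cov_sum_right R.cov_commute[of "\<lambda>i. \<Sum>k\<in>K. c k * y k i"] sum_distrib_left mult_ac)
qed

text \<open>The ReLU bound holds at each position and in each row with the same linear forms.
  Averaging with nonnegative token weights preserves it, and \<open>gram_cov_avg\<close> identifies
  the averaged covariances with \<open>gram u\<close>.\<close>

lemma egram_quadratic_ge:
  assumes u: "Suc u < l" and K: "finite K"
  shows "(\<Sum>k\<in>K. \<Sum>k'\<in>K. c k * c k' * gram u (X k) (X k') w) / 4
    \<le> (\<Sum>k\<in>K. \<Sum>k'\<in>K. c k * c k' * egram (Suc u) (X k) (X k') w)"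
proof -
  let ?G = "\<Sum>k\<in>K. \<Sum>k'\<in>K. c k * c k' * gram u (X k) (X k') w"
  have row: "?G / 4 \<le> (\<Sum>k\<in>K. \<Sum>k'\<in>K. c k * c k' * resample_mean (row (Suc u) r) (gram_row (Suc u) (X k) (X k') r) w)"
    if r: "r < dims (Suc u)" for r
  proof -
    interpret R: gaussian_family sd "row (Suc u) r" using row_family[of u r] u r by simp
    define L where "L i k k' = (\<integral>z. relu (R.lin (inp u (X k) w i) z) * relu (R.lin (inp u (X k') w i) z) \<partial>PGJ (row (Suc u) r))" for i k k'
    have "?G = (\<Sum>k\<in>K. \<Sum>k'\<in>K. \<Sum>i<ns (Suc u). c k * c k' * (token_weight (Suc u) i * R.cov (inp u (X k) w i) (inp u (X k') w i)))"
      using u r by (simp add: gram_cov_avg[symmetric, OF _ r] sum_distrib_left)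
    also have "\<dots> = (\<Sum>i<ns (Suc u). \<Sum>k\<in>K. \<Sum>k'\<in>K. c k * c k' * (token_weight (Suc u) i * R.cov (inp u (X k) w i) (inp u (X k') w i)))"
      by (subst sum.swap, subst (2) sum.swap) (rule refl)
    also have "\<dots> = (\<Sum>i<ns (Suc u). token_weight (Suc u) i * (\<Sum>k\<in>K. \<Sum>k'\<in>K. c k * c k' * R.cov (inp u (X k) w i) (inp u (X k') w i)))"
      by (simp add: sum_distrib_left mult_ac)
    finally have G: "?G / 4 = (\<Sum>i<ns (Suc u). token_weight (Suc u) i * ((\<Sum>k\<in>K. \<Sum>k'\<in>K. c k * c k' * R.cov (inp u (X k) w i) (inp u (X k') w i)) / 4))"
      by (simp only: times_divide_eq_right sum_divide_distrib[of _ "{..<ns (Suc u)}"])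
    also have "\<dots> \<le> (\<Sum>i<ns (Suc u). token_weight (Suc u) i * (\<Sum>k\<in>K. \<Sum>k'\<in>K. c k * c k' * L i k k'))"
      using R.relu_quadratic_form_ge[OF K, of c "\<lambda>k. inp u (X k) w _"]
      unfolding cov_combination[OF R.gaussian_family_axioms] L_def
      by (intro sum_mono mult_left_mono token_weight_nonneg) auto
    also have "\<dots> = (\<Sum>i<ns (Suc u). \<Sum>k\<in>K. \<Sum>k'\<in>K. c k * c k' * (token_weight (Suc u) i * L i k k'))"
      by (simp add: sum_distrib_left mult_ac)
    also have "\<dots> = (\<Sum>k\<in>K. \<Sum>k'\<in>K. \<Sum>i<ns (Suc u). c k * c k' * (token_weight (Suc u) i * L i k k'))"
      by (subst sum.swap, subst (2) sum.swap) (rule refl)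
    also have "\<dots> = (\<Sum>k\<in>K. \<Sum>k'\<in>K. c k * c k' * resample_mean (row (Suc u) r) (gram_row (Suc u) (X k) (X k') r) w)"
      using u r by (simp add: resample_mean_gram_row sum_distrib_left L_def)
    finally show ?thesis .
  qed
  have d: "0 < dims (Suc u)" using u by (intro dims_pos) auto
  have "?G / 4 = (\<Sum>r<dims (Suc u). ?G / 4) / dims (Suc u)" using d by simp
  also have "\<dots> \<le> (\<Sum>r<dims (Suc u). \<Sum>k\<in>K. \<Sum>k'\<in>K. c k * c k' * resample_mean (row (Suc u) r) (gram_row (Suc u) (X k) (X k') r) w) / dims (Suc u)"
    using row by (intro divide_right_mono sum_mono) auto
  also have "(\<Sum>r<dims (Suc u). \<Sum>k\<in>K. \<Sum>k'\<in>K. c k * c k' * resample_mean (row (Suc u) r) (gram_row (Suc u) (X k) (X k') r) w)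
     = (\<Sum>k\<in>K. \<Sum>k'\<in>K. \<Sum>r<dims (Suc u). c k * c k' * resample_mean (row (Suc u) r) (gram_row (Suc u) (X k) (X k') r) w)"
    by (subst sum.swap, subst (2) sum.swap) (rule refl)
  also have "\<dots> / dims (Suc u) = (\<Sum>k\<in>K. \<Sum>k'\<in>K. c k * c k' * egram (Suc u) (X k) (X k') w)"
    by (simp add: egram_def sum_distrib_left sum_divide_distrib)
  finally show ?thesis .
qed

lemma egram_diag_le:
  assumes u: "Suc u < l"
  shows "egram (Suc u) x x w \<le> gram u x x w"
proof -
  have "resample_mean (row (Suc u) r) (gram_row (Suc u) x x r) w \<le> gram u x x w" if r: "r < dims (Suc u)" for r
  proof -
    interpret R: gaussian_family sd "row (Suc u) r" using row_family[of u r] u r by simp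
    show ?thesis
      unfolding resample_mean_gram_row[OF u r] using u
      by (subst gram_cov_avg[symmetric, OF _ r]) (auto intro!: sum_mono mult_left_mono token_weight_nonneg R.integral_relu_square_le)
  qed
  then have "(\<Sum>r<dims (Suc u). resample_mean (row (Suc u) r) (gram_row (Suc u) x x r) w) \<le> (\<Sum>r<dims (Suc u). gram u x x w)"
    by (intro sum_mono) auto
  then show ?thesis
    using dims_pos[of "Suc u"] u by (simp add: egram_def field_simps)
qed


section \<open>Concentration in the hidden layers and Gaussian outputs\<close>

lemma gram_override_last: "v < l \<Longrightarrow> gram v x x' (override (row l 0) w z) = gram v x x' w"
  by (simp add: gram_def H_override_row)

text \<open>Needed so that the concentration event is decided before the output row is
  resampled.\<close>

lemma egram_override_last:
  assumes "v < l"
  shows "egram v x x' (override (row l 0) w z) = egram v x x' w"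
proof -
  have "resample_mean (row v r) (gram_row v x x' r) (override (row l 0) w z) = resample_mean (row v r) (gram_row v x x' r) w" for r
  proof (rule resample_mean_override_other)
    show "row v r \<inter> row l 0 = {}" using assms by (auto simp: row_def)
    show "gram_row v x x' r (override (row l 0) w z) = gram_row v x x' r w" for w z
      by (simp add: gram_row_def H_override_row[OF assms])
  qed
  then show ?thesis by (simp add: egram_def)
qed

text \<open>Here \<open>d\<close> is a deviation threshold, taken to be
  \<open>\<epsilon> * \<rho>\<close> later, and not a dimension. Layer 0 is deterministic and layer
  \<open>l\<close> is the output, so \<open>v\<close> runs strictly between them.\<close>

definition bad_event :: "nat \<Rightarrow> (nat \<Rightarrow> nat \<Rightarrow> nat \<Rightarrow> real) \<Rightarrow> real \<Rightarrow> (nat \<times> nat \<times> nat \<Rightarrow> real) set" where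
  "bad_event m X d = {w \<in> space PG. \<exists>v\<in>{1..<l}. \<exists>k<m. \<exists>k'<m. d \<le> \<bar>gram v (X k) (X k') w - egram v (X k) (X k') w\<bar>}"

lemma bad_event_eq: "bad_event m X d = (\<Union>v\<in>{1..<l}. \<Union>k<m. \<Union>k'<m. {w \<in> space PG. d \<le> \<bar>gram v (X k) (X k') w - egram v (X k) (X k') w\<bar>})"
  by (auto simp: bad_event_def)

lemma sets_bad_part:
  assumes "1 \<le> v" "v < l"
  shows "{w \<in> space PG. d \<le> \<bar>gram v x x' w - egram v x x' w\<bar>} \<in> sets PG"
proof -
  have [measurable]: "gram v x x' \<in> borel_measurable PG" "egram v x x' \<in> borel_measurable PG"
    using assms by (auto intro: measurable_gram measurable_egram)
  show ?thesis by measurable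
qed

lemma sets_bad [measurable]: "bad_event m X d \<in> sets PG"
  unfolding bad_event_eq by (intro sets.finite_UN sets_bad_part) auto

lemma measure_bad:
  assumes X: "\<And>k. k < m \<Longrightarrow> on_sphere \<rho> (X k)" and N: "0 < N" "\<And>v. 1 \<le> v \<Longrightarrow> v < l \<Longrightarrow> N \<le> dims v"
    and e: "0 < \<epsilon>" and r: "0 < \<rho>"
  shows "measure PG (bad_event m X (\<epsilon> * \<rho>)) \<le> l * m\<^sup>2 * (4 * 3 ^ l / (N * \<epsilon>\<^sup>2))"
proof -
  let ?S = "\<lambda>v k k'. {w \<in> space PG. \<epsilon> * \<rho> \<le> \<bar>gram v (X k) (X k') w - egram v (X k) (X k') w\<bar>}"
  have one: "measure PG (?S v k k') \<le> 4 * 3 ^ l / (N * \<epsilon>\<^sup>2)" if v: "1 \<le> v" "v < l" and k: "k < m" "k' < m" for v k k'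
  proof -
    let ?g = "\<lambda>w. (gram v (X k) (X k') w - egram v (X k) (X k') w)\<^sup>2"
    have [measurable]: "gram v (X k) (X k') \<in> borel_measurable PG" "egram v (X k) (X k') \<in> borel_measurable PG"
      using v by (auto intro: measurable_gram measurable_egram)
    note gv = gram_variance[OF X[OF k(1)] X[OF k(2)] v]
    have "measure PG (?S v k k') \<le> measure PG {w \<in> space PG. (\<epsilon> * \<rho>)\<^sup>2 \<le> ?g w}"
    proof (rule P.finite_measure_mono)
      show "?S v k k' \<subseteq> {w \<in> space PG. (\<epsilon> * \<rho>)\<^sup>2 \<le> ?g w}"
        using e r by (auto simp: abs_le_square_iff[symmetric])
    qed measurable
    also have "\<dots> \<le> (\<integral>w. ?g w \<partial>PG) / (\<epsilon> * \<rho>)\<^sup>2"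
      using e r gv(1) by (intro integral_Markov_inequality_measure[where A="{}"]) auto
    also have "\<dots> \<le> (4 * (3 ^ v * \<rho>\<^sup>2) / dims v) / (\<epsilon> * \<rho>)\<^sup>2"
      by (intro divide_right_mono gv(2)) simp
    also have "\<dots> = 4 * 3 ^ v / (dims v * \<epsilon>\<^sup>2)"
      using r by (simp add: power_mult_distrib)
    also have "\<dots> \<le> 4 * 3 ^ l / (N * \<epsilon>\<^sup>2)"
      using v N e by (intro frac_le mult_right_mono mult_left_mono power_increasing mult_pos_pos) auto
    finally show ?thesis .
  qed
  have "measure PG (bad_event m X (\<epsilon> * \<rho>)) \<le> (\<Sum>v\<in>{1..<l}. measure PG (\<Union>k<m. \<Union>k'<m. ?S v k k'))"
    unfolding bad_event_eq by (rule measure_UNION_le) (auto intro!: sets.finite_UN sets_bad_part)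
  also have "\<dots> \<le> (\<Sum>v\<in>{1..<l}. \<Sum>k<m. measure PG (\<Union>k'<m. ?S v k k'))"
    by (rule sum_mono, rule measure_UNION_le) (auto intro!: sets.finite_UN sets_bad_part)
  also have "\<dots> \<le> (\<Sum>v\<in>{1..<l}. \<Sum>k<m. \<Sum>k'<m. measure PG (?S v k k'))"
    by (rule sum_mono, rule sum_mono, rule measure_UNION_le) (auto intro!: sets_bad_part)
  also have "\<dots> \<le> (\<Sum>v\<in>{1..<l}. \<Sum>k<m. \<Sum>k'<m. 4 * 3 ^ l / (N * \<epsilon>\<^sup>2))"
    by (intro sum_mono one) auto
  also have "\<dots> = real (l - 1) * m\<^sup>2 * (4 * 3 ^ l / (N * \<epsilon>\<^sup>2))"
    by (simp add: power2_eq_square)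
  also have "\<dots> \<le> l * m\<^sup>2 * (4 * 3 ^ l / (N * \<epsilon>\<^sup>2))"
    using N(1) by (intro mult_right_mono) (auto intro!: mult_right_mono)
  finally show ?thesis .
qed

text \<open>Entrywise errors \<open>d\<close> cost at most \<open>m * d\<close> in operator norm, by
  \<open>\<bar>c k * c k'\<bar> \<le> ((c k)\<^sup>2 + (c k')\<^sup>2) / 2\<close>.\<close>

lemma quadratic_perturb:
  fixes A B :: "nat \<Rightarrow> nat \<Rightarrow> real"
  assumes "\<And>k k'. k < m \<Longrightarrow> k' < m \<Longrightarrow> \<bar>A k k' - B k k'\<bar> \<le> d"
  shows "(\<Sum>k<m. \<Sum>k'<m. c k * c k' * B k k') - m * d * (\<Sum>k<m. (c k)\<^sup>2) \<le> (\<Sum>k<m. \<Sum>k'<m. c k * c k' * A k k')"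
proof -
  have "(\<Sum>k<m. \<Sum>k'<m. c k * c k' * B k k') - (\<Sum>k<m. \<Sum>k'<m. c k * c k' * A k k')
     = (\<Sum>k<m. \<Sum>k'<m. c k * c k' * (B k k' - A k k'))"
    by (simp add: sum_subtractf right_diff_distrib)
  also have "\<dots> \<le> (\<Sum>k<m. \<Sum>k'<m. ((c k)\<^sup>2 + (c k')\<^sup>2) / 2 * d)"
  proof (intro sum_mono)
    fix k k' assume kk: "k \<in> {..<m}" "k' \<in> {..<m}"
    have d: "\<bar>A k k' - B k k'\<bar> \<le> d" using assms kk by simp
    have "c k * c k' * (B k k' - A k k') \<le> \<bar>c k * c k'\<bar> * \<bar>A k k' - B k k'\<bar>"
      by (metis abs_ge_self abs_minus_commute abs_mult)
    also have "\<dots> \<le> ((c k)\<^sup>2 + (c k')\<^sup>2) / 2 * d"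
    proof (rule mult_mono)
      show "\<bar>c k * c k'\<bar> \<le> ((c k)\<^sup>2 + (c k')\<^sup>2) / 2"
        using sum_squares_bound[of "\<bar>c k\<bar>" "\<bar>c k'\<bar>"] by (simp add: abs_mult)
    qed (use d in auto)
    finally show "c k * c k' * (B k k' - A k k') \<le> ((c k)\<^sup>2 + (c k')\<^sup>2) / 2 * d" .
  qed
  also have "\<dots> = m * d * (\<Sum>k<m. (c k)\<^sup>2)"
  proof -
    have "(\<Sum>k<m. \<Sum>k'<m. ((c k)\<^sup>2 + (c k')\<^sup>2) / 2 * d)
       = (\<Sum>k<m. \<Sum>k'<m. (c k)\<^sup>2 * (d / 2)) + (\<Sum>k<m. \<Sum>k'<m. (c k')\<^sup>2 * (d / 2))"
      by (simp only: sum.distrib[symmetric] distrib_right add_divide_distrib times_divide_eq_right times_divide_eq_left)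
    also have "\<dots> = m * ((\<Sum>k<m. (c k)\<^sup>2) * (d / 2)) + m * ((\<Sum>k<m. (c k)\<^sup>2) * (d / 2))"
      by (simp add: sum_distrib_right sum_distrib_left)
    finally show ?thesis by (simp add: field_simps)
  qed
  finally show ?thesis by simp
qed

text \<open>A layer divides the lower constant by 4 and subtracts \<open>m * \<epsilon>\<close>. The
  error term \<open>2 * m * \<epsilon>\<close> is stable under this, since a quarter of it plus
  \<open>m * \<epsilon>\<close> is only \<open>3 / 2 * m * \<epsilon>\<close>; the error thus does
  not grow with depth. The diagonal gains at most \<open>\<epsilon> * \<rho>\<close> per layer
  because the ReLU does not increase second moments.\<close>

lemma good_gram:
  assumes w: "w \<in> space PG" "w \<notin> bad_event m X (\<epsilon> * \<rho>)"
    and base: "\<And>k k'. k < m \<Longrightarrow> k' < m \<Longrightarrow> \<bar>gram 0 (X k) (X k') w - (if k = k' then \<rho> else 0)\<bar> \<le> \<epsilon> * \<rho>"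
    and e: "0 < \<epsilon>" and r: "0 < \<rho>"
  shows "v < l \<Longrightarrow> (1 / 4 ^ v - 2 * real m * \<epsilon>) * \<rho> * (\<Sum>k<m. (c k)\<^sup>2) \<le> (\<Sum>k<m. \<Sum>k'<m. c k * c k' * gram v (X k) (X k') w)"
    and "v < l \<Longrightarrow> k < m \<Longrightarrow> gram v (X k) (X k) w \<le> (1 + (real v + 1) * \<epsilon>) * \<rho>"
proof -
  define S where "S = (\<Sum>k<m. (c k)\<^sup>2)"
  have S: "0 \<le> S" by (simp add: S_def sum_nonneg)
  have step: "\<bar>gram v (X k) (X k') w - egram v (X k) (X k') w\<bar> \<le> \<epsilon> * \<rho>" if "1 \<le> v" "v < l" "k < m" "k' < m" for v k k'
    using w that by (force simp: bad_event_def)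
  show "v < l \<Longrightarrow> (1 / 4 ^ v - 2 * real m * \<epsilon>) * \<rho> * (\<Sum>k<m. (c k)\<^sup>2) \<le> (\<Sum>k<m. \<Sum>k'<m. c k * c k' * gram v (X k) (X k') w)"
    unfolding S_def[symmetric]
  proof (induction v)
    case 0
    have "(\<Sum>k<m. \<Sum>k'<m. c k * c k' * (if k = k' then \<rho> else 0)) - m * (\<epsilon> * \<rho>) * S \<le> (\<Sum>k<m. \<Sum>k'<m. c k * c k' * gram 0 (X k) (X k') w)"
      unfolding S_def by (rule quadratic_perturb[OF base])
    also have "(\<Sum>k<m. \<Sum>k'<m. c k * c k' * (if k = k' then \<rho> else 0)) = \<rho> * S"
      by (simp add: S_def sum_distrib_left power2_eq_square mult_ac if_distrib[of "\<lambda>x. _ * x"] cong: if_cong)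
    finally have "\<rho> * S - m * (\<epsilon> * \<rho>) * S \<le> (\<Sum>k<m. \<Sum>k'<m. c k * c k' * gram 0 (X k) (X k') w)" .
    moreover have "0 \<le> m * (\<epsilon> * \<rho>) * S" using e r S by simp
    ultimately show ?case by (simp add: algebra_simps)
  next
    case (Suc v)
    have arith: "L \<le> G'" if "e - P \<le> G'" "G / 4 \<le> e" "Q \<le> G" "0 \<le> P" "L = Q / 4 - 3 / 2 * P" for L G G' e P Q :: real
      using that by linarith
    have "(\<Sum>k<m. \<Sum>k'<m. c k * c k' * egram (Suc v) (X k) (X k') w) - m * (\<epsilon> * \<rho>) * S
        \<le> (\<Sum>k<m. \<Sum>k'<m. c k * c k' * gram (Suc v) (X k) (X k') w)"
      unfolding S_def by (rule quadratic_perturb) (use step Suc.prems in auto)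
    moreover have "(\<Sum>k<m. \<Sum>k'<m. c k * c k' * gram v (X k) (X k') w) / 4
        \<le> (\<Sum>k<m. \<Sum>k'<m. c k * c k' * egram (Suc v) (X k) (X k') w)"
      using Suc.prems by (intro egram_quadratic_ge) auto
    moreover have "(1 / 4 ^ v - 2 * real m * \<epsilon>) * \<rho> * S \<le> (\<Sum>k<m. \<Sum>k'<m. c k * c k' * gram v (X k) (X k') w)"
      using Suc by simp
    moreover have "0 \<le> m * (\<epsilon> * \<rho>) * S" using e r S by simp
    moreover have "(1 / 4 ^ Suc v - 2 * real m * \<epsilon>) * \<rho> * S = (1 / 4 ^ v - 2 * real m * \<epsilon>) * \<rho> * S / 4 - 3 / 2 * (m * (\<epsilon> * \<rho>) * S)"
      by (simp add: field_simps)
    ultimately show ?case by (rule arith)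
  qed
  show "v < l \<Longrightarrow> k < m \<Longrightarrow> gram v (X k) (X k) w \<le> (1 + (real v + 1) * \<epsilon>) * \<rho>"
  proof (induction v)
    case 0
    then show ?case using base[of k k] by (simp add: algebra_simps)
  next
    case (Suc v)
    have "gram (Suc v) (X k) (X k) w \<le> egram (Suc v) (X k) (X k) w + \<epsilon> * \<rho>"
      using step[of "Suc v" k k] Suc.prems by simp
    also have "egram (Suc v) (X k) (X k) w \<le> gram v (X k) (X k) w"
      using Suc.prems by (intro egram_diag_le)
    also have "\<dots> \<le> (1 + (real v + 1) * \<epsilon>) * \<rho>" using Suc by simp
    finally show ?case by (simp add: algebra_simps)
  qed
qed

text \<open>Only the output row is resampled. Off the bad event the \<open>m\<close> outputs are
  then linear forms with covariance matrix \<open>gram (l - 1)\<close>, and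
  \<open>prob_all_lin_nonneg\<close> applies with \<open>a = 1 / 4 ^ l\<close>. The last summand
  pays for the bad event.\<close>

lemma prob_same_sign:
  assumes X: "\<And>k. k < m \<Longrightarrow> on_sphere \<rho> (X k)" and N: "0 < N" "\<And>v. 1 \<le> v \<Longrightarrow> v < l \<Longrightarrow> N \<le> dims v"
    and base: "\<And>k k' w. k < m \<Longrightarrow> k' < m \<Longrightarrow> \<bar>gram 0 (X k) (X k') w - (if k = k' then \<rho> else 0)\<bar> \<le> \<epsilon> * \<rho>"
    and e: "0 < \<epsilon>" "2 * real m * \<epsilon> \<le> 1 / 4 ^ l" and r: "0 < \<rho>" and m: "0 < m" and T: "0 < T"
    and s: "s = 1 \<or> s = - 1"
  shows "measure PG {w \<in> space PG. \<forall>k<m. 0 \<le> s * H l (X k) w 0 0}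
    \<le> 2 / T\<^sup>2 + exp (T\<^sup>2 * 4 ^ l / 2) / sqrt m + l * m\<^sup>2 * (4 * 3 ^ l / (N * \<epsilon>\<^sup>2))"
proof -
  obtain u where u: "l = Suc u" using l_pos by (cases l) auto
  let ?J = "row l 0"
  have J: "?J \<subseteq> WI" using row_subset[of l 0] l_pos dims_last by simp
  interpret R: gaussian_family sd ?J by (rule gaussian_family_subset[OF J])
  let ?B = "bad_event m X (\<epsilon> * \<rho>)"
  define E where "E = {w \<in> space PG. \<forall>k<m. 0 \<le> s * H l (X k) w 0 0}"
  have Hm [measurable]: "(\<lambda>w. H l (X k) w 0 0) \<in> borel_measurable PG" for k
    using dims_last by (intro measurable_H) auto
  have Em [measurable]: "E \<in> sets PG" unfolding E_def by measurable
  define b where "b = 2 / T\<^sup>2 + exp (T\<^sup>2 / (2 * (1 / 4 ^ l))) / sqrt m"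
  have b: "0 \<le> b" by (simp add: b_def)
  have inner: "(\<integral>\<^sup>+z. indicator (E - ?B) (override ?J w z) \<partial>PGJ ?J) \<le> ennreal b" if w: "w \<in> space PG" for w
  proof (cases "w \<in> ?B")
    case True
    have "indicator (E - ?B) (override ?J w z) = (0::ennreal)" if z: "z \<in> space (PGJ ?J)" for z
    proof -
      have "override ?J w z \<in> space PG"
        using measurable_space[OF measurable_override[OF J], of "(w, z)"] w z by (simp add: space_pair_measure)
      then have "override ?J w z \<in> ?B"
        using True by (auto simp: bad_event_def gram_override_last egram_override_last)
      then show ?thesis by simp
    qed
    then have "(\<integral>\<^sup>+z. indicator (E - ?B) (override ?J w z) \<partial>PGJ ?J) = (\<integral>\<^sup>+z. 0 \<partial>PGJ ?J)"
      by (rule nn_integral_cong)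
    then show ?thesis by simp
  next
    case False
    have ul: "u < l" using u by simp
    \<comment> \<open>The sign \<open>s\<close> is moved into the coefficients; covariances do not
      change because \<open>s * s = 1\<close>.\<close>
    define y where "y k = (\<lambda>j. s * inp u (X k) w 0 j)" for k
    have ss1: "s * s = 1" using s by auto
    have linY: "R.lin (y k) z = s * R.lin (inp u (X k) w 0) z" for k z
      by (simp add: R.lin_def y_def sum_distrib_left mult_ac)
    have covY: "R.cov (y k) (y k') = gram u (X k) (X k') w" for k k'
    proof -
      have "R.cov (y k) (y k') = s * s * R.cov (inp u (X k) w 0) (inp u (X k') w 0)"
        by (simp add: R.cov_def y_def sum_distrib_left mult_ac)
      also have "\<dots> = (\<Sum>i<ns (Suc u). token_weight (Suc u) i * R.cov (inp u (X k) w i) (inp u (X k') w i))"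
        using token_weight_last[of "\<lambda>i. R.cov (inp u (X k) w i) (inp u (X k') w i)"] u ss1 by simp
      also have "\<dots> = gram u (X k) (X k') w"
        using gram_cov_avg[of u 0 "X k" w "X k'"] u dims_last by simp
      finally show ?thesis .
    qed
    have "(\<integral>\<^sup>+z. indicator (E - ?B) (override ?J w z) \<partial>PGJ ?J)
       \<le> (\<integral>\<^sup>+z. indicator {z \<in> space (PGJ ?J). \<forall>k<m. 0 \<le> R.lin (y k) z} z \<partial>PGJ ?J)"
    proof (rule nn_integral_mono)
      fix z assume z: "z \<in> space (PGJ ?J)"
      have "H l (X k) (override ?J w z) 0 0 = R.lin (inp u (X k) w 0) z" for k
        using output_override[of "X k" w z] u by simp
      then show "indicator (E - ?B) (override ?J w z) \<le> (indicator {z \<in> space (PGJ ?J). \<forall>k<m. 0 \<le> R.lin (y k) z} z :: ennreal)"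
        using z by (auto simp: indicator_def E_def linY)
    qed
    also have "\<dots> = ennreal (measure (PGJ ?J) {z \<in> space (PGJ ?J). \<forall>k<m. 0 \<le> R.lin (y k) z})"
      by (subst nn_integral_indicator) (auto simp: R.emeasure_eq_measure)
    also have "\<dots> \<le> ennreal b"
      unfolding b_def
    proof (intro ennreal_leI R.prob_all_lin_nonneg)
      fix c :: "nat \<Rightarrow> real"
      have p: "(4::real) ^ l = 4 * 4 ^ u" using u by simp
      \<comment> \<open>There are only \<open>u = l - 1\<close> ReLU layers, so
        \<open>1 / 4 ^ u\<close> is four times \<open>1 / 4 ^ l\<close>, which leaves room for the
        error \<open>2 * m * \<epsilon>\<close>.\<close>
      have "1 / 4 ^ l \<le> 1 / 4 ^ u - 2 * real m * \<epsilon>"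
        using e(2) unfolding p by (simp add: field_simps)
      then have "1 / 4 ^ l * \<rho> * (\<Sum>k<m. (c k)\<^sup>2) \<le> (1 / 4 ^ u - 2 * real m * \<epsilon>) * \<rho> * (\<Sum>k<m. (c k)\<^sup>2)"
        using r by (intro mult_right_mono) (auto simp: sum_nonneg)
      also have "\<dots> \<le> (\<Sum>k<m. \<Sum>k'<m. c k * c k' * gram u (X k) (X k') w)"
        using good_gram(1)[OF w False base e(1) r ul, of c] by simp
      also have "\<dots> = R.cov (\<lambda>i. \<Sum>k<m. c k * y k i) (\<lambda>i. \<Sum>k<m. c k * y k i)"
        by (subst cov_combination[OF R.gaussian_family_axioms]) (simp add: covY)
      finally show "1 / 4 ^ l * \<rho> * (\<Sum>k<m. (c k)\<^sup>2) \<le> R.cov (\<lambda>i. \<Sum>k<m. c k * y k i) (\<lambda>i. \<Sum>k<m. c k * y k i)" .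
    next
      fix k assume k: "k < m"
      have "R.cov (y k) (y k) \<le> (1 + (real u + 1) * \<epsilon>) * \<rho>"
        unfolding covY using good_gram(2)[OF w False base e(1) r ul k] by simp
      also have "(1 + (real u + 1) * \<epsilon>) * \<rho> \<le> 2 * \<rho>"
      proof -
        \<comment> \<open>The smallness of \<open>\<epsilon>\<close> assumed for the lower bound
          also keeps the accumulated diagonal error \<open>l * \<epsilon>\<close> below 1.\<close>
        have "real l * \<epsilon> \<le> 4 ^ l * \<epsilon>"
        proof (rule mult_right_mono)
          have "real l < 2 ^ l" by (rule of_nat_less_two_power)
          also have "(2::real) ^ l \<le> 4 ^ l" by (rule power_mono) auto
          finally show "real l \<le> 4 ^ l" by simp
        qed (use e in auto)
        also have "\<dots> \<le> 4 ^ l * (2 * real m * \<epsilon>)"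
          using m e(1) by (intro mult_left_mono) auto
        also have "\<dots> \<le> 1" using e(2) by (simp add: field_simps)
        finally have "(real u + 1) * \<epsilon> \<le> 1" using u by (simp add: add.commute)
        then show ?thesis using r by (intro mult_right_mono) auto
      qed
      finally show "R.cov (y k) (y k) \<le> 2 * \<rho>" .
    qed (use r T m in auto)
    finally show ?thesis .
  qed
  have "emeasure PG (E - ?B) = (\<integral>\<^sup>+w. indicator (E - ?B) w \<partial>PG)" by simp
  also have "\<dots> = (\<integral>\<^sup>+w. \<integral>\<^sup>+z. indicator (E - ?B) (override ?J w z) \<partial>PGJ ?J \<partial>PG)"
    by (rule nn_integral_resample[OF J]) measurable
  also have "\<dots> \<le> (\<integral>\<^sup>+w. ennreal b \<partial>PG)" by (rule nn_integral_mono[OF inner])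
  also have "\<dots> = ennreal b" by (simp add: P.emeasure_space_1)
  finally have EB: "measure PG (E - ?B) \<le> b" using b by (simp add: P.emeasure_eq_measure)
  have "measure PG E \<le> measure PG ((E - ?B) \<union> ?B)"
    by (rule P.finite_measure_mono) auto
  also have "\<dots> \<le> measure PG (E - ?B) + measure PG ?B" by (rule measure_Un_le) auto
  also have "\<dots> \<le> b + l * m\<^sup>2 * (4 * 3 ^ l / (N * \<epsilon>\<^sup>2))"
    using measure_bad[OF X N e(1) r] EB by (intro add_mono)
  finally show ?thesis by (simp add: E_def b_def)
qed

end

section \<open>Random skew rotations\<close>

text \<open>\<open>vrot d \<sigma> t \<theta>\<close> is \<open>cos \<theta> + sin \<theta> A\<close> on the coordinates moved by the involution \<open>\<sigma>\<close>, where the skew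
  matrix \<open>A\<close> has entries \<open>t k\<close> at \<open>(k, \<sigma> k)\<close>; it fixes the other coordinates.\<close>

definition vrot :: "nat \<Rightarrow> (nat \<Rightarrow> nat) \<Rightarrow> (nat \<Rightarrow> real) \<Rightarrow> real \<Rightarrow> (nat \<Rightarrow> real) \<Rightarrow> (nat \<Rightarrow> real)" where
  "vrot d \<sigma> t \<theta> x = (\<lambda>k. if k < d \<and> \<sigma> k \<noteq> k then cos \<theta> * x k + sin \<theta> * t k * x (\<sigma> k) else x k)"

text \<open>The matrix \<open>A\<close> is then skew with square \<open>-1\<close> on the moved
  coordinates, so the maps \<open>vrot\<close> form a one-parameter group of isometries.\<close>

definition skew :: "nat \<Rightarrow> (nat \<Rightarrow> nat) \<Rightarrow> (nat \<Rightarrow> real) \<Rightarrow> bool" where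
  "skew d \<sigma> t \<longleftrightarrow> (\<forall>k<d. \<sigma> k < d \<and> \<sigma> (\<sigma> k) = k \<and> (t k = 1 \<or> t k = - 1) \<and> (\<sigma> k \<noteq> k \<longrightarrow> t (\<sigma> k) = - t k))"

lemma skewD:
  assumes "skew d \<sigma> t" "k < d"
  shows "\<sigma> k < d" "\<sigma> (\<sigma> k) = k" "t k = 1 \<or> t k = - 1" "\<sigma> k \<noteq> k \<Longrightarrow> t (\<sigma> k) = - t k"
  using assms unfolding skew_def by blast+

lemma skew_square: "skew d \<sigma> t \<Longrightarrow> k < d \<Longrightarrow> t k * t k = 1"
  using skewD(3)[of d \<sigma> t k] by auto

lemma vrot_0: "vrot d \<sigma> t 0 x = x"
  by (auto simp: vrot_def)

lemma vrot_vrot: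
  assumes "skew d \<sigma> t"
  shows "vrot d \<sigma> t \<theta> (vrot d \<sigma> t \<phi> x) = vrot d \<sigma> t (\<theta> + \<phi>) x"
proof
  fix k
  show "vrot d \<sigma> t \<theta> (vrot d \<sigma> t \<phi> x) k = vrot d \<sigma> t (\<theta> + \<phi>) x k"
  proof (cases "k < d \<and> \<sigma> k \<noteq> k")
    case True
    then have s: "\<sigma> k < d" "\<sigma> (\<sigma> k) = k" "t (\<sigma> k) = - t k" and tt: "t k * t k = 1"
      using skewD[OF assms, of k] skew_square[OF assms, of k] by auto
    have "vrot d \<sigma> t \<theta> (vrot d \<sigma> t \<phi> x) k = cos \<theta> * (cos \<phi> * x k + sin \<phi> * t k * x (\<sigma> k))
        + sin \<theta> * t k * (cos \<phi> * x (\<sigma> k) + sin \<phi> * (- t k) * x k)"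
      using True s by (simp add: vrot_def)
    also have "\<dots> = (cos \<theta> * cos \<phi> - sin \<theta> * sin \<phi> * (t k * t k)) * x k + (cos \<theta> * sin \<phi> + sin \<theta> * cos \<phi>) * t k * x (\<sigma> k)"
      by (simp add: algebra_simps)
    also have "\<dots> = vrot d \<sigma> t (\<theta> + \<phi>) x k"
      using True by (simp add: vrot_def tt cos_add sin_add)
    finally show ?thesis .
  qed (auto simp: vrot_def)
qed

lemma sum_involution:
  fixes F :: "nat \<Rightarrow> 'a::comm_monoid_add"
  assumes "skew d \<sigma> t"
  shows "(\<Sum>k | k < d \<and> \<sigma> k \<noteq> k. F (\<sigma> k)) = (\<Sum>k | k < d \<and> \<sigma> k \<noteq> k. F k)"
  by (rule sum.reindex_bij_witness[where i=\<sigma> and j=\<sigma>]) (use skewD(1,2)[OF assms] in auto)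

lemma sum_split_moved:
  "(\<Sum>k<d. F k) = (\<Sum>k | k < d \<and> \<sigma> k \<noteq> k. F k) + (\<Sum>k | k < d \<and> \<sigma> k = k. F k :: 'a::comm_monoid_add)" for \<sigma> :: "nat \<Rightarrow> nat"
proof -
  have "{..<d} = {k. k < d \<and> \<sigma> k \<noteq> k} \<union> {k. k < d \<and> \<sigma> k = k}" by auto
  then show ?thesis by (simp only:) (rule sum.union_disjoint, auto)
qed

text \<open>The transpose of a rotation is its inverse. On the moved coordinates this is a
  reindexing by \<open>\<sigma>\<close>, where \<open>t\<close> changes sign.\<close>

lemma vrot_adjoint:
  assumes "skew d \<sigma> t"
  shows "(\<Sum>k<d. a k * vrot d \<sigma> t \<theta> b k) = (\<Sum>k<d. vrot d \<sigma> t (- \<theta>) a k * b k)"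
proof -
  let ?M = "{k. k < d \<and> \<sigma> k \<noteq> k}"
  have "(\<Sum>k\<in>?M. a k * t k * b (\<sigma> k)) = (\<Sum>k\<in>?M. a (\<sigma> (\<sigma> k)) * t (\<sigma> (\<sigma> k)) * b (\<sigma> k))"
    using skewD(2,4)[OF assms] by (intro sum.cong) auto
  also have "\<dots> = (\<Sum>k\<in>?M. a (\<sigma> k) * t (\<sigma> k) * b k)"
    by (rule sum_involution[OF assms, where F="\<lambda>k. a (\<sigma> k) * t (\<sigma> k) * b k"])
  also have "\<dots> = (\<Sum>k\<in>?M. - (a (\<sigma> k) * t k * b k))"
    using skewD(2,4)[OF assms] by (intro sum.cong) auto
  finally have key: "(\<Sum>k\<in>?M. a k * t k * b (\<sigma> k)) = (\<Sum>k\<in>?M. - (a (\<sigma> k) * t k * b k))" .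
  have "(\<Sum>k\<in>?M. a k * vrot d \<sigma> t \<theta> b k) = cos \<theta> * (\<Sum>k\<in>?M. a k * b k) + sin \<theta> * (\<Sum>k\<in>?M. a k * t k * b (\<sigma> k))"
    unfolding sum_distrib_left sum.distrib[symmetric]
    by (intro sum.cong) (auto simp: vrot_def algebra_simps)
  also have "\<dots> = (\<Sum>k\<in>?M. vrot d \<sigma> t (- \<theta>) a k * b k)"
    unfolding key unfolding sum_distrib_left sum.distrib[symmetric]
    by (intro sum.cong) (auto simp: vrot_def algebra_simps)
  finally have 1: "(\<Sum>k\<in>?M. a k * vrot d \<sigma> t \<theta> b k) = (\<Sum>k\<in>?M. vrot d \<sigma> t (- \<theta>) a k * b k)" .
  have 2: "(\<Sum>k | k < d \<and> \<sigma> k = k. a k * vrot d \<sigma> t \<theta> b k) = (\<Sum>k | k < d \<and> \<sigma> k = k. vrot d \<sigma> t (- \<theta>) a k * b k)"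
    by (intro sum.cong) (auto simp: vrot_def)
  show ?thesis
    unfolding sum_split_moved[where \<sigma>=\<sigma>] 1 2 ..
qed

lemma vrot_isometry:
  assumes "skew d \<sigma> t"
  shows "(\<Sum>k<d. vrot d \<sigma> t \<theta> a k * vrot d \<sigma> t \<theta> b k) = (\<Sum>k<d. a k * b k)"
  using vrot_adjoint[OF assms, of "vrot d \<sigma> t \<theta> a" \<theta> b] by (simp add: vrot_vrot[OF assms] vrot_0)

section \<open>Averaging over random pairings and signs\<close>

text \<open>The reflection of the residues modulo \<open>d\<close> with
  \<open>k + refl_pair d s k = s\<close> modulo \<open>d\<close>. As \<open>s\<close> varies, the
  partner of a fixed \<open>k\<close> takes every value exactly once, so \<open>d\<close> pairings
  already give each index a uniform partner.\<close>

definition refl_pair :: "nat \<Rightarrow> nat \<Rightarrow> nat \<Rightarrow> nat" where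
  "refl_pair d s k = (if k \<le> s then s - k else s + d - k)"

text \<open>A pair is named by its smaller index, and membership of that index in
  \<open>\<Xi>\<close> is a coin toss for the pair. The second factor makes the sign
  antisymmetric.\<close>

definition refl_sign :: "nat \<Rightarrow> nat \<Rightarrow> nat set \<Rightarrow> nat \<Rightarrow> real" where
  "refl_sign d s \<Xi> k = (if min k (refl_pair d s k) \<in> \<Xi> then 1 else - 1) * (if k < refl_pair d s k then 1 else - 1)"

lemma refl_pair_lt: "s < d \<Longrightarrow> k < d \<Longrightarrow> refl_pair d s k < d"
  and refl_pair_invol: "s < d \<Longrightarrow> k < d \<Longrightarrow> refl_pair d s (refl_pair d s k) = k"
  unfolding refl_pair_def by auto

lemma skew_refl: "s < d \<Longrightarrow> skew d (refl_pair d s) (refl_sign d s \<Xi>)"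
  unfolding skew_def
  by (auto simp: refl_pair_lt refl_pair_invol refl_sign_def min.commute)

lemma sum_refl_pair:
  fixes F :: "nat \<Rightarrow> 'a::comm_monoid_add"
  assumes "a < d"
  shows "(\<Sum>s<d. F (refl_pair d s a)) = (\<Sum>b<d. F b)"
  by (rule sum.reindex_bij_witness[where i="\<lambda>b. if a + b < d then a + b else a + b - d" and j="\<lambda>s. refl_pair d s a"])
     (use assms in \<open>auto simp: refl_pair_def\<close>)

text \<open>The offset \<open>x\<close> carries the induction: splitting the subsets by whether they
  contain \<open>a\<close> replaces \<open>x\<close> by \<open>x - b a\<close> or
  \<open>x + b a\<close>, and the cross terms cancel in the sum of the two.\<close>

lemma rademacher_second_moment:
  fixes b :: "nat \<Rightarrow> real"
  assumes "finite S"
  shows "(\<Sum>\<Xi>\<in>Pow S. (x + (\<Sum>k\<in>S. (if k \<in> \<Xi> then 1 else - 1) * b k))\<^sup>2) = 2 ^ card S * (x\<^sup>2 + (\<Sum>k\<in>S. (b k)\<^sup>2))"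
  using assms
proof (induction S arbitrary: x)
  case (insert a S)
  have i: "inj_on (insert a) (Pow S)" using insert.hyps(2) by (auto simp: inj_on_def)
  let ?e = "\<lambda>\<Xi> k. (if k \<in> \<Xi> then 1 else - 1) * b k"
  have "(\<Sum>\<Xi>\<in>Pow (insert a S). (x + (\<Sum>k\<in>insert a S. ?e \<Xi> k))\<^sup>2)
    = (\<Sum>\<Xi>\<in>Pow S. (x + (\<Sum>k\<in>insert a S. ?e \<Xi> k))\<^sup>2) + (\<Sum>\<Xi>\<in>Pow S. (x + (\<Sum>k\<in>insert a S. ?e (insert a \<Xi>) k))\<^sup>2)"
    unfolding Pow_insert using insert.hyps i
    by (subst sum.union_disjoint) (auto simp: sum.reindex)
  also have "(\<Sum>\<Xi>\<in>Pow S. (x + (\<Sum>k\<in>insert a S. ?e \<Xi> k))\<^sup>2) = (\<Sum>\<Xi>\<in>Pow S. ((x - b a) + (\<Sum>k\<in>S. ?e \<Xi> k))\<^sup>2)"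
  proof (rule sum.cong[OF refl])
    fix \<Xi> assume "\<Xi> \<in> Pow S"
    then have "a \<notin> \<Xi>" using insert.hyps(2) by auto
    then show "(x + (\<Sum>k\<in>insert a S. ?e \<Xi> k))\<^sup>2 = ((x - b a) + (\<Sum>k\<in>S. ?e \<Xi> k))\<^sup>2"
      using insert.hyps by (simp add: algebra_simps)
  qed
  also have "(\<Sum>\<Xi>\<in>Pow S. (x + (\<Sum>k\<in>insert a S. ?e (insert a \<Xi>) k))\<^sup>2) = (\<Sum>\<Xi>\<in>Pow S. ((x + b a) + (\<Sum>k\<in>S. ?e \<Xi> k))\<^sup>2)"
  proof (rule sum.cong[OF refl])
    fix \<Xi> assume "\<Xi> \<in> Pow S"
    have "(\<Sum>k\<in>S. ?e (insert a \<Xi>) k) = (\<Sum>k\<in>S. ?e \<Xi> k)"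
      using insert.hyps(2) by (intro sum.cong) auto
    then show "(x + (\<Sum>k\<in>insert a S. ?e (insert a \<Xi>) k))\<^sup>2 = ((x + b a) + (\<Sum>k\<in>S. ?e \<Xi> k))\<^sup>2"
      using insert.hyps by (simp add: algebra_simps)
  qed
  also have "(\<Sum>\<Xi>\<in>Pow S. ((x - b a) + (\<Sum>k\<in>S. ?e \<Xi> k))\<^sup>2) + (\<Sum>\<Xi>\<in>Pow S. ((x + b a) + (\<Sum>k\<in>S. ?e \<Xi> k))\<^sup>2)
     = 2 ^ card S * ((x - b a)\<^sup>2 + (\<Sum>k\<in>S. (b k)\<^sup>2)) + 2 ^ card S * ((x + b a)\<^sup>2 + (\<Sum>k\<in>S. (b k)\<^sup>2))"
    by (simp only: insert.IH)
  also have "\<dots> = 2 ^ card (insert a S) * (x\<^sup>2 + (\<Sum>k\<in>insert a S. (b k)\<^sup>2))"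
    using insert.hyps by (simp add: power2_eq_square algebra_simps)
  finally show ?case .
qed simp

text \<open>Expectation over a uniform pairing and independent fair signs, as a finite sum; no
  second probability space is needed.\<close>

definition avg_refl :: "nat \<Rightarrow> (nat \<Rightarrow> nat set \<Rightarrow> real) \<Rightarrow> real" where
  "avg_refl d F = (\<Sum>s<d. \<Sum>\<Xi>\<in>Pow {..<d}. F s \<Xi>) / (d * 2 ^ d)"

lemma avg_refl_mono:
  assumes "\<And>s \<Xi>. s < d \<Longrightarrow> \<Xi> \<subseteq> {..<d} \<Longrightarrow> F s \<Xi> \<le> G s \<Xi>"
  shows "avg_refl d F \<le> avg_refl d G"
  unfolding avg_refl_def using assms by (intro divide_right_mono sum_mono) auto

lemma avg_refl_add: "avg_refl d (\<lambda>s \<Xi>. F s \<Xi> + G s \<Xi>) = avg_refl d F + avg_refl d G"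
  unfolding avg_refl_def by (simp add: sum.distrib add_divide_distrib)

lemma avg_refl_cmult: "avg_refl d (\<lambda>s \<Xi>. c * F s \<Xi>) = c * avg_refl d F"
  unfolding avg_refl_def by (simp add: sum_distrib_left)

lemma avg_refl_sum: "avg_refl d (\<lambda>s \<Xi>. \<Sum>k\<in>K. F k s \<Xi>) = (\<Sum>k\<in>K. avg_refl d (F k))"
  by (induction K rule: infinite_finite_induct) (simp_all add: avg_refl_add, simp_all add: avg_refl_def)

lemma avg_refl_const: "0 < d \<Longrightarrow> avg_refl d (\<lambda>s \<Xi>. c) = c"
  unfolding avg_refl_def by (simp add: card_Pow)

lemma avg_refl_exists:
  assumes "0 < d"
  shows "\<exists>s \<Xi>. s < d \<and> F s \<Xi> \<le> avg_refl d F"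
proof (rule ccontr)
  assume "\<not> ?thesis"
  then have *: "\<And>s \<Xi>. s < d \<Longrightarrow> avg_refl d F < F s \<Xi>" by (meson not_le)
  have "(\<Sum>s<d. \<Sum>\<Xi>\<in>Pow {..<d}. avg_refl d F) < (\<Sum>s<d. \<Sum>\<Xi>\<in>Pow {..<d}. F s \<Xi>)"
    using assms * by (intro sum_strict_mono) auto
  then show False using assms by (simp add: avg_refl_def card_Pow field_simps)
qed

lemma sum_involution_pairs:
  fixes G :: "nat \<Rightarrow> real" and \<sigma> :: "nat \<Rightarrow> nat"
  assumes "\<And>k. k < d \<Longrightarrow> \<sigma> k < d" "\<And>k. k < d \<Longrightarrow> \<sigma> (\<sigma> k) = k"
  shows "(\<Sum>k | k < d \<and> \<sigma> k \<noteq> k. G k) = (\<Sum>k | k < d \<and> k < \<sigma> k. G k + G (\<sigma> k))"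
proof -
  define L U where "L = {k. k < d \<and> k < \<sigma> k}" and "U = {k. k < d \<and> \<sigma> k < k}"
  have UL: "(\<Sum>k\<in>U. G k) = (\<Sum>k\<in>L. G (\<sigma> k))"
    by (rule sum.reindex_bij_witness[where i=\<sigma> and j=\<sigma>]) (auto simp: assms L_def U_def)
  have "{k. k < d \<and> \<sigma> k \<noteq> k} = L \<union> U"
    unfolding L_def U_def by (auto elim: linorder_neqE_nat)
  then have "(\<Sum>k | k < d \<and> \<sigma> k \<noteq> k. G k) = sum G (L \<union> U)"
    by (rule arg_cong)
  also have "\<dots> = sum G L + sum G U"
  proof (rule sum.union_disjoint)
    show "finite L" "finite U" by (simp_all add: L_def U_def)
    show "L \<inter> U = {}" by (auto simp: L_def U_def)
  qed
  finally show ?thesis unfolding L_def[symmetric] sum.distrib UL .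
qed

text \<open>For a fixed pairing the form is a Rademacher sum over pairs with coefficients
  \<open>B k (\<sigma> k) - B (\<sigma> k) k\<close>, whose mean square is the sum of their squares.
  Averaging over the pairing makes the partner of each row index uniform, which yields the squared
  Frobenius norm over \<open>d\<close>.\<close>

lemma skew_isotropic:
  fixes B :: "nat \<Rightarrow> nat \<Rightarrow> real"
  assumes "0 < d"
  shows "avg_refl d (\<lambda>s \<Xi>. (\<Sum>k | k < d \<and> refl_pair d s k \<noteq> k. refl_sign d s \<Xi> k * B k (refl_pair d s k))\<^sup>2)
    \<le> 2 / d * (\<Sum>a<d. \<Sum>b<d. (B a b)\<^sup>2)"
proof -
  have fixs: "(\<Sum>\<Xi>\<in>Pow {..<d}. (\<Sum>k | k < d \<and> refl_pair d s k \<noteq> k. refl_sign d s \<Xi> k * B k (refl_pair d s k))\<^sup>2)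
     \<le> 2 ^ d * (2 * (\<Sum>k<d. (B k (refl_pair d s k))\<^sup>2))" if s: "s < d" for s
  proof -
    define \<sigma> where "\<sigma> = refl_pair d s"
    have inv: "\<And>k. k < d \<Longrightarrow> \<sigma> k < d" "\<And>k. k < d \<Longrightarrow> \<sigma> (\<sigma> k) = k"
      unfolding \<sigma>_def by (rule refl_pair_lt[OF s], assumption, rule refl_pair_invol[OF s], assumption)
    \<comment> \<open>Each pair is represented by its smaller index, with value 0 elsewhere, so the
      sum can run over all of \<open>{..<d}\<close> and match the sign patterns
      \<open>Pow {..<d}\<close>.\<close>
    define b where "b k = (if k < \<sigma> k then B k (\<sigma> k) - B (\<sigma> k) k else 0)" for k
    let ?L = "{k. k < d \<and> k < \<sigma> k}"
    have split: "(\<Sum>k | k < d \<and> \<sigma> k \<noteq> k. G k) = (\<Sum>k\<in>?L. G k + G (\<sigma> k))" for G :: "nat \<Rightarrow> real"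
      by (rule sum_involution_pairs[OF inv])
    have toall: "(\<Sum>k\<in>?L. G k) = (\<Sum>k<d. if k < \<sigma> k then G k else 0)" for G :: "nat \<Rightarrow> real"
      using sum.inter_filter[of "{..<d}" G "\<lambda>k. k < \<sigma> k"] by simp
    have e: "(\<Sum>k | k < d \<and> \<sigma> k \<noteq> k. refl_sign d s \<Xi> k * B k (\<sigma> k)) = (\<Sum>k<d. (if k \<in> \<Xi> then 1 else - 1) * b k)" for \<Xi>
    proof -
      have "(\<Sum>k | k < d \<and> \<sigma> k \<noteq> k. refl_sign d s \<Xi> k * B k (\<sigma> k)) = (\<Sum>k\<in>?L. (if k \<in> \<Xi> then 1 else - 1) * (B k (\<sigma> k) - B (\<sigma> k) k))"
        unfolding split
      proof (rule sum.cong[OF refl])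
        fix k assume "k \<in> ?L"
        then have k: "k < \<sigma> k" "\<sigma> (\<sigma> k) = k" using inv(2)[of k] by simp_all
        have "refl_sign d s \<Xi> k = (if k \<in> \<Xi> then 1 else - 1)" "refl_sign d s \<Xi> (\<sigma> k) = - (if k \<in> \<Xi> then 1 else - 1)"
          using k by (simp_all add: refl_sign_def \<sigma>_def[symmetric])
        then show "refl_sign d s \<Xi> k * B k (\<sigma> k) + refl_sign d s \<Xi> (\<sigma> k) * B (\<sigma> k) (\<sigma> (\<sigma> k))
          = (if k \<in> \<Xi> then 1 else - 1) * (B k (\<sigma> k) - B (\<sigma> k) k)"
          by (simp add: k(2) right_diff_distrib)
      qed
      then show ?thesis unfolding toall by (simp add: b_def if_distrib[of "\<lambda>x. _ * x"] cong: if_cong)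
    qed
    have first: "(\<Sum>\<Xi>\<in>Pow {..<d}. (\<Sum>k | k < d \<and> \<sigma> k \<noteq> k. refl_sign d s \<Xi> k * B k (\<sigma> k))\<^sup>2) = 2 ^ d * (\<Sum>k<d. (b k)\<^sup>2)"
      unfolding e using rademacher_second_moment[of "{..<d}" 0 b] by simp
    have "(\<Sum>k<d. (b k)\<^sup>2) = (\<Sum>k\<in>?L. (B k (\<sigma> k) - B (\<sigma> k) k)\<^sup>2)"
      unfolding toall by (intro sum.cong) (auto simp: b_def)
    also have "\<dots> \<le> (\<Sum>k\<in>?L. 2 * (B k (\<sigma> k))\<^sup>2 + 2 * (B (\<sigma> k) (\<sigma> (\<sigma> k)))\<^sup>2)"
    proof (rule sum_mono)
      fix k assume "k \<in> ?L"
      then have "\<sigma> (\<sigma> k) = k" using inv(2)[of k] by simp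
      moreover have "(x - y)\<^sup>2 \<le> 2 * x\<^sup>2 + 2 * y\<^sup>2" for x y :: real
        using zero_le_power2[of "x + y"] by (simp add: power2_eq_square algebra_simps)
      ultimately show "(B k (\<sigma> k) - B (\<sigma> k) k)\<^sup>2 \<le> 2 * (B k (\<sigma> k))\<^sup>2 + 2 * (B (\<sigma> k) (\<sigma> (\<sigma> k)))\<^sup>2" by simp
    qed
    also have "\<dots> = (\<Sum>k | k < d \<and> \<sigma> k \<noteq> k. 2 * (B k (\<sigma> k))\<^sup>2)" by (rule split[symmetric])
    also have "\<dots> \<le> (\<Sum>k<d. 2 * (B k (\<sigma> k))\<^sup>2)"
      by (rule sum_mono2) auto
    finally have "(\<Sum>k<d. (b k)\<^sup>2) \<le> 2 * (\<Sum>k<d. (B k (\<sigma> k))\<^sup>2)"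
      by (simp add: sum_distrib_left)
    then show ?thesis
      unfolding \<sigma>_def[symmetric] first by (rule mult_left_mono) simp
  qed
  have "avg_refl d (\<lambda>s \<Xi>. (\<Sum>k | k < d \<and> refl_pair d s k \<noteq> k. refl_sign d s \<Xi> k * B k (refl_pair d s k))\<^sup>2)
     \<le> (\<Sum>s<d. 2 ^ d * (2 * (\<Sum>k<d. (B k (refl_pair d s k))\<^sup>2))) / (d * 2 ^ d)"
    unfolding avg_refl_def using fixs by (intro divide_right_mono sum_mono) auto
  also have "\<dots> = 2 / d * (\<Sum>s<d. \<Sum>k<d. (B k (refl_pair d s k))\<^sup>2)"
    by (simp add: sum_distrib_left[symmetric])
  also have "(\<Sum>s<d. \<Sum>k<d. (B k (refl_pair d s k))\<^sup>2) = (\<Sum>k<d. \<Sum>s<d. (B k (refl_pair d s k))\<^sup>2)"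
    by (rule sum.swap)
  also have "\<dots> = (\<Sum>k<d. \<Sum>b<d. (B k b)\<^sup>2)"
    by (intro sum.cong refl sum_refl_pair[where F="\<lambda>b. (B _ b)\<^sup>2"]) auto
  finally show ?thesis .
qed

section \<open>Distance to a sign change\<close>

context xavier_net
begin

section \<open>Rotations absorbed by the first weight matrix\<close>

definition rotx :: "(nat \<Rightarrow> nat) \<Rightarrow> (nat \<Rightarrow> real) \<Rightarrow> real \<Rightarrow> (nat \<Rightarrow> nat \<Rightarrow> real) \<Rightarrow> (nat \<Rightarrow> nat \<Rightarrow> real)" where
  "rotx \<sigma> t \<theta> x = (\<lambda>j. vrot (dims 0) \<sigma> t \<theta> (x j))"

abbreviation sk :: "(nat \<Rightarrow> nat) \<Rightarrow> (nat \<Rightarrow> real) \<Rightarrow> bool" where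
  "sk \<equiv> skew (dims 0)"

definition wJ :: "(nat \<Rightarrow> nat) \<Rightarrow> (nat \<times> nat \<times> nat) set" where
  "wJ \<sigma> = {(v, r, c). (v, r, c) \<in> WI \<and> v = 1 \<and> \<sigma> (c mod dims 0) \<noteq> c mod dims 0}"

text \<open>The column of the partner channel within the same token of the window.\<close>

definition wtau :: "(nat \<Rightarrow> nat) \<Rightarrow> nat \<times> nat \<times> nat \<Rightarrow> nat \<times> nat \<times> nat" where
  "wtau \<sigma> = (\<lambda>(v, r, c). (v, r, c div dims 0 * dims 0 + \<sigma> (c mod dims 0)))"

text \<open>The sign in \<open>- t\<close> is that of the adjoint: rotating the inputs by
  \<open>\<theta>\<close> amounts to rotating each token block of the rows by
  \<open>- \<theta>\<close>.\<close>

definition wrot :: "(nat \<Rightarrow> nat) \<Rightarrow> (nat \<Rightarrow> real) \<Rightarrow> real \<Rightarrow> (nat \<times> nat \<times> nat \<Rightarrow> real) \<Rightarrow> (nat \<times> nat \<times> nat \<Rightarrow> real)" where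
  "wrot \<sigma> t = pairrot (wJ \<sigma>) (wtau \<sigma>) (\<lambda>(v, r, c). - t (c mod dims 0))"

lemma d_pos: "0 < dims 0"
  by (rule dims_pos) simp

lemma wJ_props:
  assumes sk: "sk \<sigma> t" and i: "(v, r, c) \<in> wJ \<sigma>"
  defines "c' \<equiv> c div dims 0 * dims 0 + \<sigma> (c mod dims 0)"
  shows "c' mod dims 0 = \<sigma> (c mod dims 0)" "c' div dims 0 = c div dims 0" "(v, r, c') \<in> wJ \<sigma>"
    "\<sigma> (c mod dims 0) \<noteq> c mod dims 0" "(v, r, c) \<in> WI" "v = 1"
proof -
  have m: "c mod dims 0 < dims 0" using d_pos by simp
  have s: "\<sigma> (c mod dims 0) < dims 0" by (rule skewD(1)[OF sk m])
  show a: "c' mod dims 0 = \<sigma> (c mod dims 0)" "c' div dims 0 = c div dims 0"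
    using s by (simp_all add: c'_def)
  show b: "\<sigma> (c mod dims 0) \<noteq> c mod dims 0" "(v, r, c) \<in> WI" "v = 1"
    using i by (auto simp: wJ_def)
  have "c div dims 0 < ws 1"
    using b by (simp add: weight_index_def less_mult_imp_div_less mult.commute)
  then have "c' < dims 0 * ws 1"
    unfolding c'_def using window_index[of "c div dims 0" 1 "\<sigma> (c mod dims 0)"] s by simp
  then have "(v, r, c') \<in> WI" using b(2,3) by (simp add: weight_index_def)
  moreover have "\<sigma> (c' mod dims 0) \<noteq> c' mod dims 0"
    unfolding a using b(1) skewD(2)[OF sk m] by simp
  ultimately show "(v, r, c') \<in> wJ \<sigma>" using b(3) by (simp add: wJ_def)
qed

lemma wJ_subset: "wJ \<sigma> \<subseteq> WI"
  by (auto simp: wJ_def)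

lemma wtau_wJ:
  assumes "sk \<sigma> t" "i \<in> wJ \<sigma>" shows "wtau \<sigma> i \<in> wJ \<sigma>"
  using wJ_props(3)[OF assms(1)] assms(2) by (cases i) (simp add: wtau_def)

lemma measurable_wrot:
  assumes "sk \<sigma> t" shows "wrot \<sigma> t \<theta> \<in> measurable PG PG"
  unfolding wrot_def by (rule measurable_pairrot[OF wJ_subset wtau_wJ[OF assms]])

lemma distr_wrot:
  assumes sk: "sk \<sigma> t" and c: "cos \<theta> \<noteq> 0"
  shows "distr PG PG (wrot \<sigma> t \<theta>) = PG"
  unfolding wrot_def
proof (rule distr_pairrot[OF wJ_subset _ _ _ _ _ c])
  fix i assume i: "i \<in> wJ \<sigma>"
  obtain v r c where ic: "i = (v, r, c)" by (cases i)
  note p = wJ_props[OF sk i[unfolded ic]]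
  have m: "c mod dims 0 < dims 0" using d_pos by simp
  note sD = skewD[OF sk m]
  show "wtau \<sigma> i \<in> wJ \<sigma>" by (rule wtau_wJ[OF sk i])
  show "wtau \<sigma> (wtau \<sigma> i) = i"
    unfolding ic wtau_def by (simp add: p(2) sD(1,2))
  have "wtau \<sigma> i \<in> WI" using wtau_wJ[OF sk i] wJ_subset by auto
  then show "sd (wtau \<sigma> i) = sd i" unfolding ic using p(5) by (simp add: sd_def wtau_def)
  show "(case i of (v, r, c) \<Rightarrow> - t (c mod dims 0)) = 1 \<or> (case i of (v, r, c) \<Rightarrow> - t (c mod dims 0)) = - 1"
    unfolding ic using sD(3) by auto
  show "(case wtau \<sigma> i of (v, r, c) \<Rightarrow> - t (c mod dims 0)) = - (case i of (v, r, c) \<Rightarrow> - t (c mod dims 0))"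
    unfolding ic wtau_def using sD(4)[OF p(4)] by (simp add: sD(1))
qed

text \<open>In the first layer this is adjointness of the rotation; later layers use untouched
  weights and receive equal inputs. The identity begins at layer 1, because layer 0 is the input
  itself.\<close>

lemma H_wrot:
  assumes sk: "sk \<sigma> t"
  shows "Suc u \<le> l \<Longrightarrow> r < dims (Suc u) \<Longrightarrow> H (Suc u) x (wrot \<sigma> t \<theta> w) i r = H (Suc u) (rotx \<sigma> t \<theta> x) w i r"
proof (induction u arbitrary: i r)
  case (0 i r)
  have w: "wrot \<sigma> t \<theta> w (1, r, p * dims 0 + k) = vrot (dims 0) \<sigma> t (- \<theta>) (\<lambda>k. w (1, r, p * dims 0 + k)) k"
    if "p < ws 1" "k < dims 0" for p k
  proof -
    have "(1, r, p * dims 0 + k) \<in> WI"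
      using 0 window_index[of p 1 k] that by (simp add: weight_index_def)
    then show ?thesis
      using that by (simp add: wrot_def pairrot_def wJ_def wtau_def vrot_def)
  qed
  have "(\<Sum>p<ws 1. \<Sum>k<dims 0. wrot \<sigma> t \<theta> w (1, r, p * dims 0 + k) * x (i * ss 1 + p) k)
     = (\<Sum>p<ws 1. \<Sum>k<dims 0. vrot (dims 0) \<sigma> t (- \<theta>) (\<lambda>k. w (1, r, p * dims 0 + k)) k * x (i * ss 1 + p) k)"
    by (intro sum.cong refl) (simp only: w lessThan_iff)
  also have "\<dots> = (\<Sum>p<ws 1. \<Sum>k<dims 0. w (1, r, p * dims 0 + k) * rotx \<sigma> t \<theta> x (i * ss 1 + p) k)"
    unfolding rotx_def by (rule sum.cong[OF refl]) (rule vrot_adjoint[OF sk, symmetric])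
  finally show ?case by (simp add: H_Suc H_0)
next
  case (Suc u i r)
  have w: "wrot \<sigma> t \<theta> w (Suc (Suc u), r, c) = w (Suc (Suc u), r, c)" for r c
    by (simp add: wrot_def pairrot_def wJ_def)
  show ?case
    unfolding H_Suc[of "Suc u"] w
    by (intro arg_cong[where f="if Suc (Suc u) = l then id else relu"] sum.cong refl)
       (use Suc in simp)
qed

definition out :: "(nat \<Rightarrow> nat \<Rightarrow> real) \<Rightarrow> (nat \<times> nat \<times> nat \<Rightarrow> real) \<Rightarrow> real" where
  "out x w = H l x w 0 0"

lemma out_wrot: "sk \<sigma> t \<Longrightarrow> out x (wrot \<sigma> t \<theta> w) = out (rotx \<sigma> t \<theta> x) w"
  unfolding out_def using H_wrot[of \<sigma> t "l - 1" 0] l_pos dims_last by simp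

lemma measurable_out [measurable]: "out x \<in> borel_measurable PG"
  unfolding out_def[abs_def] using dims_last by (intro measurable_H) auto

lemma rotx_rotx: "sk \<sigma> t \<Longrightarrow> rotx \<sigma> t \<theta> (rotx \<sigma> t \<phi> x) = rotx \<sigma> t (\<theta> + \<phi>) x"
  by (simp add: rotx_def vrot_vrot)

lemma rotx_0: "rotx \<sigma> t 0 x = x"
  by (simp add: rotx_def vrot_0)

definition dist2 :: "(nat \<Rightarrow> nat \<Rightarrow> real) \<Rightarrow> (nat \<Rightarrow> nat \<Rightarrow> real) \<Rightarrow> real" where
  "dist2 x y = (\<Sum>j<ns 0. \<Sum>k<dims 0. (x j k - y j k)\<^sup>2)"

lemma dist2_nonneg: "0 \<le> dist2 x y"
  by (simp add: dist2_def sum_nonneg)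

lemma dist2_rotx:
  assumes sk: "sk \<sigma> t" shows "dist2 (rotx \<sigma> t \<theta> x) (rotx \<sigma> t \<theta> y) = dist2 x y"
  unfolding dist2_def
proof (rule sum.cong[OF refl])
  fix j
  have "rotx \<sigma> t \<theta> x j k - rotx \<sigma> t \<theta> y j k = vrot (dims 0) \<sigma> t \<theta> (\<lambda>k. x j k - y j k) k" for k
    by (simp add: rotx_def vrot_def algebra_simps)
  then show "(\<Sum>k<dims 0. (rotx \<sigma> t \<theta> x j k - rotx \<sigma> t \<theta> y j k)\<^sup>2) = (\<Sum>k<dims 0. (x j k - y j k)\<^sup>2)"
    using vrot_isometry[OF sk, of \<theta> "\<lambda>k. x j k - y j k" "\<lambda>k. x j k - y j k"] by (simp add: power2_eq_square)
qed

text \<open>A smoothed and truncated distance from \<open>x\<close> to the points where the output has sign \<open>- s\<close>.\<close>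

definition phiset :: "real \<Rightarrow> real \<Rightarrow> real \<Rightarrow> (nat \<times> nat \<times> nat \<Rightarrow> real) \<Rightarrow> (nat \<Rightarrow> nat \<Rightarrow> real) \<Rightarrow> real set" where
  "phiset s B \<eta> w x = insert B {sqrt (dist2 x y + \<eta>\<^sup>2) | y. s * out y w < 0}"

text \<open>The cap \<open>B\<close> provides a value when no input has sign \<open>- s\<close> and
  makes all moments finite. The smoothing \<open>\<eta>\<close> keeps the square root away from 0,
  so the second-order error of an increment is controlled by \<open>1 / \<eta>\<close>.\<close>

definition phi :: "real \<Rightarrow> real \<Rightarrow> real \<Rightarrow> (nat \<times> nat \<times> nat \<Rightarrow> real) \<Rightarrow> (nat \<Rightarrow> nat \<Rightarrow> real) \<Rightarrow> real" where
  "phi s B \<eta> w x = Inf (phiset s B \<eta> w x)"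

lemma phiset_nonneg: "0 \<le> B \<Longrightarrow> a \<in> phiset s B \<eta> w x \<Longrightarrow> 0 \<le> a"
  by (auto simp: phiset_def dist2_nonneg)

lemma phiset_ne: "phiset s B \<eta> w x \<noteq> {}"
  by (simp add: phiset_def)

lemma phiset_bdd: "0 \<le> B \<Longrightarrow> bdd_below (phiset s B \<eta> w x)"
  using phiset_nonneg by (intro bdd_belowI[of _ 0]) auto

lemma phi_nonneg: "0 \<le> B \<Longrightarrow> 0 \<le> phi s B \<eta> w x"
  unfolding phi_def using phiset_nonneg by (intro cInf_greatest phiset_ne) auto

lemma phi_le: "0 \<le> B \<Longrightarrow> a \<in> phiset s B \<eta> w x \<Longrightarrow> phi s B \<eta> w x \<le> a"
  unfolding phi_def by (rule cInf_lower[OF _ phiset_bdd])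

lemma phi_le_B: "0 \<le> B \<Longrightarrow> phi s B \<eta> w x \<le> B"
  by (rule phi_le) (auto simp: phiset_def)

lemma phi_less_iff: "0 \<le> B \<Longrightarrow> phi s B \<eta> w x < a \<longleftrightarrow> B < a \<or> (\<exists>y. s * out y w < 0 \<and> sqrt (dist2 x y + \<eta>\<^sup>2) < a)"
  unfolding phi_def by (subst cInf_less_iff[OF phiset_ne phiset_bdd]) (auto simp: phiset_def)

text \<open>The candidates \<open>y\<close> can be rotated along with \<open>x\<close>, since
  rotations preserve distances and carry sign changes to sign changes. An increment along the
  rotation path thereby becomes an increment at the unrotated input for rotated weights.\<close>

lemma phi_rot:
  assumes sk: "sk \<sigma> t"
  shows "phi s B \<eta> w (rotx \<sigma> t \<theta> x) = phi s B \<eta> (wrot \<sigma> t \<theta> w) x"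
proof -
  have "{sqrt (dist2 (rotx \<sigma> t \<theta> x) y + \<eta>\<^sup>2) | y. s * out y w < 0}
     = {sqrt (dist2 x y + \<eta>\<^sup>2) | y. s * out y (wrot \<sigma> t \<theta> w) < 0}" (is "?A = ?B")
  proof (rule subset_antisym; rule subsetI)
    fix a assume "a \<in> ?A"
    then obtain y where y: "a = sqrt (dist2 (rotx \<sigma> t \<theta> x) y + \<eta>\<^sup>2)" "s * out y w < 0" by auto
    have yy: "rotx \<sigma> t \<theta> (rotx \<sigma> t (- \<theta>) y) = y" by (simp add: rotx_rotx[OF sk] rotx_0)
    have "a = sqrt (dist2 x (rotx \<sigma> t (- \<theta>) y) + \<eta>\<^sup>2)"
      using y(1) dist2_rotx[OF sk, of \<theta> x "rotx \<sigma> t (- \<theta>) y"] by (simp add: yy)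
    moreover have "s * out (rotx \<sigma> t (- \<theta>) y) (wrot \<sigma> t \<theta> w) < 0"
      using y(2) by (simp add: out_wrot[OF sk] yy)
    ultimately show "a \<in> ?B" by blast
  next
    fix a assume "a \<in> ?B"
    then obtain y where y: "a = sqrt (dist2 x y + \<eta>\<^sup>2)" "s * out y (wrot \<sigma> t \<theta> w) < 0" by auto
    then show "a \<in> ?A"
      by (intro CollectI exI[of _ "rotx \<sigma> t \<theta> y"]) (simp add: dist2_rotx[OF sk] out_wrot[OF sk])
  qed
  then show ?thesis by (simp add: phi_def phiset_def)
qed

section \<open>Measurability of the truncated distance\<close>

lemma relu_tendsto: "(f \<longlongrightarrow> a) F \<Longrightarrow> ((\<lambda>x. relu (f x)) \<longlongrightarrow> relu a) F"
  unfolding relu_def by (intro tendsto_max tendsto_const)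

lemma H_tendsto:
  assumes "\<And>j k. (\<lambda>N. y N j k) \<longlonglongrightarrow> x j k"
  shows "(\<lambda>N. H v (y N) w i r) \<longlonglongrightarrow> H v x w i r"
proof (induction v arbitrary: i r)
  case 0
  then show ?case using assms by (simp add: H_0)
next
  case (Suc u)
  have "(\<lambda>N. \<Sum>p<ws (Suc u). \<Sum>k<dims u. w (Suc u, r, p * dims u + k) * H u (y N) w (i * ss (Suc u) + p) k)
     \<longlonglongrightarrow> (\<Sum>p<ws (Suc u). \<Sum>k<dims u. w (Suc u, r, p * dims u + k) * H u x w (i * ss (Suc u) + p) k)"
    by (intro tendsto_sum tendsto_mult tendsto_const Suc.IH)
  note lim = this
  show ?case
  proof (cases "Suc u = l")
    case True
    from lim show ?thesis unfolding H_Suc if_P[OF True] id_def .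
  next
    case False
    from relu_tendsto[OF lim] show ?thesis unfolding H_Suc if_not_P[OF False] .
  qed
qed

text \<open>A countable set of inputs that is dense for pointwise convergence. Inputs are functions
  on all of \<open>nat\<close> in both arguments, hence the truncation to
  \<open>j, k < N\<close>.\<close>

definition grid :: "(nat \<Rightarrow> nat \<Rightarrow> real) set" where
  "grid = (\<Union>N::nat. (\<lambda>(g :: nat \<times> nat \<Rightarrow> int) j k. if j < N \<and> k < N then of_int (g (j, k)) / of_nat N else 0)
     ` (PiE ({..<N} \<times> {..<N}) (\<lambda>_. UNIV)))"

lemma countable_grid: "countable grid"
  unfolding grid_def
proof (rule countable_UN)
  show "countable ((\<lambda>(g :: nat \<times> nat \<Rightarrow> int) j k. if j < N \<and> k < N then of_int (g (j, k)) / of_nat N else 0 :: real)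
     ` (PiE ({..<N} \<times> {..<N}) (\<lambda>_. UNIV)))" for N :: nat
    by (rule countable_image, rule countable_PiE) simp_all
qed simp

lemma grid_approx:
  obtains y :: "nat \<Rightarrow> nat \<Rightarrow> nat \<Rightarrow> real" where "\<And>N. y N \<in> grid" "\<And>j k. (\<lambda>N. y N j k) \<longlonglongrightarrow> x j k"
proof
  define y where "y N j k = (if j < N \<and> k < N then of_int \<lfloor>real N * x j k\<rfloor> / real N else 0)" for N j k
  show "y N \<in> grid" for N
    unfolding grid_def
  proof (intro UN_I image_eqI)
    show "y N = (\<lambda>j k. if j < N \<and> k < N then of_int ((\<lambda>p\<in>{..<N} \<times> {..<N}. \<lfloor>real N * x (fst p) (snd p)\<rfloor>) (j, k)) / of_nat N else 0)"
      by (rule ext, rule ext) (simp add: y_def)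
    show "(\<lambda>p\<in>{..<N} \<times> {..<N}. \<lfloor>real N * x (fst p) (snd p)\<rfloor>) \<in> PiE ({..<N} \<times> {..<N}) (\<lambda>_. UNIV)"
      by simp
  qed simp
  show "(\<lambda>N. y N j k) \<longlonglongrightarrow> x j k" for j k
  proof (rule real_tendsto_sandwich)
    show "\<forall>\<^sub>F N in sequentially. x j k - 1 / real N \<le> y N j k"
    proof (rule eventually_sequentiallyI[of "Suc (max j k)"])
      fix N assume N: "Suc (max j k) \<le> N"
      have "(real N * x j k - 1) / real N \<le> of_int \<lfloor>real N * x j k\<rfloor> / real N"
        by (rule divide_right_mono[OF real_of_int_floor_ge_diff_one]) simp
      then show "x j k - 1 / real N \<le> y N j k"
        using N by (auto simp: y_def diff_divide_distrib)
    qed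
    show "\<forall>\<^sub>F N in sequentially. y N j k \<le> x j k"
    proof (rule eventually_sequentiallyI[of "Suc (max j k)"])
      fix N assume N: "Suc (max j k) \<le> N"
      have "of_int \<lfloor>real N * x j k\<rfloor> / real N \<le> real N * x j k / real N"
        by (rule divide_right_mono[OF of_int_floor_le]) simp
      then show "y N j k \<le> x j k" using N by (auto simp: y_def)
    qed
    have "(\<lambda>N. x j k - 1 / real N) \<longlonglongrightarrow> x j k - 0"
      by (intro tendsto_diff tendsto_const lim_1_over_n)
    then show "(\<lambda>N. x j k - 1 / real N) \<longlonglongrightarrow> x j k" by simp
  qed simp
qed

lemma grid_dense:
  assumes "s * out y w < 0" "sqrt (dist2 x y + \<eta>\<^sup>2) < a"
  shows "\<exists>y\<in>grid. s * out y w < 0 \<and> sqrt (dist2 x y + \<eta>\<^sup>2) < a"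
proof -
  obtain z where z: "\<And>N. z N \<in> grid" "\<And>j k. (\<lambda>N. z N j k) \<longlonglongrightarrow> y j k" using grid_approx[of y] by blast
  have "(\<lambda>N. s * out (z N) w) \<longlonglongrightarrow> s * out y w"
    unfolding out_def by (intro tendsto_mult tendsto_const H_tendsto z)
  from order_tendstoD(2)[OF this assms(1)]
  have 1: "\<forall>\<^sub>F N in sequentially. s * out (z N) w < 0" .
  have "(\<lambda>N. sqrt (dist2 x (z N) + \<eta>\<^sup>2)) \<longlonglongrightarrow> sqrt (dist2 x y + \<eta>\<^sup>2)"
    unfolding dist2_def by (intro tendsto_intros z)
  from order_tendstoD(2)[OF this assms(2)]
  have 2: "\<forall>\<^sub>F N in sequentially. sqrt (dist2 x (z N) + \<eta>\<^sup>2) < a" .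
  from eventually_conj[OF 1 2] obtain N where "s * out (z N) w < 0 \<and> sqrt (dist2 x (z N) + \<eta>\<^sup>2) < a"
    by (auto simp: eventually_sequentially)
  then show ?thesis using z(1) by blast
qed

text \<open>The infimum runs over uncountably many inputs. Both conditions on \<open>y\<close> are
  strict and continuous in \<open>y\<close>, so in a sublevel set the existential may be restricted
  to \<open>grid\<close>, giving a countable union.\<close>

lemma measurable_phi [measurable]:
  assumes B: "0 \<le> B"
  shows "(\<lambda>w. phi s B \<eta> w x) \<in> borel_measurable PG"
  unfolding borel_measurable_iff_less
proof
  fix a
  have eq: "{w \<in> space PG. phi s B \<eta> w x < a} =
    (if B < a then space PG else (\<Union>y\<in>{y\<in>grid. sqrt (dist2 x y + \<eta>\<^sup>2) < a}. {w \<in> space PG. s * out y w < 0}))"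
  proof -
    have "(\<exists>y. s * out y w < 0 \<and> sqrt (dist2 x y + \<eta>\<^sup>2) < a) \<longleftrightarrow> (\<exists>y\<in>grid. s * out y w < 0 \<and> sqrt (dist2 x y + \<eta>\<^sup>2) < a)" for w
      using grid_dense[of s _ w x \<eta> a] by blast
    then show ?thesis unfolding phi_less_iff[OF B] by auto
  qed
  show "{w \<in> space PG. phi s B \<eta> w x < a} \<in> sets PG"
    unfolding eq using countable_grid by (auto intro!: sets.countable_UN'' countable_Collect)
qed

end

section \<open>The spectral norm and scalar inequalities\<close>

lemma spnorm_ge:
  assumes "(\<Sum>j<n. (u j)\<^sup>2) = 1"
  shows "sqrt (\<Sum>k<d. (\<Sum>j<n. u j * x j k)\<^sup>2) \<le> spnorm n d x"
  unfolding spnorm_def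
proof (rule cSup_upper)
  show "bdd_above {sqrt (\<Sum>k<d. (\<Sum>j<n. u j * x j k)\<^sup>2) | u. (\<Sum>j<n. (u j)\<^sup>2) = 1}"
  proof (rule bdd_aboveI)
    fix a assume "a \<in> {sqrt (\<Sum>k<d. (\<Sum>j<n. u j * x j k)\<^sup>2) | u. (\<Sum>j<n. (u j)\<^sup>2) = 1}"
    then obtain u where u: "a = sqrt (\<Sum>k<d. (\<Sum>j<n. u j * x j k)\<^sup>2)" "(\<Sum>j<n. (u j)\<^sup>2) = 1" by auto
    have "(\<Sum>k<d. (\<Sum>j<n. u j * x j k)\<^sup>2) \<le> (\<Sum>k<d. (\<Sum>j<n. (x j k)\<^sup>2))"
    proof (rule sum_mono)
      fix k
      show "(\<Sum>j<n. u j * x j k)\<^sup>2 \<le> (\<Sum>j<n. (x j k)\<^sup>2)"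
        using Cauchy_Schwarz_ineq_sum[of u "\<lambda>j. x j k" "{..<n}"] u(2) by simp
    qed
    then show "a \<le> sqrt (\<Sum>k<d. (\<Sum>j<n. (x j k)\<^sup>2))" unfolding u(1) by simp
  qed
qed (use assms in auto)

lemma spnorm_bound:
  assumes n: "0 < n"
  shows "(\<Sum>k<d. (\<Sum>j<n. u j * x j k)\<^sup>2) \<le> (spnorm n d x)\<^sup>2 * (\<Sum>j<n. (u j)\<^sup>2)"
proof (cases "(\<Sum>j<n. (u j)\<^sup>2) = 0")
  case True
  then have "\<forall>j\<in>{..<n}. (u j)\<^sup>2 = 0" by (subst (asm) sum_nonneg_eq_0_iff) auto
  then have "\<And>j. j < n \<Longrightarrow> u j = 0" by simp
  then have "(\<Sum>k<d. (\<Sum>j<n. u j * x j k)\<^sup>2) = 0" by simp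
  then show ?thesis using True by simp
next
  case False
  define c where "c = sqrt (\<Sum>j<n. (u j)\<^sup>2)"
  have S: "0 < (\<Sum>j<n. (u j)\<^sup>2)" using False sum_nonneg[of "{..<n}" "\<lambda>j. (u j)\<^sup>2"] by (simp add: less_le)
  then have c: "0 < c" and c2: "c\<^sup>2 = (\<Sum>j<n. (u j)\<^sup>2)" by (auto simp: c_def)
  have "(\<Sum>j<n. (u j / c)\<^sup>2) = 1"
    using S by (simp add: power_divide c2 sum_divide_distrib[symmetric])
  from spnorm_ge[OF this, where d=d and x=x]
  have "(sqrt (\<Sum>k<d. (\<Sum>j<n. u j / c * x j k)\<^sup>2))\<^sup>2 \<le> (spnorm n d x)\<^sup>2"
    by (rule power_mono) (simp add: sum_nonneg)
  then have "(\<Sum>k<d. (\<Sum>j<n. u j / c * x j k)\<^sup>2) \<le> (spnorm n d x)\<^sup>2"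
    by (simp add: sum_nonneg)
  also have "(\<Sum>k<d. (\<Sum>j<n. u j / c * x j k)\<^sup>2) = (\<Sum>k<d. (\<Sum>j<n. u j * x j k)\<^sup>2) / c\<^sup>2"
    by (simp add: sum_divide_distrib[symmetric] power_divide)
  finally show ?thesis using c by (simp add: c2[symmetric] field_simps)
qed

lemma one_minus_cos_le: "1 - cos x \<le> x\<^sup>2 / 2" for x :: real
proof -
  have "cos x = 1 - 2 * (sin (x / 2))\<^sup>2" using cos_double_sin[of "x / 2"] by simp
  moreover have "(sin (x / 2))\<^sup>2 \<le> (x / 2)\<^sup>2"
    using abs_sin_x_le_abs_x[of "x / 2"] unfolding abs_le_square_iff .
  ultimately show ?thesis by (simp add: power_divide)
qed

text \<open>The graph of the concave square root lies below its tangent at \<open>a\<close>.\<close>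

lemma sqrt_add_le:
  assumes "0 < a" "0 \<le> a + b"
  shows "sqrt (a + b) \<le> sqrt a + b / (2 * sqrt a)"
proof (rule real_le_lsqrt)
  have s: "0 < sqrt a" "sqrt a * sqrt a = a" using assms by auto
  have "0 \<le> (2 * a + b) / (2 * sqrt a)" using assms s by (intro divide_nonneg_pos) auto
  also have "(2 * a + b) / (2 * sqrt a) = sqrt a + b / (2 * sqrt a)"
    using s by (simp add: field_simps)
  finally show "0 \<le> sqrt a + b / (2 * sqrt a)" .
  have "(r + b / (2 * r))\<^sup>2 = r * r + b + (b / (2 * r))\<^sup>2" if "0 < r" for r
    using that by (simp add: power2_eq_square field_simps)
  from this[OF s(1)] have "(sqrt a + b / (2 * sqrt a))\<^sup>2 = a + b + (b / (2 * sqrt a))\<^sup>2"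
    unfolding s(2) .
  then show "a + b \<le> (sqrt a + b / (2 * sqrt a))\<^sup>2" by simp
qed

section \<open>Mean square change of the distance under rotations\<close>

context xavier_net
begin

text \<open>An almost optimal \<open>y\<close> for \<open>x\<close> remains a candidate for the
  rotated input, and expanding its distance yields the bound. The quantifier order is essential:
  \<open>e\<close> is produced before \<open>\<sigma>\<close>, \<open>t\<close> and
  \<open>\<delta>\<close>, so averaging over the skew matrix afterwards treats it as fixed. Only
  increases are bounded.\<close>

lemma phi_increment:
  fixes x :: "nat \<Rightarrow> nat \<Rightarrow> real"
  assumes B: "0 \<le> B" and eta: "0 < \<eta>" and kap: "0 < \<kappa>"
  defines "X2 \<equiv> (\<Sum>j<ns 0. \<Sum>k<dims 0. (x j k)\<^sup>2)"
  shows "\<exists>e. (\<Sum>j<ns 0. \<Sum>k<dims 0. (e j k)\<^sup>2) \<le> 1 \<and> (\<forall>\<sigma> t \<delta>. sk \<sigma> t \<longrightarrow>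
    phi s B \<eta> w (rotx \<sigma> t \<delta> x) - phi s B \<eta> w x
    \<le> \<bar>\<delta>\<bar> * \<bar>\<Sum>k | k < dims 0 \<and> \<sigma> k \<noteq> k. t k * (\<Sum>j<ns 0. e j k * x j (\<sigma> k))\<bar>
      + \<delta>\<^sup>2 * ((X2 + 1) / 4 + 2 * X2 / \<eta>) + \<kappa>)"
proof (cases "phi s B \<eta> w x = B")
  \<comment> \<open>At the cap \<open>B\<close> the value cannot increase, so \<open>e = 0\<close>
    serves.\<close>
  case True
  have X2: "0 \<le> X2" by (simp add: X2_def sum_nonneg)
  have "phi s B \<eta> w (rotx \<sigma> t \<delta> x) - phi s B \<eta> w x \<le> \<delta>\<^sup>2 * ((X2 + 1) / 4 + 2 * X2 / \<eta>) + \<kappa>" for \<sigma> t \<delta>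
  proof -
    have "phi s B \<eta> w (rotx \<sigma> t \<delta> x) - phi s B \<eta> w x \<le> 0" using phi_le_B[OF B] True by simp
    also have "0 \<le> \<delta>\<^sup>2 * ((X2 + 1) / 4 + 2 * X2 / \<eta>) + \<kappa>" using X2 eta kap by simp
    finally show ?thesis .
  qed
  then show ?thesis by (intro exI[of _ "\<lambda>_ _. 0"]) simp
next
  case False
  define p where "p = phi s B \<eta> w x"
  have pB: "p < B" using phi_le_B[OF B, of s \<eta> w x] False by (simp add: p_def)
  have "p < min B (p + \<kappa>)" using pB kap by simp
  then obtain y where y: "s * out y w < 0" "sqrt (dist2 x y + \<eta>\<^sup>2) < min B (p + \<kappa>)"
    unfolding p_def phi_less_iff[OF B] by auto
  define S where "S = sqrt (dist2 x y + \<eta>\<^sup>2)"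
  have S2: "S\<^sup>2 = dist2 x y + \<eta>\<^sup>2" by (simp add: S_def dist2_nonneg)
  have Seta: "\<eta> \<le> S" using eta dist2_nonneg[of x y] by (simp add: S_def real_le_rsqrt)
  have Spos: "0 < S" using Seta eta by linarith
  have Sp: "S \<le> p + \<kappa>" using y(2) by (simp add: S_def)
  \<comment> \<open>The gradient of the smoothed distance at \<open>x\<close>; its norm is at most 1
    because \<open>S\<close> includes \<open>\<eta>\<close>.\<close>
  define e where "e j k = (x j k - y j k) / S" for j k
  have X2: "0 \<le> X2" by (simp add: X2_def sum_nonneg)
  have e1: "(\<Sum>j<ns 0. \<Sum>k<dims 0. (e j k)\<^sup>2) \<le> 1"
  proof -
    have "(\<Sum>j<ns 0. \<Sum>k<dims 0. (e j k)\<^sup>2) = dist2 x y / S\<^sup>2"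
      by (simp add: e_def dist2_def power_divide sum_divide_distrib)
    also have "dist2 x y \<le> S\<^sup>2" using S2 by simp
    then have "dist2 x y / S\<^sup>2 \<le> 1" using Spos by (simp add: divide_le_eq_1)
    finally show ?thesis .
  qed
  have main: "phi s B \<eta> w (rotx \<sigma> t \<delta> x) - p
    \<le> \<bar>\<delta>\<bar> * \<bar>\<Sum>k | k < dims 0 \<and> \<sigma> k \<noteq> k. t k * (\<Sum>j<ns 0. e j k * x j (\<sigma> k))\<bar>
      + \<delta>\<^sup>2 * ((X2 + 1) / 4 + 2 * X2 / \<eta>) + \<kappa>" if sk: "sk \<sigma> t" for \<sigma> t \<delta>
  proof -
    let ?M = "{k. k < dims 0 \<and> \<sigma> k \<noteq> k}"
    define D where "D j k = rotx \<sigma> t \<delta> x j k - x j k" for j k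
    have DM: "D j k = (cos \<delta> - 1) * x j k + sin \<delta> * t k * x j (\<sigma> k)" if "k \<in> ?M" for j k
      using that by (simp add: D_def rotx_def vrot_def algebra_simps)
    have D0: "D j k = 0" if "k < dims 0" "\<sigma> k = k" for j k
      using that by (simp add: D_def rotx_def vrot_def)
    have onM: "(\<Sum>k<dims 0. F (D j k) k) = (\<Sum>k\<in>?M. F (D j k) k)" if "\<And>k. F 0 k = 0" for F :: "real \<Rightarrow> nat \<Rightarrow> real" and j
    proof -
      have "(\<Sum>k | k < dims 0 \<and> \<sigma> k = k. F (D j k) k) = 0"
        by (rule sum.neutral) (use that D0 in simp)
      then show ?thesis using sum_split_moved[where \<sigma>=\<sigma> and d="dims 0" and F="\<lambda>k. F (D j k) k"] by simp
    qed
    \<comment> \<open>\<open>L\<close> is the linear part of the change in distance, and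
      \<open>Q\<close> the squared displacement. Inside \<open>L\<close>, the sum \<open>Z\<close>
      multiplies \<open>sin \<delta>\<close> and is the first-order response, while \<open>Y\<close>
      multiplies \<open>cos \<delta> - 1\<close> and is of second order.\<close>
    define L where "L = (\<Sum>j<ns 0. \<Sum>k<dims 0. D j k * e j k)"
    define Q where "Q = (\<Sum>j<ns 0. \<Sum>k<dims 0. (D j k)\<^sup>2)"
    define Z where "Z = (\<Sum>k\<in>?M. t k * (\<Sum>j<ns 0. e j k * x j (\<sigma> k)))"
    define Y where "Y = (\<Sum>j<ns 0. \<Sum>k\<in>?M. x j k * e j k)"
    have Leq: "L = (cos \<delta> - 1) * Y + sin \<delta> * Z"
    proof -
      have "L = (\<Sum>j<ns 0. \<Sum>k\<in>?M. D j k * e j k)"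
        unfolding L_def using onM[of "\<lambda>a k. a * e _ k"] by simp
      also have "\<dots> = (\<Sum>j<ns 0. \<Sum>k\<in>?M. (cos \<delta> - 1) * (x j k * e j k) + sin \<delta> * (t k * (e j k * x j (\<sigma> k))))"
        by (intro sum.cong refl) (simp add: DM algebra_simps)
      also have "\<dots> = (cos \<delta> - 1) * Y + sin \<delta> * (\<Sum>j<ns 0. \<Sum>k\<in>?M. t k * (e j k * x j (\<sigma> k)))"
        by (simp add: Y_def sum.distrib sum_distrib_left)
      also have "(\<Sum>j<ns 0. \<Sum>k\<in>?M. t k * (e j k * x j (\<sigma> k))) = Z"
        unfolding Z_def sum_distrib_left by (rule sum.swap)
      finally show ?thesis .
    qed
    have subM: "(\<Sum>k\<in>?M. G k) \<le> (\<Sum>k<dims 0. G k)" if "\<And>k. 0 \<le> G k" for G :: "nat \<Rightarrow> real"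
      using that by (intro sum_mono2) auto
    have Yb: "\<bar>Y\<bar> \<le> (X2 + 1) / 2"
    proof -
      have "\<bar>Y\<bar> \<le> (\<Sum>j<ns 0. \<Sum>k\<in>?M. \<bar>x j k * e j k\<bar>)"
        unfolding Y_def by (rule order_trans[OF sum_abs]) (intro sum_mono sum_abs)
      also have "\<dots> \<le> (\<Sum>j<ns 0. \<Sum>k<dims 0. \<bar>x j k * e j k\<bar>)"
        by (intro sum_mono subM) simp
      also have "\<dots> \<le> (\<Sum>j<ns 0. \<Sum>k<dims 0. ((x j k)\<^sup>2 + (e j k)\<^sup>2) / 2)"
      proof (intro sum_mono)
        fix j k
        show "\<bar>x j k * e j k\<bar> \<le> ((x j k)\<^sup>2 + (e j k)\<^sup>2) / 2"
          using sum_squares_bound[of "\<bar>x j k\<bar>" "\<bar>e j k\<bar>"] by (simp add: abs_mult)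
      qed
      also have "\<dots> = (X2 + (\<Sum>j<ns 0. \<Sum>k<dims 0. (e j k)\<^sup>2)) / 2"
        by (simp add: X2_def sum.distrib sum_divide_distrib add_divide_distrib)
      also have "\<dots> \<le> (X2 + 1) / 2" using e1 by simp
      finally show ?thesis .
    qed
    have c1: "0 \<le> 1 - cos \<delta>" "1 - cos \<delta> \<le> \<delta>\<^sup>2 / 2" using one_minus_cos_le[of \<delta>] by simp_all
    have sn: "\<bar>sin \<delta>\<bar> \<le> \<bar>\<delta>\<bar>" by (rule abs_sin_x_le_abs_x)
    have Lb: "L \<le> \<bar>\<delta>\<bar> * \<bar>Z\<bar> + \<delta>\<^sup>2 * ((X2 + 1) / 4)"
    proof -
      have "L \<le> (1 - cos \<delta>) * \<bar>Y\<bar> + \<bar>sin \<delta>\<bar> * \<bar>Z\<bar>"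
      proof -
        have "(cos \<delta> - 1) * Y \<le> \<bar>(cos \<delta> - 1) * Y\<bar>" "sin \<delta> * Z \<le> \<bar>sin \<delta> * Z\<bar>" by simp_all
        then show ?thesis unfolding Leq using c1(1) by (simp add: abs_mult)
      qed
      also have "\<dots> \<le> (\<delta>\<^sup>2 / 2) * ((X2 + 1) / 2) + \<bar>\<delta>\<bar> * \<bar>Z\<bar>"
        using c1 Yb sn by (intro add_mono mult_mono) auto
      finally show ?thesis by simp
    qed
    have Qb: "Q \<le> 4 * \<delta>\<^sup>2 * X2"
    proof -
      have sqc: "(1 - cos \<delta>)\<^sup>2 \<le> \<delta>\<^sup>2"
      proof -
        have "1 - cos \<delta> \<le> 2" by (simp add: diff_le_eq) (smt (verit) cos_ge_minus_one)
        then have "(1 - cos \<delta>) * (1 - cos \<delta>) \<le> 2 * (\<delta>\<^sup>2 / 2)"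
          using c1 by (intro mult_mono) auto
        then show ?thesis by (simp add: power2_eq_square)
      qed
      have sqs: "(sin \<delta>)\<^sup>2 \<le> \<delta>\<^sup>2" using sn by (simp add: abs_le_square_iff)
      have row: "(\<Sum>k<dims 0. (D j k)\<^sup>2) \<le> 4 * \<delta>\<^sup>2 * (\<Sum>k<dims 0. (x j k)\<^sup>2)" for j
      proof -
        have "(\<Sum>k<dims 0. (D j k)\<^sup>2) = (\<Sum>k\<in>?M. (D j k)\<^sup>2)"
          using onM[of "\<lambda>a k. a\<^sup>2"] by simp
        also have "\<dots> \<le> (\<Sum>k\<in>?M. 2 * \<delta>\<^sup>2 * (x j k)\<^sup>2 + 2 * \<delta>\<^sup>2 * (x j (\<sigma> k))\<^sup>2)"
        proof (rule sum_mono)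
          fix k assume k: "k \<in> ?M"
          have tk: "(t k)\<^sup>2 = 1" using skew_square[OF sk, of k] k by (simp add: power2_eq_square)
          have ab: "(a + b)\<^sup>2 \<le> 2 * a\<^sup>2 + 2 * b\<^sup>2" for a b :: real
            using zero_le_power2[of "a - b"] by (simp add: power2_eq_square algebra_simps)
          have "(D j k)\<^sup>2 \<le> 2 * ((cos \<delta> - 1) * x j k)\<^sup>2 + 2 * (sin \<delta> * t k * x j (\<sigma> k))\<^sup>2"
            unfolding DM[OF k] by (rule ab)
          also have "\<dots> = 2 * ((1 - cos \<delta>)\<^sup>2 * (x j k)\<^sup>2) + 2 * ((sin \<delta>)\<^sup>2 * (x j (\<sigma> k))\<^sup>2)"
            by (simp add: power_mult_distrib tk power2_commute[of "cos \<delta>" 1])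
          also have "\<dots> \<le> 2 * (\<delta>\<^sup>2 * (x j k)\<^sup>2) + 2 * (\<delta>\<^sup>2 * (x j (\<sigma> k))\<^sup>2)"
            using sqc sqs by (intro add_mono mult_left_mono mult_right_mono) auto
          finally show "(D j k)\<^sup>2 \<le> 2 * \<delta>\<^sup>2 * (x j k)\<^sup>2 + 2 * \<delta>\<^sup>2 * (x j (\<sigma> k))\<^sup>2" by simp
        qed
        also have "\<dots> = 2 * \<delta>\<^sup>2 * (\<Sum>k\<in>?M. (x j k)\<^sup>2) + 2 * \<delta>\<^sup>2 * (\<Sum>k\<in>?M. (x j (\<sigma> k))\<^sup>2)"
          by (simp add: sum.distrib sum_distrib_left)
        also have "\<dots> = 4 * \<delta>\<^sup>2 * (\<Sum>k\<in>?M. (x j k)\<^sup>2)"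
          using sum_involution[OF sk, where F="\<lambda>k. (x j k)\<^sup>2"] by simp
        also have "\<dots> \<le> 4 * \<delta>\<^sup>2 * (\<Sum>k<dims 0. (x j k)\<^sup>2)"
          by (intro mult_left_mono subM) auto
        finally show ?thesis .
      qed
      have "Q \<le> (\<Sum>j<ns 0. 4 * \<delta>\<^sup>2 * (\<Sum>k<dims 0. (x j k)\<^sup>2))"
        unfolding Q_def by (intro sum_mono row)
      then show ?thesis by (simp add: X2_def sum_distrib_left)
    qed
    have dd: "dist2 (rotx \<sigma> t \<delta> x) y = dist2 x y + (2 * (S * L) + Q)"
    proof -
      have "(rotx \<sigma> t \<delta> x j k - y j k)\<^sup>2 = (x j k - y j k)\<^sup>2 + (2 * (S * (D j k * e j k)) + (D j k)\<^sup>2)" for j k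
      proof -
        have "S * e j k = x j k - y j k" using Spos by (simp add: e_def)
        then have "2 * (S * (D j k * e j k)) = 2 * (D j k * (x j k - y j k))"
          by (simp add: mult.left_commute)
        then show ?thesis by (simp add: D_def power2_eq_square algebra_simps)
      qed
      then show ?thesis
        by (simp add: dist2_def L_def Q_def sum.distrib sum_distrib_left)
    qed
    have mem: "sqrt (dist2 (rotx \<sigma> t \<delta> x) y + \<eta>\<^sup>2) \<in> phiset s B \<eta> w (rotx \<sigma> t \<delta> x)"
      using y(1) by (auto simp: phiset_def)
    have "phi s B \<eta> w (rotx \<sigma> t \<delta> x) \<le> sqrt (dist2 (rotx \<sigma> t \<delta> x) y + \<eta>\<^sup>2)"
      by (rule phi_le[OF B mem])
    also have "dist2 (rotx \<sigma> t \<delta> x) y + \<eta>\<^sup>2 = S\<^sup>2 + (2 * (S * L) + Q)"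
      unfolding dd S2 by simp
    also have "sqrt (S\<^sup>2 + (2 * (S * L) + Q)) \<le> sqrt (S\<^sup>2) + (2 * (S * L) + Q) / (2 * sqrt (S\<^sup>2))"
    proof (rule sqrt_add_le)
      show "0 \<le> S\<^sup>2 + (2 * (S * L) + Q)"
        using dist2_nonneg[of "rotx \<sigma> t \<delta> x" y] zero_le_power2[of \<eta>] unfolding dd S2 by linarith
    qed (use Spos in simp)
    also have "\<dots> = S + L + Q / (2 * S)" using Spos by (simp add: field_simps power2_eq_square)
    finally have "phi s B \<eta> w (rotx \<sigma> t \<delta> x) \<le> S + L + Q / (2 * S)" .
    \<comment> \<open>The smoothing enters here: \<open>S \<ge> \<eta>\<close> bounds the curvature
      of the distance.\<close>
    moreover have "Q / (2 * S) \<le> (4 * \<delta>\<^sup>2 * X2) / (2 * \<eta>)"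
      using Qb Seta eta X2 by (intro frac_le) auto
    moreover have "(4 * \<delta>\<^sup>2 * X2) / (2 * \<eta>) = \<delta>\<^sup>2 * (2 * X2 / \<eta>)" using eta by simp
    ultimately show ?thesis using Sp Lb unfolding Z_def distrib_left by linarith
  qed
  show ?thesis
    using e1 main unfolding p_def by (intro exI[of _ e]) blast
qed


abbreviation rotr :: "nat \<Rightarrow> nat set \<Rightarrow> real \<Rightarrow> (nat \<Rightarrow> nat \<Rightarrow> real) \<Rightarrow> (nat \<Rightarrow> nat \<Rightarrow> real)" where
  "rotr a \<Xi> \<equiv> rotx (refl_pair (dims 0) a) (refl_sign (dims 0) a \<Xi>)"

abbreviation wrotr :: "nat \<Rightarrow> nat set \<Rightarrow> real \<Rightarrow> (nat \<times> nat \<times> nat \<Rightarrow> real) \<Rightarrow> (nat \<times> nat \<times> nat \<Rightarrow> real)" where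
  "wrotr a \<Xi> \<equiv> wrot (refl_pair (dims 0) a) (refl_sign (dims 0) a \<Xi>)"

lemma sk_refl: "a < dims 0 \<Longrightarrow> sk (refl_pair (dims 0) a) (refl_sign (dims 0) a \<Xi>)"
  by (rule skew_refl)

text \<open>Second-order constant of \<open>phi_increment\<close>; the final \<open>+ 1\<close>
  covers the slack \<open>\<kappa>\<close>, which is taken to be
  \<open>\<delta>\<^sup>2\<close>.\<close>

definition incr_const :: "real \<Rightarrow> (nat \<Rightarrow> nat \<Rightarrow> real) \<Rightarrow> real" where
  "incr_const \<eta> x = ((\<Sum>j<ns 0. \<Sum>k<dims 0. (x j k)\<^sup>2) + 1) / 4 + 2 * (\<Sum>j<ns 0. \<Sum>k<dims 0. (x j k)\<^sup>2) / \<eta> + 1"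

text \<open>The first-order response is the form of \<open>skew_isotropic\<close> for the matrix
  \<open>Bm\<close>, the product of the direction \<open>e\<close> with the tokens. Its squared
  Frobenius norm is at most that of \<open>e\<close> times the squared spectral norm, and
  \<open>e\<close> has norm at most 1.\<close>

lemma phi_increment_avg:
  assumes B: "0 \<le> B" and eta: "0 < \<eta>" and del: "\<delta> \<noteq> 0"
  shows "avg_refl (dims 0) (\<lambda>a \<Xi>. (max 0 (phi s B \<eta> w (rotr a \<Xi> \<delta> x) - phi s B \<eta> w x))\<^sup>2)
    \<le> 4 * \<delta>\<^sup>2 * (spnorm (ns 0) (dims 0) x)\<^sup>2 / dims 0 + 2 * (\<delta>\<^sup>2 * incr_const \<eta> x)\<^sup>2"
proof -
  let ?d = "dims 0" let ?C = "\<delta>\<^sup>2 * incr_const \<eta> x"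
  define sp where "sp = spnorm (ns 0) ?d x"
  have d2: "0 < \<delta>\<^sup>2" using del by simp
  obtain e where e1: "(\<Sum>j<ns 0. \<Sum>k<?d. (e j k)\<^sup>2) \<le> 1"
    and e: "\<And>\<sigma> t \<delta>'. sk \<sigma> t \<Longrightarrow> phi s B \<eta> w (rotx \<sigma> t \<delta>' x) - phi s B \<eta> w x
      \<le> \<bar>\<delta>'\<bar> * \<bar>\<Sum>k | k < ?d \<and> \<sigma> k \<noteq> k. t k * (\<Sum>j<ns 0. e j k * x j (\<sigma> k))\<bar>
        + \<delta>'\<^sup>2 * (((\<Sum>j<ns 0. \<Sum>k<?d. (x j k)\<^sup>2) + 1) / 4 + 2 * (\<Sum>j<ns 0. \<Sum>k<?d. (x j k)\<^sup>2) / \<eta>) + \<delta>\<^sup>2"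
    using phi_increment[OF B eta d2, where x=x and s=s and w=w] by blast
  define Bm where "Bm a b = (\<Sum>j<ns 0. e j a * x j b)" for a b
  define Z where "Z a \<Xi> = (\<Sum>k | k < ?d \<and> refl_pair ?d a k \<noteq> k. refl_sign ?d a \<Xi> k * Bm k (refl_pair ?d a k))" for a \<Xi>
  have "avg_refl ?d (\<lambda>a \<Xi>. (max 0 (phi s B \<eta> w (rotr a \<Xi> \<delta> x) - phi s B \<eta> w x))\<^sup>2)
     \<le> avg_refl ?d (\<lambda>a \<Xi>. 2 * \<delta>\<^sup>2 * (Z a \<Xi>)\<^sup>2 + 2 * ?C\<^sup>2)"
  proof (rule avg_refl_mono)
    fix a \<Xi> assume a: "a < ?d"
    define u where "u = phi s B \<eta> w (rotr a \<Xi> \<delta> x) - phi s B \<eta> w x"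
    have Cpos: "0 \<le> ?C"
      using eta by (simp add: incr_const_def sum_nonneg)
    have "u \<le> \<bar>\<delta>\<bar> * \<bar>Z a \<Xi>\<bar> + ?C"
      using e[OF sk_refl[OF a], of \<Xi> \<delta>] unfolding u_def Z_def Bm_def incr_const_def
      by (simp add: algebra_simps)
    then have "max 0 u \<le> \<bar>\<delta>\<bar> * \<bar>Z a \<Xi>\<bar> + ?C" using Cpos by simp
    then have "(max 0 u)\<^sup>2 \<le> (\<bar>\<delta>\<bar> * \<bar>Z a \<Xi>\<bar> + ?C)\<^sup>2" by (intro power_mono) auto
    also have "\<dots> \<le> 2 * (\<bar>\<delta>\<bar> * \<bar>Z a \<Xi>\<bar>)\<^sup>2 + 2 * ?C\<^sup>2"
    proof -
      have "(p + q)\<^sup>2 \<le> 2 * p\<^sup>2 + 2 * q\<^sup>2" for p q :: real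
        using zero_le_power2[of "p - q"] by (simp add: power2_eq_square algebra_simps)
      then show ?thesis .
    qed
    finally show "(max 0 (phi s B \<eta> w (rotr a \<Xi> \<delta> x) - phi s B \<eta> w x))\<^sup>2 \<le> 2 * \<delta>\<^sup>2 * (Z a \<Xi>)\<^sup>2 + 2 * ?C\<^sup>2"
      by (simp add: u_def power_mult_distrib)
  qed
  also have "\<dots> = 2 * \<delta>\<^sup>2 * avg_refl ?d (\<lambda>a \<Xi>. (Z a \<Xi>)\<^sup>2) + 2 * ?C\<^sup>2"
    by (simp only: avg_refl_add avg_refl_cmult avg_refl_const[OF d_pos])
  finally have 1: "avg_refl ?d (\<lambda>a \<Xi>. (max 0 (phi s B \<eta> w (rotr a \<Xi> \<delta> x) - phi s B \<eta> w x))\<^sup>2)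
     \<le> 2 * \<delta>\<^sup>2 * avg_refl ?d (\<lambda>a \<Xi>. (Z a \<Xi>)\<^sup>2) + 2 * ?C\<^sup>2" .
  have "(\<Sum>a<?d. \<Sum>b<?d. (Bm a b)\<^sup>2) \<le> (\<Sum>a<?d. sp\<^sup>2 * (\<Sum>j<ns 0. (e j a)\<^sup>2))"
    unfolding Bm_def sp_def using ns_pos[of 0] by (intro sum_mono spnorm_bound) simp
  also have "\<dots> = sp\<^sup>2 * (\<Sum>j<ns 0. \<Sum>k<?d. (e j k)\<^sup>2)"
    unfolding sum_distrib_left by (rule sum.swap)
  also have "\<dots> \<le> sp\<^sup>2 * 1" using e1 by (intro mult_left_mono) auto
  finally have Bb: "(\<Sum>a<?d. \<Sum>b<?d. (Bm a b)\<^sup>2) \<le> sp\<^sup>2" by simp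
  have "avg_refl ?d (\<lambda>a \<Xi>. (Z a \<Xi>)\<^sup>2) \<le> 2 / ?d * (\<Sum>a<?d. \<Sum>b<?d. (Bm a b)\<^sup>2)"
    unfolding Z_def by (rule skew_isotropic[OF d_pos])
  also have "\<dots> \<le> 2 / ?d * sp\<^sup>2" using Bb by (intro mult_left_mono) auto
  finally have "2 * \<delta>\<^sup>2 * avg_refl ?d (\<lambda>a \<Xi>. (Z a \<Xi>)\<^sup>2) \<le> 2 * \<delta>\<^sup>2 * (2 / ?d * sp\<^sup>2)"
    by (intro mult_left_mono) auto
  with 1 show ?thesis by (simp add: sp_def)
qed

lemma integral_wrot:
  fixes F :: "(nat \<times> nat \<times> nat \<Rightarrow> real) \<Rightarrow> real"
  assumes sk: "sk \<sigma> t" "cos \<theta> \<noteq> 0" and [measurable]: "F \<in> borel_measurable PG"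
  shows "(\<integral>w. F (wrot \<sigma> t \<theta> w) \<partial>PG) = (\<integral>w. F w \<partial>PG)"
proof -
  have "(\<integral>w. F w \<partial>PG) = (\<integral>w. F w \<partial>distr PG PG (wrot \<sigma> t \<theta>))"
    by (simp add: distr_wrot[OF sk])
  also have "\<dots> = (\<integral>w. F (wrot \<sigma> t \<theta> w) \<partial>PG)"
    by (rule integral_distr[OF measurable_wrot[OF sk(1)]]) measurable
  finally show ?thesis by simp
qed

lemma integrable_phi_diff:
  assumes B: "0 \<le> B"
  shows "integrable PG (\<lambda>w. (phi s B \<eta> w x - phi s B \<eta> w y)\<^sup>2)"
    and "integrable PG (\<lambda>w. (max 0 (phi s B \<eta> w x - phi s B \<eta> w y))\<^sup>2)"
proof -
  note [measurable] = measurable_phi[OF B]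
  have le: "\<bar>phi s B \<eta> w x - phi s B \<eta> w y\<bar> \<le> B" for w
    using phi_nonneg[OF B, of s \<eta> w x] phi_nonneg[OF B, of s \<eta> w y]
      phi_le_B[OF B, of s \<eta> w x] phi_le_B[OF B, of s \<eta> w y] by linarith
  have "(phi s B \<eta> w x - phi s B \<eta> w y)\<^sup>2 \<le> B\<^sup>2" for w
    using power_mono[OF le, of w 2] by simp
  then show "integrable PG (\<lambda>w. (phi s B \<eta> w x - phi s B \<eta> w y)\<^sup>2)"
    by (intro P.integrable_const_bound[where B="B\<^sup>2"]) auto
  have "(max 0 (phi s B \<eta> w x - phi s B \<eta> w y))\<^sup>2 \<le> B\<^sup>2" for w
    using le[of w] B by (intro power_mono) auto
  then show "integrable PG (\<lambda>w. (max 0 (phi s B \<eta> w x - phi s B \<eta> w y))\<^sup>2)"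
    by (intro P.integrable_const_bound[where B="B\<^sup>2"]) auto
qed

lemma avg_refl_integral:
  assumes "\<And>a \<Xi>. integrable PG (F a \<Xi>)"
  shows "avg_refl d (\<lambda>a \<Xi>. \<integral>w. F a \<Xi> w \<partial>PG) = (\<integral>w. avg_refl d (\<lambda>a \<Xi>. F a \<Xi> w) \<partial>PG)"
proof -
  have "(\<integral>w. (\<Sum>s<d. \<Sum>\<Xi>\<in>Pow {..<d}. F s \<Xi> w) \<partial>PG) = (\<Sum>s<d. \<integral>w. (\<Sum>\<Xi>\<in>Pow {..<d}. F s \<Xi> w) \<partial>PG)"
    using assms by (intro Bochner_Integration.integral_sum Bochner_Integration.integrable_sum)
  also have "\<dots> = (\<Sum>s<d. \<Sum>\<Xi>\<in>Pow {..<d}. \<integral>w. F s \<Xi> w \<partial>PG)"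
    using assms by (intro sum.cong refl Bochner_Integration.integral_sum)
  finally show ?thesis by (simp add: avg_refl_def)
qed

lemma integral_avg_refl_le:
  assumes i: "\<And>a \<Xi>. integrable PG (F a \<Xi>)" and le: "\<And>w. avg_refl d (\<lambda>a \<Xi>. F a \<Xi> w) \<le> c"
  shows "avg_refl d (\<lambda>a \<Xi>. \<integral>w. F a \<Xi> w \<partial>PG) \<le> c"
proof -
  have "integrable PG (\<lambda>w. avg_refl d (\<lambda>a \<Xi>. F a \<Xi> w))"
    unfolding avg_refl_def using i by (intro Bochner_Integration.integrable_divide Bochner_Integration.integrable_sum)
  then have "(\<integral>w. avg_refl d (\<lambda>a \<Xi>. F a \<Xi> w) \<partial>PG) \<le> (\<integral>w. c \<partial>PG)"
    using le by (intro integral_mono) auto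
  then show ?thesis by (simp add: avg_refl_integral[OF i] P.prob_space)
qed

text \<open>The pair \<open>(w, wrot w)\<close> is exchangeable up to the sign of \<open>\<delta>\<close>, so the one-sided bound on the
  increments of \<open>phi\<close> suffices.\<close>

lemma phi_step:
  assumes B: "0 \<le> B" and eta: "0 < \<eta>" and del: "\<delta> \<noteq> 0" "cos \<delta> \<noteq> 0"
  shows "avg_refl (dims 0) (\<lambda>a \<Xi>. \<integral>w. (phi s B \<eta> w (rotr a \<Xi> \<delta> x) - phi s B \<eta> w x)\<^sup>2 \<partial>PG)
    \<le> 2 * (4 * \<delta>\<^sup>2 * (spnorm (ns 0) (dims 0) x)\<^sup>2 / dims 0 + 2 * (\<delta>\<^sup>2 * incr_const \<eta> x)\<^sup>2)"
proof -
  note [measurable] = measurable_phi[OF B]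
  let ?c = "4 * \<delta>\<^sup>2 * (spnorm (ns 0) (dims 0) x)\<^sup>2 / dims 0 + 2 * (\<delta>\<^sup>2 * incr_const \<eta> x)\<^sup>2"
  let ?P = "\<lambda>\<delta> a \<Xi>. \<integral>w. (max 0 (phi s B \<eta> w (rotr a \<Xi> \<delta> x) - phi s B \<eta> w x))\<^sup>2 \<partial>PG"
  have "avg_refl (dims 0) (\<lambda>a \<Xi>. \<integral>w. (phi s B \<eta> w (rotr a \<Xi> \<delta> x) - phi s B \<eta> w x)\<^sup>2 \<partial>PG)
     \<le> avg_refl (dims 0) (\<lambda>a \<Xi>. ?P \<delta> a \<Xi> + ?P (- \<delta>) a \<Xi>)"
  proof (rule avg_refl_mono)
    fix a \<Xi> assume a: "a < dims 0"
    note sk = sk_refl[OF a, of \<Xi>]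
    have sq: "u\<^sup>2 = (max 0 u)\<^sup>2 + (max 0 (- u))\<^sup>2" for u :: real by (simp add: max_def)
    have "(\<integral>w. (phi s B \<eta> w (rotr a \<Xi> \<delta> x) - phi s B \<eta> w x)\<^sup>2 \<partial>PG)
       = (\<integral>w. (max 0 (phi s B \<eta> w (rotr a \<Xi> \<delta> x) - phi s B \<eta> w x))\<^sup>2
          + (max 0 (phi s B \<eta> w x - phi s B \<eta> w (rotr a \<Xi> \<delta> x)))\<^sup>2 \<partial>PG)"
      by (subst sq) simp
    also have "\<dots> = ?P \<delta> a \<Xi> + (\<integral>w. (max 0 (phi s B \<eta> w x - phi s B \<eta> w (rotr a \<Xi> \<delta> x)))\<^sup>2 \<partial>PG)"
      by (intro Bochner_Integration.integral_add integrable_phi_diff[OF B])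
    also have "(\<integral>w. (max 0 (phi s B \<eta> w x - phi s B \<eta> w (rotr a \<Xi> \<delta> x)))\<^sup>2 \<partial>PG) = ?P (- \<delta>) a \<Xi>"
    proof -
      \<comment> \<open>A decrease under rotation by \<open>\<delta>\<close> is an increase under
        rotation by \<open>- \<delta>\<close> for the rotated weights, which have the same
        law.\<close>
      have "(max 0 (phi s B \<eta> w x - phi s B \<eta> w (rotr a \<Xi> \<delta> x)))\<^sup>2
        = (max 0 (phi s B \<eta> (wrotr a \<Xi> \<delta> w) (rotr a \<Xi> (- \<delta>) x) - phi s B \<eta> (wrotr a \<Xi> \<delta> w) x))\<^sup>2" for w
        by (simp add: phi_rot[OF sk, symmetric] rotx_rotx[OF sk] rotx_0)
      then show ?thesis
        using integral_wrot[OF sk del(2), of "\<lambda>w. (max 0 (phi s B \<eta> w (rotr a \<Xi> (- \<delta>) x) - phi s B \<eta> w x))\<^sup>2"] by simp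
    qed
    finally show "(\<integral>w. (phi s B \<eta> w (rotr a \<Xi> \<delta> x) - phi s B \<eta> w x)\<^sup>2 \<partial>PG) \<le> ?P \<delta> a \<Xi> + ?P (- \<delta>) a \<Xi>" by simp
  qed
  also have "\<dots> = avg_refl (dims 0) (?P \<delta>) + avg_refl (dims 0) (?P (- \<delta>))"
    by (rule avg_refl_add)
  also have "\<dots> \<le> ?c + ?c"
  proof (rule add_mono)
    show "avg_refl (dims 0) (?P \<delta>) \<le> ?c"
      by (rule integral_avg_refl_le[OF integrable_phi_diff(2)[OF B] phi_increment_avg[OF B eta del(1)]])
    have "- \<delta> \<noteq> 0" using del(1) by simp
    from phi_increment_avg[OF B eta this]
    show "avg_refl (dims 0) (?P (- \<delta>)) \<le> ?c"
      by (intro integral_avg_refl_le[OF integrable_phi_diff(2)[OF B]]) simp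
  qed
  finally show ?thesis by simp
qed

text \<open>The quarter turn is cut into \<open>N\<close> equal steps. The angle already covered is
  absorbed into the weights, so every step has the integral of the first one; the angles absorbed
  are strictly below \<open>pi / 2\<close>, where the law is known to be invariant. Cauchy-Schwarz
  on the telescoping sum gives \<open>N\<^sup>2\<close>.\<close>

lemma phi_path:
  fixes N :: nat
  assumes B: "0 \<le> B" and a: "a < dims 0" and N: "2 \<le> N"
  shows "(\<integral>w. (phi s B \<eta> w (rotr a \<Xi> (pi / 2) x) - phi s B \<eta> w x)\<^sup>2 \<partial>PG)
    \<le> (real N)\<^sup>2 * (\<integral>w. (phi s B \<eta> w (rotr a \<Xi> (pi / (2 * real N)) x) - phi s B \<eta> w x)\<^sup>2 \<partial>PG)"
proof -
  note [measurable] = measurable_phi[OF B]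
  note sk = sk_refl[OF a, of \<Xi>]
  define \<delta> where "\<delta> = pi / (2 * real N)"
  define g where "g i w = phi s B \<eta> w (rotr a \<Xi> (real i * \<delta>) x)" for i w
  let ?I = "\<integral>w. (phi s B \<eta> w (rotr a \<Xi> \<delta> x) - phi s B \<eta> w x)\<^sup>2 \<partial>PG"
  have Nd: "real N * \<delta> = pi / 2" using N by (simp add: \<delta>_def)
  have step: "(\<integral>w. (g (Suc i) w - g i w)\<^sup>2 \<partial>PG) = ?I" if i: "i < N" for i
  proof -
    have "0 \<le> real i * \<delta>" by (simp add: \<delta>_def)
    moreover have "real i * \<delta> < real N * \<delta>"
    proof (rule mult_strict_right_mono)
      show "0 < \<delta>" using N by (simp add: \<delta>_def)
    qed (use i in simp)
    ultimately have "0 < cos (real i * \<delta>)" unfolding Nd by (intro cos_gt_zero_pi) auto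
    then have c: "cos (real i * \<delta>) \<noteq> 0" by simp
    have "(g (Suc i) w - g i w)\<^sup>2 = (phi s B \<eta> (wrotr a \<Xi> (real i * \<delta>) w) (rotr a \<Xi> \<delta> x) - phi s B \<eta> (wrotr a \<Xi> (real i * \<delta>) w) x)\<^sup>2" for w
      by (simp add: g_def phi_rot[OF sk, symmetric] rotx_rotx[OF sk] distrib_right add.commute)
    then show ?thesis
      using integral_wrot[OF sk c, of "\<lambda>w. (phi s B \<eta> w (rotr a \<Xi> \<delta> x) - phi s B \<eta> w x)\<^sup>2"] by simp
  qed
  have gi: "integrable PG (\<lambda>w. (g (Suc i) w - g i w)\<^sup>2)" for i
    unfolding g_def by (rule integrable_phi_diff[OF B])
  have tele: "(g N w - g 0 w)\<^sup>2 \<le> N * (\<Sum>i<N. (g (Suc i) w - g i w)\<^sup>2)" for w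
  proof -
    have "g N w - g 0 w = (\<Sum>i<N. g (Suc i) w - g i w)" by (rule sum_lessThan_telescope[symmetric])
    then show ?thesis
      using sum_squared_le_sum_of_squares[of "\<lambda>i. g (Suc i) w - g i w" "{..<N}"] by (simp add: mult.commute)
  qed
  have "(\<integral>w. (g N w - g 0 w)\<^sup>2 \<partial>PG) \<le> (\<integral>w. N * (\<Sum>i<N. (g (Suc i) w - g i w)\<^sup>2) \<partial>PG)"
  proof (rule integral_mono)
    show "integrable PG (\<lambda>w. (g N w - g 0 w)\<^sup>2)"
      unfolding g_def by (rule integrable_phi_diff[OF B])
    show "integrable PG (\<lambda>w. real N * (\<Sum>i<N. (g (Suc i) w - g i w)\<^sup>2))"
      by (intro Bochner_Integration.integrable_mult_right Bochner_Integration.integrable_sum gi)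
  qed (rule tele)
  also have "\<dots> = N * (\<Sum>i<N. ?I)"
    using gi step by simp
  also have "\<dots> = (real N)\<^sup>2 * ?I" by (simp add: power2_eq_square)
  finally show ?thesis unfolding g_def Nd by (simp add: rotx_0 \<delta>_def)
qed

text \<open>With \<open>N * \<delta> = pi / 2\<close> the first-order part stays bounded, while the
  second-order part, collected in \<open>K\<close>, decays like \<open>1 / N\<^sup>2\<close>.
  Letting \<open>N\<close> tend to infinity removes all dependence on \<open>\<eta>\<close> and
  \<open>B\<close>; what remains is \<open>2 * pi\<^sup>2\<close>, at most 32.\<close>

lemma phi_poincare:
  assumes B: "0 \<le> B" and eta: "0 < \<eta>"
  shows "avg_refl (dims 0) (\<lambda>a \<Xi>. \<integral>w. (phi s B \<eta> w (rotr a \<Xi> (pi / 2) x) - phi s B \<eta> w x)\<^sup>2 \<partial>PG)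
    \<le> 32 * (spnorm (ns 0) (dims 0) x)\<^sup>2 / dims 0" (is "?L \<le> _")
proof -
  define A where "A = (spnorm (ns 0) (dims 0) x)\<^sup>2 / dims 0"
  define K where "K = 4 * (pi / 2) ^ 4 * (incr_const \<eta> x)\<^sup>2"
  have A: "0 \<le> A" by (simp add: A_def)
  have bound: "?L \<le> 2 * pi\<^sup>2 * A + K / (real N)\<^sup>2" if N: "2 \<le> N" for N :: nat
  proof -
    define \<delta> where "\<delta> = pi / (2 * real N)"
    have dpos: "0 < \<delta>" using N by (simp add: \<delta>_def)
    have "\<delta> < pi / 2"
    proof -
      have "pi / (2 * real N) < pi / 2" using N by (intro divide_strict_left_mono) auto
      then show ?thesis by (simp add: \<delta>_def)
    qed
    then have c: "cos \<delta> \<noteq> 0" using dpos cos_gt_zero_pi[of \<delta>] by simp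
    have d0: "\<delta> \<noteq> 0" using dpos by simp
    have Nd: "real N * \<delta> = pi / 2" using N by (simp add: \<delta>_def)
    have "?L \<le> avg_refl (dims 0) (\<lambda>a \<Xi>. (real N)\<^sup>2 * (\<integral>w. (phi s B \<eta> w (rotr a \<Xi> \<delta> x) - phi s B \<eta> w x)\<^sup>2 \<partial>PG))"
      unfolding \<delta>_def by (rule avg_refl_mono) (rule phi_path[OF B _ N])
    also have "\<dots> = (real N)\<^sup>2 * avg_refl (dims 0) (\<lambda>a \<Xi>. \<integral>w. (phi s B \<eta> w (rotr a \<Xi> \<delta> x) - phi s B \<eta> w x)\<^sup>2 \<partial>PG)"
      by (rule avg_refl_cmult)
    also have "\<dots> \<le> (real N)\<^sup>2 * (2 * (4 * \<delta>\<^sup>2 * (spnorm (ns 0) (dims 0) x)\<^sup>2 / dims 0 + 2 * (\<delta>\<^sup>2 * incr_const \<eta> x)\<^sup>2))"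
      by (intro mult_left_mono phi_step[OF B eta d0 c]) simp
    also have "\<dots> = 8 * (real N * \<delta>)\<^sup>2 * A + 4 * (real N * \<delta>) ^ 4 * (incr_const \<eta> x)\<^sup>2 / (real N)\<^sup>2"
      using N by (simp add: A_def power_mult_distrib field_simps eval_nat_numeral)
    also have "\<dots> = 2 * pi\<^sup>2 * A + K / (real N)\<^sup>2"
      unfolding Nd by (simp add: K_def power_divide)
    finally show ?thesis .
  qed
  have "(\<lambda>N. 2 * pi\<^sup>2 * A + K / (real N)\<^sup>2) \<longlonglongrightarrow> 2 * pi\<^sup>2 * A + 0"
  proof (intro tendsto_add tendsto_const)
    have "(\<lambda>N. K * (1 / real N * (1 / real N))) \<longlonglongrightarrow> K * (0 * 0)"
      by (intro tendsto_mult tendsto_const lim_1_over_n)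
    then show "(\<lambda>N. K / (real N)\<^sup>2) \<longlonglongrightarrow> 0" by (simp add: power2_eq_square)
  qed
  then have "?L \<le> 2 * pi\<^sup>2 * A + 0"
    by (rule LIMSEQ_le_const) (use bound in blast)
  also have "\<dots> \<le> 32 * A"
  proof -
    have "pi\<^sup>2 \<le> 4\<^sup>2" using pi_less_4 by (intro power_mono) auto
    then have "2 * pi\<^sup>2 * A \<le> 32 * A" using A by (intro mult_right_mono) auto
    then show ?thesis by simp
  qed
  finally show ?thesis by (simp add: A_def)
qed

end

section \<open>The sign change\<close>

context xavier_net
begin

lemma on_sphere_rotx:
  assumes sk: "sk \<sigma> t" and x: "on_sphere \<rho> x"
  shows "on_sphere \<rho> (rotx \<sigma> t \<theta> x)"
  unfolding on_sphere_def
proof (intro allI impI)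
  fix j assume "j < ns 0"
  then show "(\<Sum>k<dims 0. (rotx \<sigma> t \<theta> x j k)\<^sup>2) / dims 0 = \<rho>"
    using x vrot_isometry[OF sk, of \<theta> "x j" "x j"] by (simp add: on_sphere_def rotx_def power2_eq_square)
qed

lemma gram_0: "gram 0 x y w = (\<Sum>j<ns 0. token_weight 0 j * ((\<Sum>k<dims 0. x j k * y j k) / dims 0))"
  by (simp add: gram_def H_0)

lemma gram_0_commute: "gram 0 x y w = gram 0 y x w"
  by (simp add: gram_0 mult.commute)

lemma gram_0_diag:
  assumes "on_sphere \<rho> x" shows "gram 0 x x w = \<rho>"
proof -
  have "gram 0 x x w = (\<Sum>j<ns 0. token_weight 0 j * \<rho>)"
    unfolding gram_0 using assms by (intro sum.cong refl) (simp add: on_sphere_def power2_eq_square)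
  then show ?thesis using token_weight_sum[of 0] by (simp add: sum_distrib_right[symmetric])
qed

lemma token_norm:
  assumes "on_sphere \<rho> x" "j < ns 0" shows "(\<Sum>k<dims 0. (x j k)\<^sup>2) = real (dims 0) * \<rho>"
proof -
  have "(\<Sum>k<dims 0. (x j k)\<^sup>2) / dims 0 = \<rho>" using assms by (simp add: on_sphere_def)
  then show ?thesis using d_pos by (simp add: field_simps)
qed

text \<open>At the quarter turn moved coordinates undergo \<open>A\<close> itself and contribute
  \<open>Z\<close>, small by isotropy. Fixed coordinates contribute \<open>F\<close>, and each
  coordinate is fixed by exactly one of the \<open>d\<close> pairings. The point \<open>y\<close> is
  arbitrary on the sphere, so earlier choices are allowed.\<close>

lemma gram_0_avg:
  assumes x: "on_sphere \<rho> x" and y: "on_sphere \<rho> y" and rho: "0 \<le> \<rho>"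
  shows "avg_refl (dims 0) (\<lambda>a \<Xi>. (gram 0 (rotr a \<Xi> (pi / 2) x) y w)\<^sup>2) \<le> 6 * \<rho>\<^sup>2 / dims 0"
proof -
  let ?d = "dims 0"
  define R where "R = real ?d * \<rho>"
  have R: "0 \<le> R" using rho by (simp add: R_def)
  define C where "C a b = (\<Sum>j<ns 0. token_weight 0 j * (y j a * x j b))" for a b
  define Ch where "Ch k = (\<Sum>j<ns 0. token_weight 0 j * \<bar>y j k * x j k\<bar>)" for k
  define Z where "Z a \<Xi> = (\<Sum>k | k < ?d \<and> refl_pair ?d a k \<noteq> k. refl_sign ?d a \<Xi> k * C k (refl_pair ?d a k))" for a \<Xi>
  define F where "F a = (\<Sum>k | k < ?d \<and> refl_pair ?d a k = k. C k k)" for a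
  define G where "G a = (\<Sum>k | k < ?d \<and> refl_pair ?d a k = k. Ch k)" for a
  have Ch0: "0 \<le> Ch k" for k unfolding Ch_def by (intro sum_nonneg) (simp add: token_weight_nonneg)
  have CCh: "\<bar>C k k\<bar> \<le> Ch k" for k
    unfolding C_def Ch_def by (rule order_trans[OF sum_abs]) (simp add: abs_mult token_weight_nonneg)
  have Chs: "(\<Sum>k<?d. Ch k) \<le> R"
  proof -
    have "(\<Sum>k<?d. Ch k) = (\<Sum>j<ns 0. token_weight 0 j * (\<Sum>k<?d. \<bar>y j k * x j k\<bar>))"
      unfolding Ch_def sum_distrib_left by (rule sum.swap)
    also have "\<dots> \<le> (\<Sum>j<ns 0. token_weight 0 j * R)"
    proof (intro sum_mono mult_left_mono token_weight_nonneg)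
      fix j assume j: "j \<in> {..<ns 0}"
      have "(\<Sum>k<?d. \<bar>y j k * x j k\<bar>) \<le> (\<Sum>k<?d. (y j k)\<^sup>2 / 2 + (x j k)\<^sup>2 / 2)"
      proof (rule sum_mono)
        fix k show "\<bar>y j k * x j k\<bar> \<le> (y j k)\<^sup>2 / 2 + (x j k)\<^sup>2 / 2"
          using sum_squares_bound[of "\<bar>y j k\<bar>" "\<bar>x j k\<bar>"] by (simp add: abs_mult)
      qed
      also have "\<dots> = (\<Sum>k<?d. (y j k)\<^sup>2) / 2 + (\<Sum>k<?d. (x j k)\<^sup>2) / 2"
        by (simp add: sum.distrib sum_divide_distrib)
      also have "\<dots> = R" using token_norm[OF x, of j] token_norm[OF y, of j] j by (simp add: R_def)
      finally show "(\<Sum>k<?d. \<bar>y j k * x j k\<bar>) \<le> R" .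
    qed
    also have "\<dots> = R" using token_weight_sum[of 0] by (simp add: sum_distrib_right[symmetric])
    finally show ?thesis .
  qed
  have Cs: "(\<Sum>a<?d. \<Sum>b<?d. (C a b)\<^sup>2) \<le> R\<^sup>2"
  proof -
    have "(\<Sum>a<?d. \<Sum>b<?d. (C a b)\<^sup>2) \<le> (\<Sum>a<?d. \<Sum>b<?d. \<Sum>j<ns 0. token_weight 0 j * (y j a * x j b)\<^sup>2)"
      unfolding C_def using token_weight_nonneg token_weight_sum[of 0] by (intro sum_mono weighted_square_le) auto
    also have "\<dots> = (\<Sum>a<?d. \<Sum>j<ns 0. \<Sum>b<?d. token_weight 0 j * (y j a * x j b)\<^sup>2)"
      by (rule sum.cong[OF refl], rule sum.swap)
    also have "\<dots> = (\<Sum>j<ns 0. \<Sum>a<?d. \<Sum>b<?d. token_weight 0 j * (y j a * x j b)\<^sup>2)"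
      by (rule sum.swap)
    also have "\<dots> = (\<Sum>j<ns 0. token_weight 0 j * ((\<Sum>a<?d. (y j a)\<^sup>2) * (\<Sum>b<?d. (x j b)\<^sup>2)))"
    proof (rule sum.cong[OF refl])
      fix j
      have "(\<Sum>a<?d. (y j a)\<^sup>2) * (\<Sum>b<?d. (x j b)\<^sup>2) = (\<Sum>a<?d. \<Sum>b<?d. (y j a * x j b)\<^sup>2)"
        by (simp add: sum_product power_mult_distrib)
      then show "(\<Sum>a<?d. \<Sum>b<?d. token_weight 0 j * (y j a * x j b)\<^sup>2) = token_weight 0 j * ((\<Sum>a<?d. (y j a)\<^sup>2) * (\<Sum>b<?d. (x j b)\<^sup>2))"
        by (simp only: sum_distrib_left)
    qed
    also have "\<dots> = (\<Sum>j<ns 0. token_weight 0 j * R\<^sup>2)"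
      using token_norm[OF x] token_norm[OF y] by (intro sum.cong refl) (simp add: R_def power2_eq_square)
    also have "\<dots> = R\<^sup>2" using token_weight_sum[of 0] by (simp add: sum_distrib_right[symmetric])
    finally show ?thesis .
  qed
  have Zavg: "avg_refl ?d (\<lambda>a \<Xi>. (Z a \<Xi>)\<^sup>2) \<le> 2 / ?d * R\<^sup>2"
  proof -
    have "avg_refl ?d (\<lambda>a \<Xi>. (Z a \<Xi>)\<^sup>2) \<le> 2 / ?d * (\<Sum>a<?d. \<Sum>b<?d. (C a b)\<^sup>2)"
      unfolding Z_def by (rule skew_isotropic[OF d_pos])
    also have "\<dots> \<le> 2 / ?d * R\<^sup>2" using Cs by (intro mult_left_mono) auto
    finally show ?thesis .
  qed
  have Gle: "G a \<le> R" for a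
  proof -
    have "G a \<le> (\<Sum>k<?d. Ch k)" unfolding G_def using Ch0 by (intro sum_mono2) auto
    then show ?thesis using Chs by simp
  qed
  have G0: "0 \<le> G a" for a unfolding G_def using Ch0 by (intro sum_nonneg) auto
  \<comment> \<open>One factor is bounded by the worst case \<open>R\<close>, so that only the first
    power of \<open>G\<close> has to be averaged over the pairings.\<close>
  have FG: "(F a)\<^sup>2 \<le> R * G a" for a
  proof -
    have "\<bar>F a\<bar> \<le> G a" unfolding F_def G_def
      by (rule order_trans[OF sum_abs]) (intro sum_mono CCh)
    then have "\<bar>F a\<bar> * \<bar>F a\<bar> \<le> R * G a" using Gle[of a] R by (intro mult_mono) auto
    then show ?thesis by (simp add: power2_eq_square)
  qed
  have Favg: "avg_refl ?d (\<lambda>a \<Xi>. (F a)\<^sup>2) \<le> 1 / ?d * R\<^sup>2"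
  proof -
    have "(\<Sum>a<?d. G a) = (\<Sum>a<?d. \<Sum>k<?d. if refl_pair ?d a k = k then Ch k else 0)"
      unfolding G_def by (rule sum.cong[OF refl]) (use sum.inter_filter[of "{..<?d}" Ch] in simp)
    also have "\<dots> = (\<Sum>k<?d. \<Sum>a<?d. if refl_pair ?d a k = k then Ch k else 0)"
      by (rule sum.swap)
    also have "\<dots> = (\<Sum>k<?d. \<Sum>b<?d. if b = k then Ch k else 0)"
      by (rule sum.cong[OF refl]) (rule sum_refl_pair[where F="\<lambda>b. if b = _ then Ch _ else 0"], simp)
    also have "\<dots> = (\<Sum>k<?d. Ch k)" by simp
    finally have Gs: "(\<Sum>a<?d. G a) \<le> R" using Chs by simp
    have "avg_refl ?d (\<lambda>a \<Xi>. (F a)\<^sup>2) \<le> avg_refl ?d (\<lambda>a \<Xi>. R * G a)"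
      by (rule avg_refl_mono) (rule FG)
    also have "\<dots> = R * (\<Sum>a<?d. G a) / ?d"
      by (simp add: avg_refl_def card_Pow sum_distrib_left[symmetric])
    also have "\<dots> \<le> R * R / ?d"
      using Gs R by (intro divide_right_mono mult_left_mono) auto
    finally show ?thesis by (simp add: power2_eq_square)
  qed
  have g: "gram 0 (rotr a \<Xi> (pi / 2) x) y w = (Z a \<Xi> + F a) / ?d" for a \<Xi>
  proof -
    let ?\<sigma> = "refl_pair ?d a" and ?t = "refl_sign ?d a \<Xi>"
    have "gram 0 (rotr a \<Xi> (pi / 2) x) y w = (\<Sum>j<ns 0. \<Sum>k<?d. token_weight 0 j * (y j k * rotr a \<Xi> (pi / 2) x j k)) / ?d"
      unfolding gram_0 by (simp add: sum_distrib_left sum_divide_distrib mult_ac)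
    also have "(\<Sum>j<ns 0. \<Sum>k<?d. token_weight 0 j * (y j k * rotr a \<Xi> (pi / 2) x j k))
       = (\<Sum>k<?d. \<Sum>j<ns 0. token_weight 0 j * (y j k * rotr a \<Xi> (pi / 2) x j k))"
      by (rule sum.swap)
    also have "\<dots> = (\<Sum>k | k < ?d \<and> ?\<sigma> k \<noteq> k. \<Sum>j<ns 0. token_weight 0 j * (y j k * rotr a \<Xi> (pi / 2) x j k))
       + (\<Sum>k | k < ?d \<and> ?\<sigma> k = k. \<Sum>j<ns 0. token_weight 0 j * (y j k * rotr a \<Xi> (pi / 2) x j k))"
      by (rule sum_split_moved)
    also have "(\<Sum>k | k < ?d \<and> ?\<sigma> k \<noteq> k. \<Sum>j<ns 0. token_weight 0 j * (y j k * rotr a \<Xi> (pi / 2) x j k)) = Z a \<Xi>"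
      unfolding Z_def C_def by (intro sum.cong refl) (simp add: rotx_def vrot_def sum_distrib_left mult_ac)
    also have "(\<Sum>k | k < ?d \<and> ?\<sigma> k = k. \<Sum>j<ns 0. token_weight 0 j * (y j k * rotr a \<Xi> (pi / 2) x j k)) = F a"
      unfolding F_def C_def by (intro sum.cong refl) (simp add: rotx_def vrot_def)
    finally show ?thesis .
  qed
  have "avg_refl ?d (\<lambda>a \<Xi>. (gram 0 (rotr a \<Xi> (pi / 2) x) y w)\<^sup>2)
    \<le> avg_refl ?d (\<lambda>a \<Xi>. 2 / (real ?d)\<^sup>2 * (Z a \<Xi>)\<^sup>2 + 2 / (real ?d)\<^sup>2 * (F a)\<^sup>2)"
  proof (rule avg_refl_mono)
    fix a \<Xi>
    have "(Z a \<Xi> + F a)\<^sup>2 \<le> 2 * (Z a \<Xi>)\<^sup>2 + 2 * (F a)\<^sup>2"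
      using zero_le_power2[of "Z a \<Xi> - F a"] by (simp add: power2_eq_square algebra_simps)
    then have "(Z a \<Xi> + F a)\<^sup>2 / (real ?d)\<^sup>2 \<le> (2 * (Z a \<Xi>)\<^sup>2 + 2 * (F a)\<^sup>2) / (real ?d)\<^sup>2"
      by (rule divide_right_mono) simp
    then show "(gram 0 (rotr a \<Xi> (pi / 2) x) y w)\<^sup>2 \<le> 2 / (real ?d)\<^sup>2 * (Z a \<Xi>)\<^sup>2 + 2 / (real ?d)\<^sup>2 * (F a)\<^sup>2"
      unfolding g power_divide by (simp add: add_divide_distrib)
  qed
  also have "\<dots> = 2 / (real ?d)\<^sup>2 * avg_refl ?d (\<lambda>a \<Xi>. (Z a \<Xi>)\<^sup>2) + 2 / (real ?d)\<^sup>2 * avg_refl ?d (\<lambda>a \<Xi>. (F a)\<^sup>2)"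
    by (simp only: avg_refl_add avg_refl_cmult)
  also have "\<dots> \<le> 2 / (real ?d)\<^sup>2 * (2 / ?d * R\<^sup>2) + 2 / (real ?d)\<^sup>2 * (1 / ?d * R\<^sup>2)"
    using Zavg Favg by (intro add_mono mult_left_mono) auto
  also have "\<dots> = 6 * \<rho>\<^sup>2 / ?d"
    using d_pos by (simp add: R_def power_mult_distrib field_simps)
  finally show ?thesis .
qed

definition phi_var :: "real \<Rightarrow> real \<Rightarrow> real \<Rightarrow> (nat \<Rightarrow> nat \<Rightarrow> real) \<Rightarrow> (nat \<Rightarrow> nat \<Rightarrow> real) \<Rightarrow> real" where
  "phi_var s B \<eta> y x = (\<integral>w. (phi s B \<eta> w y - phi s B \<eta> w x)\<^sup>2 \<partial>PG)"

text \<open>Greedy choice by averaging. The costs of a new rotation, each divided by its average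
  bound, are nonnegative and add up to at most \<open>m + 2\<close> on average, so some rotation
  keeps every single one below \<open>m + 2\<close> times its bound. Weights do not enter
  \<open>gram 0\<close>; the constant 0 is a placeholder.\<close>

lemma select_points:
  fixes m m' :: nat
  assumes x: "on_sphere \<rho> x" and rho: "0 < \<rho>" and B: "0 \<le> B" and eta: "0 < \<eta>"
    and sp: "0 < spnorm (ns 0) (dims 0) x"
  defines "b \<equiv> 32 * (spnorm (ns 0) (dims 0) x)\<^sup>2 / dims 0" and "g \<equiv> 6 * \<rho>\<^sup>2 / dims 0"
  shows "m' \<le> m \<Longrightarrow> \<exists>X. \<forall>k<m'. on_sphere \<rho> (X k)
    \<and> phi_var 1 B \<eta> (X k) x \<le> (real m + 2) * b \<and> phi_var (- 1) B \<eta> (X k) x \<le> (real m + 2) * b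
    \<and> (\<forall>k'<k. (gram 0 (X k) (X k') (\<lambda>_. 0))\<^sup>2 \<le> (real m + 2) * g)"
proof (induction m')
  case 0
  then show ?case by simp
next
  case (Suc n)
  then obtain X where X: "\<forall>k<n. on_sphere \<rho> (X k)
    \<and> phi_var 1 B \<eta> (X k) x \<le> (real m + 2) * b \<and> phi_var (- 1) B \<eta> (X k) x \<le> (real m + 2) * b
    \<and> (\<forall>k'<k. (gram 0 (X k) (X k') (\<lambda>_. 0))\<^sup>2 \<le> (real m + 2) * g)" by auto
  have bg: "0 < b" "0 < g" using sp rho d_pos by (simp_all add: b_def g_def)
  let ?P = "\<lambda>s a \<Xi>. phi_var s B \<eta> (rotr a \<Xi> (pi / 2) x) x"
  let ?G = "\<lambda>k a \<Xi>. (gram 0 (rotr a \<Xi> (pi / 2) x) (X k) (\<lambda>_. 0))\<^sup>2"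
  define F where "F a \<Xi> = 1 / b * ?P 1 a \<Xi> + (1 / b * ?P (- 1) a \<Xi> + (\<Sum>k<n. 1 / g * ?G k a \<Xi>))" for a \<Xi>
  have P: "avg_refl (dims 0) (?P s) \<le> b" for s
    unfolding phi_var_def b_def by (rule phi_poincare[OF B eta])
  have G: "avg_refl (dims 0) (?G k) \<le> g" if "k < n" for k
    unfolding g_def using X that rho by (intro gram_0_avg[OF x]) auto
  have "avg_refl (dims 0) F = 1 / b * avg_refl (dims 0) (?P 1) + (1 / b * avg_refl (dims 0) (?P (- 1)) + (\<Sum>k<n. 1 / g * avg_refl (dims 0) (?G k)))"
    unfolding F_def by (simp only: avg_refl_add avg_refl_cmult avg_refl_sum)
  also have "\<dots> \<le> 1 / b * b + (1 / b * b + (\<Sum>k<n. 1 / g * g))"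
    using P G bg by (intro add_mono sum_mono mult_left_mono) auto
  also have "\<dots> = real n + 2" using bg by simp
  also have "\<dots> \<le> real m + 2" using Suc.prems by simp
  finally have avg: "avg_refl (dims 0) F \<le> real m + 2" .
  obtain a \<Xi> where a: "a < dims 0" "F a \<Xi> \<le> avg_refl (dims 0) F"
    using avg_refl_exists[OF d_pos] by blast
  have FF: "F a \<Xi> \<le> real m + 2" using a(2) avg by simp
  have P0: "0 \<le> 1 / b * ?P s a \<Xi>" for s using bg by (simp add: phi_var_def)
  have G0: "0 \<le> 1 / g * ?G k a \<Xi>" for k using bg by simp
  have Gs: "0 \<le> (\<Sum>k<n. 1 / g * ?G k a \<Xi>)" by (rule sum_nonneg) (rule G0)
  have p1: "1 / b * ?P 1 a \<Xi> \<le> real m + 2"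
    using FF P0[of "- 1"] Gs unfolding F_def by linarith
  have p2: "1 / b * ?P (- 1) a \<Xi> \<le> real m + 2"
    using FF P0[of 1] Gs unfolding F_def by linarith
  have p3: "1 / g * ?G k a \<Xi> \<le> real m + 2" if "k < n" for k
  proof -
    have "1 / g * ?G k a \<Xi> \<le> (\<Sum>k<n. 1 / g * ?G k a \<Xi>)"
      by (rule member_le_sum[where f="\<lambda>k. 1 / g * ?G k a \<Xi>"]) (use that G0 in auto)
    then show ?thesis using FF P0[of 1] P0[of "- 1"] unfolding F_def by linarith
  qed
  define X' where "X' = X(n := rotr a \<Xi> (pi / 2) x)"
  have new: "on_sphere \<rho> (rotr a \<Xi> (pi / 2) x)"
    by (rule on_sphere_rotx[OF sk_refl[OF a(1)] x])
  have "on_sphere \<rho> (X' k) \<and> phi_var 1 B \<eta> (X' k) x \<le> (real m + 2) * b \<and> phi_var (- 1) B \<eta> (X' k) x \<le> (real m + 2) * b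
    \<and> (\<forall>k'<k. (gram 0 (X' k) (X' k') (\<lambda>_. 0))\<^sup>2 \<le> (real m + 2) * g)" if k: "k < Suc n" for k
  proof (cases "k = n")
    case True
    show ?thesis
      using True new p1 p2 p3 bg by (simp add: X'_def field_simps)
  next
    case False
    then have "k < n" using k by simp
    then show ?thesis using X by (auto simp: X'_def)
  qed
  then show ?case by blast
qed

lemma spnorm_pos:
  assumes x: "on_sphere \<rho> x" and rho: "0 < \<rho>"
  shows "0 < spnorm (ns 0) (dims 0) x"
proof -
  let ?u = "\<lambda>j::nat. if j = 0 then 1 else 0 :: real"
  have n: "0 < ns 0" by (rule ns_pos) simp
  have "(\<Sum>j<ns 0. (?u j)\<^sup>2) = (\<Sum>j<ns 0. if j = 0 then 1 else 0)"
    by (intro sum.cong refl) simp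
  also have "\<dots> = 1" using n by simp
  finally have u: "(\<Sum>j<ns 0. (?u j)\<^sup>2) = 1" .
  have "(\<Sum>j<ns 0. ?u j * x j k) = x 0 k" for k
  proof -
    have "(\<Sum>j<ns 0. ?u j * x j k) = (\<Sum>j<ns 0. if j = 0 then x 0 k else 0)"
      by (intro sum.cong refl) simp
    then show ?thesis using n by simp
  qed
  then have "sqrt (\<Sum>k<dims 0. (x 0 k)\<^sup>2) \<le> spnorm (ns 0) (dims 0) x"
    using spnorm_ge[OF u, where d="dims 0" and x=x] by simp
  moreover have "0 < sqrt (\<Sum>k<dims 0. (x 0 k)\<^sup>2)"
    using token_norm[OF x n] rho d_pos by simp
  ultimately show ?thesis by linarith
qed

text \<open>Outside the exceptional sets some \<open>X k\<close> has an output of sign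
  \<open>- s\<close>, so its smoothed distance is at most \<open>\<eta>\<close>; the distance at
  \<open>x\<close> differs from it by less than \<open>r0 / 2\<close>. Both values of
  \<open>s\<close> are handled on one event, as the sign at \<open>x\<close> is random.\<close>

lemma sign_change_prob:
  fixes m N :: nat and r0 T \<epsilon> \<rho> :: real
  assumes x: "on_sphere \<rho> x" and rho: "0 < \<rho>" and r0: "0 < r0" and m: "0 < m" and T: "0 < T"
    and N: "0 < N" "\<And>v. 1 \<le> v \<Longrightarrow> v < l \<Longrightarrow> N \<le> dims v"
    and e: "0 < \<epsilon>" "2 * real m * \<epsilon> \<le> 1 / 4 ^ l" "6 * (real m + 2) \<le> \<epsilon>\<^sup>2 * dims 0"
  defines "sp \<equiv> spnorm (ns 0) (dims 0) x"
  shows "\<exists>A\<in>sets PG. (\<forall>w\<in>A. \<forall>s\<in>{1, - 1}. \<exists>y. s * out y w < 0 \<and> sqrt (dist2 x y) < r0) \<and>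
    1 - (2 * (2 / T\<^sup>2 + exp (T\<^sup>2 * 4 ^ l / 2) / sqrt m + l * m\<^sup>2 * (4 * 3 ^ l / (N * \<epsilon>\<^sup>2)))
      + 256 * m * (real m + 2) * sp\<^sup>2 / (dims 0 * r0\<^sup>2)) \<le> measure PG A"
proof -
  \<comment> \<open>\<open>\<eta> + r0 / 2 < r0\<close> closes the argument, and a cap above
    \<open>r0\<close> ensures that a value below \<open>r0\<close> is attained by a genuine point
    rather than by the cap.\<close>
  define B \<eta> where "B = 2 * r0" and "\<eta> = r0 / 4"
  have B: "0 \<le> B" and eta: "0 < \<eta>" using r0 by (simp_all add: B_def \<eta>_def)
  have sp: "0 < sp" unfolding sp_def by (rule spnorm_pos[OF x rho])
  define b where "b = 32 * sp\<^sup>2 / dims 0"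
  obtain X where X: "\<And>k. k < m \<Longrightarrow> on_sphere \<rho> (X k)"
    and V: "\<And>k. k < m \<Longrightarrow> phi_var 1 B \<eta> (X k) x \<le> (real m + 2) * b" "\<And>k. k < m \<Longrightarrow> phi_var (- 1) B \<eta> (X k) x \<le> (real m + 2) * b"
    and G: "\<And>k k'. k < m \<Longrightarrow> k' < k \<Longrightarrow> (gram 0 (X k) (X k') (\<lambda>_. 0))\<^sup>2 \<le> (real m + 2) * (6 * \<rho>\<^sup>2 / dims 0)"
    using select_points[OF x rho B eta spnorm_pos[OF x rho], of m m] unfolding b_def sp_def by blast
  \<comment> \<open>The third condition on \<open>\<epsilon>\<close> is exactly what brings the Gram
    bound of the greedy choice below \<open>(\<epsilon> * \<rho>)\<^sup>2\<close>.\<close>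
  have g: "\<bar>gram 0 (X k) (X k') w\<bar> \<le> \<epsilon> * \<rho>" if "k < m" "k' < k" for k k' w
  proof -
    have "(gram 0 (X k) (X k') w)\<^sup>2 \<le> (real m + 2) * (6 * \<rho>\<^sup>2 / dims 0)"
      using G[OF that] by (simp add: gram_0)
    also have "\<dots> = (6 * (real m + 2)) * (\<rho>\<^sup>2 / dims 0)" by simp
    also have "\<dots> \<le> (\<epsilon>\<^sup>2 * dims 0) * (\<rho>\<^sup>2 / dims 0)"
      using e(3) by (intro mult_right_mono) auto
    also have "\<dots> = (\<epsilon> * \<rho>)\<^sup>2" using d_pos by (simp add: power_mult_distrib)
    finally show ?thesis using e(1) rho by (simp add: abs_le_square_iff[symmetric])
  qed
  have base: "\<bar>gram 0 (X k) (X k') w - (if k = k' then \<rho> else 0)\<bar> \<le> \<epsilon> * \<rho>" if k: "k < m" "k' < m" for k k' w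
  proof (cases k k' rule: linorder_cases)
    case less
    then show ?thesis using g[OF k(2) less, of w] by (simp add: gram_0_commute[of "X k"])
  next
    case equal
    then show ?thesis using gram_0_diag[OF X[OF k(1)]] e(1) rho by simp
  next
    case greater
    then show ?thesis using g[OF k(1) greater, of w] by simp
  qed
  define ES where "ES s = {w \<in> space PG. \<forall>k<m. 0 \<le> s * out (X k) w}" for s
  define DS where "DS s k = {w \<in> space PG. (r0 / 2)\<^sup>2 \<le> (phi s B \<eta> w (X k) - phi s B \<eta> w x)\<^sup>2}" for s k
  note [measurable] = measurable_phi[OF B]
  have ESm [measurable]: "ES s \<in> sets PG" for s unfolding ES_def by measurable
  have DSm [measurable]: "DS s k \<in> sets PG" for s k unfolding DS_def by measurable
  define q where "q = 2 / T\<^sup>2 + exp (T\<^sup>2 * 4 ^ l / 2) / sqrt m + l * m\<^sup>2 * (4 * 3 ^ l / (N * \<epsilon>\<^sup>2))"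
  have PE: "measure PG (ES s) \<le> q" if "s = 1 \<or> s = - 1" for s
    unfolding ES_def out_def q_def by (rule prob_same_sign[OF X N base e(1,2) rho m T that])
  have PD: "measure PG (DS s k) \<le> 128 * (real m + 2) * sp\<^sup>2 / (dims 0 * r0\<^sup>2)" if s: "s = 1 \<or> s = - 1" and k: "k < m" for s k
  proof -
    have "measure PG (DS s k) \<le> (\<integral>w. (phi s B \<eta> w (X k) - phi s B \<eta> w x)\<^sup>2 \<partial>PG) / (r0 / 2)\<^sup>2"
      unfolding DS_def using r0
      by (intro integral_Markov_inequality_measure[where A="{}"] integrable_phi_diff[OF B]) auto
    also have "\<dots> \<le> (real m + 2) * b / (r0 / 2)\<^sup>2"
      using V[OF k] s unfolding phi_var_def by (intro divide_right_mono) auto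
    also have "\<dots> = 128 * (real m + 2) * sp\<^sup>2 / (dims 0 * r0\<^sup>2)"
      by (simp add: b_def power_divide)
    finally show ?thesis .
  qed
  define bd where "bd s = ES s \<union> (\<Union>k<m. DS s k)" for s
  have bdm [measurable]: "bd s \<in> sets PG" for s unfolding bd_def by measurable
  have Pb: "measure PG (bd s) \<le> q + m * (128 * (real m + 2) * sp\<^sup>2 / (dims 0 * r0\<^sup>2))" if s: "s = 1 \<or> s = - 1" for s
  proof -
    have "measure PG (\<Union>k<m. DS s k) \<le> (\<Sum>k<m. measure PG (DS s k))"
      by (rule measure_UNION_le) auto
    also have "\<dots> \<le> (\<Sum>k<m. 128 * (real m + 2) * sp\<^sup>2 / (dims 0 * r0\<^sup>2))"
      using PD[OF s] by (intro sum_mono) auto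
    finally have "measure PG (\<Union>k<m. DS s k) \<le> m * (128 * (real m + 2) * sp\<^sup>2 / (dims 0 * r0\<^sup>2))" by simp
    moreover have "measure PG (bd s) \<le> measure PG (ES s) + measure PG (\<Union>k<m. DS s k)"
      unfolding bd_def by (rule measure_Un_le) auto
    ultimately show ?thesis using PE[OF s] by linarith
  qed
  define A where "A = space PG - (bd 1 \<union> bd (- 1))"
  have Am: "A \<in> sets PG" unfolding A_def by measurable
  have good: "\<exists>y. s * out y w < 0 \<and> sqrt (dist2 x y) < r0" if w: "w \<in> space PG" "w \<notin> bd s" for w s
  proof -
    have "w \<notin> ES s" using w(2) by (simp add: bd_def)
    then obtain k where k: "k < m" "s * out (X k) w < 0"
      using w(1) by (auto simp: ES_def not_le)
    have "w \<notin> DS s k" using w(2) k(1) by (auto simp: bd_def)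
    then have "(phi s B \<eta> w (X k) - phi s B \<eta> w x)\<^sup>2 < (r0 / 2)\<^sup>2" using w(1) by (simp add: DS_def)
    then have "\<bar>phi s B \<eta> w (X k) - phi s B \<eta> w x\<bar> < r0 / 2"
      using r0 by (intro power2_less_imp_less[of "\<bar>_\<bar>"]) auto
    moreover have "phi s B \<eta> w (X k) \<le> \<eta>"
    proof (rule phi_le[OF B])
      have "sqrt (dist2 (X k) (X k) + \<eta>\<^sup>2) = \<eta>" using eta by (simp add: dist2_def)
      then show "\<eta> \<in> phiset s B \<eta> w (X k)" using k(2) unfolding phiset_def by (auto intro!: exI[of _ "X k"])
    qed
    ultimately have "phi s B \<eta> w x < r0" using r0 \<eta>_def by linarith
    then obtain y where y: "s * out y w < 0" "sqrt (dist2 x y + \<eta>\<^sup>2) < r0"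
      unfolding phi_less_iff[OF B] using r0 by (auto simp: B_def)
    have "sqrt (dist2 x y) \<le> sqrt (dist2 x y + \<eta>\<^sup>2)" by simp
    then show ?thesis using y by (meson le_less_trans)
  qed
  have "measure PG (space PG - A) \<le> measure PG (bd 1 \<union> bd (- 1))"
    by (rule P.finite_measure_mono) (auto simp: A_def)
  also have "\<dots> \<le> measure PG (bd 1) + measure PG (bd (- 1))" by (rule measure_Un_le) auto
  also have "\<dots> \<le> 2 * (q + m * (128 * (real m + 2) * sp\<^sup>2 / (dims 0 * r0\<^sup>2)))"
    using add_mono[OF Pb[of 1] Pb[of "- 1"]] unfolding mult_2 by simp
  finally have "1 - measure PG A \<le> 2 * (q + m * (128 * (real m + 2) * sp\<^sup>2 / (dims 0 * r0\<^sup>2)))"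
    using P.prob_compl[OF Am] by simp
  also have "\<dots> = 2 * q + 256 * m * (real m + 2) * sp\<^sup>2 / (dims 0 * r0\<^sup>2)"
    by (simp add: distrib_left)
  finally have PA: "1 - (2 * q + 256 * m * (real m + 2) * sp\<^sup>2 / (dims 0 * r0\<^sup>2)) \<le> measure PG A" by linarith
  have sub: "\<forall>w\<in>A. \<forall>s\<in>{1, - 1}. \<exists>y. s * out y w < 0 \<and> sqrt (dist2 x y) < r0"
  proof (intro ballI)
    fix w s assume "w \<in> A" "s \<in> {1, - 1 :: real}"
    then have "w \<in> space PG" "w \<notin> bd s" by (auto simp: A_def)
    then show "\<exists>y. s * out y w < 0 \<and> sqrt (dist2 x y) < r0" by (rule good)
  qed
  show ?thesis
    using Am sub PA unfolding q_def by blast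
qed

end

section \<open>Uniform error sequence and choice of parameters\<close>

text \<open>For each \<open>d\<close> the smallest admissible error \<open>1 / (k + 1)\<close> with
  \<open>k \<le> d\<close> is taken. The cutoff makes the maximal \<open>k\<close> exist, and
  \<open>k = 0\<close> is always admissible, with error 1.\<close>

lemma vanishing_sequence:
  assumes ev: "\<And>e::real. 0 < e \<Longrightarrow> \<forall>\<^sub>F d in sequentially. C e d"
    and one: "\<And>d. C 1 d"
  shows "\<exists>eps :: nat \<Rightarrow> real. eps \<longlonglongrightarrow> 0 \<and> (\<forall>d. C (eps d) d \<and> eps d \<le> 1)"
proof -
  define S where "S d = {k. k \<le> d \<and> C (1 / (real k + 1)) d}" for d :: nat
  have fin: "finite (S d)" for d by (rule finite_subset[of _ "{..d}"]) (auto simp: S_def)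
  have S0: "0 \<in> S d" for d using one[of d] by (simp add: S_def)
  define eps where "eps d = 1 / (real (Max (S d)) + 1)" for d
  have "Max (S d) \<in> S d" for d using Max_in[OF fin] S0 by blast
  then have C: "C (eps d) d" for d by (simp add: S_def eps_def)
  have le1: "eps d \<le> 1" for d by (simp add: eps_def)
  have "eps \<longlonglongrightarrow> 0"
  proof (rule LIMSEQ_I)
    fix e :: real assume e: "0 < e"
    obtain k where k: "1 / (real k + 1) < e"
      using reals_Archimedean[OF e] by (auto simp: inverse_eq_divide add.commute)
    have "\<forall>\<^sub>F d in sequentially. C (1 / (real k + 1)) d" by (rule ev) simp
    then obtain D where D: "\<And>d. D \<le> d \<Longrightarrow> C (1 / (real k + 1)) d"
      by (auto simp: eventually_sequentially)
    show "\<exists>no. \<forall>n\<ge>no. norm (eps n - 0) < e"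
    proof (intro exI allI impI)
      fix d assume d: "max D k \<le> d"
      then have "k \<in> S d" using D by (simp add: S_def)
      then have "k \<le> Max (S d)" using Max_ge[OF fin] by blast
      then have "eps d \<le> 1 / (real k + 1)" unfolding eps_def by (intro divide_left_mono) auto
      then show "norm (eps d - 0) < e" using k by (simp add: eps_def)
    qed
  qed
  then show ?thesis using C le1 by blast
qed

definition flip_set ::
  "nat \<Rightarrow> (nat \<Rightarrow> nat) \<Rightarrow> (nat \<Rightarrow> nat) \<Rightarrow> (nat \<Rightarrow> nat) \<Rightarrow> (nat \<Rightarrow> nat) \<Rightarrow> (nat \<Rightarrow> nat \<Rightarrow> real) \<Rightarrow> real \<Rightarrow> ((nat \<times> nat \<times> nat) \<Rightarrow> real) set" where
  "flip_set l dims ns ws ss x0 \<tau> = {wt \<in> space (xavier_measure l dims ws).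
     net_output l dims ws ss (weights_of wt) x0 = 0 \<or>
     (\<exists>x. tnorm (ns 0) (dims 0) (\<lambda>j k. x j k - x0 j k)
            \<le> (\<tau> / sqrt (real (dims 0) - 2) *
                (spnorm (ns 0) (dims 0) x0 / tnorm (ns 0) (dims 0) x0))
              * tnorm (ns 0) (dims 0) x0 \<and>
          sgn (net_output l dims ws ss (weights_of wt) x)
            \<noteq> sgn (net_output l dims ws ss (weights_of wt) x0))}"

text \<open>Architecture, input and \<open>\<tau>\<close> are quantified inside, so that a threshold
  on \<open>d\<close> for this predicate is automatically uniform in them.\<close>

definition flip_bound :: "nat \<Rightarrow> (nat \<Rightarrow> real) \<Rightarrow> real \<Rightarrow> nat \<Rightarrow> bool" where
  "flip_bound l \<psi> e d \<longleftrightarrow> (\<forall>dims ns ws ss R x0 \<tau>. conv_arch l dims ns ws ss \<and> dims 0 = d \<and>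
     (\<forall>v<l. \<psi> d * ln (real (ns 0 * d)) \<le> real (dims v)) \<and>
     0 < R \<and> (\<forall>j<ns 0. sqrt (\<Sum>k<dims 0. (x0 j k)\<^sup>2) = R) \<and> 0 < \<tau> \<and> ln (real d) \<le> \<tau> \<longrightarrow>
     (\<exists>A\<in>sets (xavier_measure l dims ws). A \<subseteq> flip_set l dims ns ws ss x0 \<tau> \<and>
        1 - e \<le> measure (xavier_measure l dims ws) A))"

lemma flip_bound_1: "flip_bound l \<psi> 1 d"
  unfolding flip_bound_def
proof (intro allI impI)
  fix dims ns ws ss R x0 \<tau>
  show "\<exists>A\<in>sets (xavier_measure l dims ws). A \<subseteq> flip_set l dims ns ws ss x0 \<tau> \<and>
        1 - 1 \<le> measure (xavier_measure l dims ws) A"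
    by (rule bexI[of _ "{}"]) auto
qed

text \<open>Each of the four failure terms of \<open>sign_change_prob\<close> receives
  \<open>e / 4\<close>. The parameters are fixed in the order \<open>T\<close>, \<open>m\<close>,
  \<open>\<epsilon>\<close>, \<open>N\<close>, \<open>K2\<close>, each depending only on earlier
  ones, on \<open>e\<close> and on \<open>l\<close>.\<close>

lemma flip_bound_eventually:
  assumes l: "1 \<le> l" and psi: "filterlim \<psi> at_top sequentially" and e: "0 < e"
  shows "\<forall>\<^sub>F d in sequentially. flip_bound l \<psi> e d"
proof -
  define T where "T = 4 / sqrt e"
  have T: "0 < T" "2 * (2 / T\<^sup>2) = e / 4" using e by (simp_all add: T_def power_divide)
  define K where "K = exp (T\<^sup>2 * 4 ^ l / 2)"
  have K: "0 < K" by (simp add: K_def)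
  define m where "m = nat \<lceil>(8 * K / e)\<^sup>2\<rceil> + 1"
  have m: "0 < m" by (simp add: m_def)
  have "(8 * K / e)\<^sup>2 \<le> real m"
    unfolding m_def by (rule order_trans[OF real_nat_ceiling_ge]) simp
  then have "8 * K / e \<le> sqrt m" by (rule real_le_rsqrt)
  then have mK: "2 * (K / sqrt m) \<le> e / 4" using e m by (simp add: field_simps)
  define \<epsilon> where "\<epsilon> = 1 / (2 * real m * 4 ^ l)"
  have eps: "0 < \<epsilon>" "2 * real m * \<epsilon> \<le> 1 / 4 ^ l" using m by (simp_all add: \<epsilon>_def)
  define Q where "Q = real l * (real m)\<^sup>2 * (4 * 3 ^ l / \<epsilon>\<^sup>2)"
  have Q: "0 \<le> Q" by (simp add: Q_def)
  define N where "N = nat \<lceil>8 * Q / e\<rceil> + 1"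
  have N: "0 < N" by (simp add: N_def)
  have "8 * Q / e \<le> real N"
    unfolding N_def by (rule order_trans[OF real_nat_ceiling_ge]) simp
  then have NQ: "2 * (Q / N) \<le> e / 4" using e N by (simp add: field_simps)
  define K2 where "K2 = 1 + 1024 * real m * (real m + 2) / e"
  have K2: "1 \<le> K2" using e by (simp add: K2_def)
  \<comment> \<open>The three lower bounds on \<open>d\<close> give, in turn,
    \<open>K2 \<le> ln d\<close>, positivity of \<open>d - 2\<close>, and enough dimensions for near
    orthogonality.\<close>
  define K3 where "K3 = max (exp K2) (max 3 (6 * (real m + 2) / \<epsilon>\<^sup>2))"
  have "\<forall>\<^sub>F d in sequentially. real N \<le> \<psi> d" using psi by (simp add: filterlim_at_top)
  moreover have "\<forall>\<^sub>F d in sequentially. K3 \<le> real d"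
    using filterlim_real_sequentially by (simp add: filterlim_at_top)
  ultimately show ?thesis
  proof eventually_elim
    case (elim d)
    show ?case unfolding flip_bound_def
    proof (intro allI impI, elim conjE)
      fix dims ns ws ss and R :: real and x0 :: "nat \<Rightarrow> nat \<Rightarrow> real" and \<tau> :: real
      assume arch: "conv_arch l dims ns ws ss" and d: "dims 0 = d"
        and dv: "\<forall>v<l. \<psi> d * ln (real (ns 0 * d)) \<le> real (dims v)"
        and R: "0 < R" and x0: "\<forall>j<ns 0. sqrt (\<Sum>k<dims 0. (x0 j k)\<^sup>2) = R"
        and tau: "0 < \<tau>" "ln (real d) \<le> \<tau>"
      interpret xavier_net l dims ns ws ss by standard (fact l, fact arch)
      have d3: "3 \<le> real d" and dK: "exp K2 \<le> real d" and d6: "6 * (real m + 2) / \<epsilon>\<^sup>2 \<le> real d"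
        using elim(2) by (simp_all add: K3_def)
      have lnd: "K2 \<le> ln (real d)" using dK d3 by (simp add: ln_ge_iff)
      have n: "0 < ns 0" by (rule ns_pos) simp
      \<comment> \<open>Since \<open>ln (n d) \<ge> 1\<close>, the growth assumption on the channels
        already forces width at least \<open>\<psi> d\<close>, hence \<open>N\<close>.\<close>
      have NN: "N \<le> dims v" if "v < l" for v
      proof -
        have "real d \<le> real (ns 0 * d)" using n unfolding of_nat_le_iff by simp
        then have "ln (real d) \<le> ln (real (ns 0 * d))" using d3 n by (subst ln_le_cancel_iff) auto
        then have "1 \<le> ln (real (ns 0 * d))" using lnd K2 by linarith
        then have "real N * 1 \<le> \<psi> d * ln (real (ns 0 * d))" using elim(1) by (intro mult_mono) auto
        also have "\<dots> \<le> real (dims v)" using dv that by simp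
        finally show ?thesis by simp
      qed
      define \<rho> where "\<rho> = R\<^sup>2 / real d"
      have rho: "0 < \<rho>" using R d3 by (simp add: \<rho>_def)
      have sph: "on_sphere \<rho> x0"
        unfolding on_sphere_def
      proof (intro allI impI)
        fix j assume "j < ns 0"
        then have "(sqrt (\<Sum>k<dims 0. (x0 j k)\<^sup>2))\<^sup>2 = R\<^sup>2" using x0 by simp
        then have "(\<Sum>k<dims 0. (x0 j k)\<^sup>2) = R\<^sup>2" by (simp add: sum_nonneg)
        then show "(\<Sum>k<dims 0. (x0 j k)\<^sup>2) / real (dims 0) = \<rho>" by (simp add: \<rho>_def d)
      qed
      define sp where "sp = spnorm (ns 0) (dims 0) x0"
      have sp: "0 < sp" unfolding sp_def by (rule spnorm_pos[OF sph rho])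
      define r0 where "r0 = \<tau> / sqrt (real d - 2) * sp"
      have sq: "0 < sqrt (real d - 2)" using d3 by simp
      have r0: "0 < r0" using tau sp sq by (simp add: r0_def)
      have tn: "0 < tnorm (ns 0) (dims 0) x0"
      proof -
        have "(\<Sum>j<ns 0. \<Sum>k<dims 0. (x0 j k)\<^sup>2) = (\<Sum>j<ns 0. real (dims 0) * \<rho>)"
          by (rule sum.cong[OF refl]) (rule token_norm[OF sph], simp)
        then show ?thesis using n rho d_pos by (simp add: tnorm_def)
      qed
      have rad: "(\<tau> / sqrt (real (dims 0) - 2) * (spnorm (ns 0) (dims 0) x0 / tnorm (ns 0) (dims 0) x0))
              * tnorm (ns 0) (dims 0) x0 = r0"
        using tn by (simp add: r0_def sp_def d)
      have e6: "6 * (real m + 2) \<le> \<epsilon>\<^sup>2 * real (dims 0)"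
        using d6 eps(1) by (simp add: d field_simps)
      obtain A where A: "A \<in> sets PG"
        and good: "\<And>w s. w \<in> A \<Longrightarrow> s \<in> {1, - 1} \<Longrightarrow> \<exists>y. s * out y w < 0 \<and> sqrt (dist2 x0 y) < r0"
        and PA: "1 - (2 * (2 / T\<^sup>2 + exp (T\<^sup>2 * 4 ^ l / 2) / sqrt m + l * m\<^sup>2 * (4 * 3 ^ l / (N * \<epsilon>\<^sup>2)))
            + 256 * m * (real m + 2) * sp\<^sup>2 / (dims 0 * r0\<^sup>2)) \<le> measure PG A"
        using sign_change_prob[OF sph rho r0 m T(1) N NN eps e6] unfolding sp_def by blast
      have term3: "l * m\<^sup>2 * (4 * 3 ^ l / (N * \<epsilon>\<^sup>2)) = Q / N"
        by (simp add: Q_def)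
      \<comment> \<open>The spectral norm cancels against the radius \<open>r0\<close>, leaving at
        most \<open>1 / \<tau>\<^sup>2\<close>; and
        \<open>\<tau> \<ge> ln d \<ge> K2 \<ge> 1\<close> makes this at most
        \<open>1 / K2\<close>.\<close>
      have term4: "256 * m * (real m + 2) * sp\<^sup>2 / (dims 0 * r0\<^sup>2) \<le> e / 4"
      proof -
        have ln1: "1 \<le> ln (real d)" using lnd K2 by linarith
        have "sp\<^sup>2 / (dims 0 * r0\<^sup>2) = (real d - 2) / (real d * \<tau>\<^sup>2)"
          using sp sq tau d3 by (simp add: r0_def d power_mult_distrib power_divide)
        also have "\<dots> \<le> real d / (real d * \<tau>\<^sup>2)"
          using d3 by (intro divide_right_mono) auto
        also have "\<dots> = 1 / \<tau>\<^sup>2" using d3 by simp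
        also have "\<dots> \<le> 1 / K2"
        proof (rule divide_left_mono)
          have "K2 * 1 \<le> \<tau> * \<tau>" using lnd tau ln1 by (intro mult_mono) auto
          then show "K2 \<le> \<tau>\<^sup>2" by (simp add: power2_eq_square)
        qed (use K2 tau in auto)
        finally have "256 * real m * (real m + 2) * (sp\<^sup>2 / (dims 0 * r0\<^sup>2)) \<le> 256 * real m * (real m + 2) * (1 / K2)"
          by (intro mult_left_mono) auto
        also have "\<dots> \<le> e / 4"
        proof -
          have "1024 * real m * (real m + 2) \<le> e * K2" using e by (simp add: K2_def field_simps)
          then show ?thesis using K2 by (simp add: field_simps)
        qed
        finally show ?thesis by simp
      qed
      have "1 - e \<le> measure PG A"
        using PA T(2) mK NQ term4 unfolding term3 K_def[symmetric] distrib_left by linarith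
      moreover have "A \<subseteq> flip_set l dims ns ws ss x0 \<tau>"
      proof
        fix w assume w: "w \<in> A"
        have ws: "w \<in> space PG" using sets.sets_into_space[OF A] w by auto
        have no: "net_output l dims ws ss (weights_of w) x = out x w" for x
          by (simp add: net_output_def out_def H_def)
        have tnd: "tnorm (ns 0) (dims 0) (\<lambda>j k. y j k - x0 j k) = sqrt (dist2 x0 y)" for y
          by (simp add: tnorm_def dist2_def power2_commute)
        have "out x0 w = 0 \<or> (\<exists>y. sqrt (dist2 x0 y) \<le> r0 \<and> sgn (out y w) \<noteq> sgn (out x0 w))"
        proof (cases "out x0 w" "0 :: real" rule: linorder_cases)
          case less
          obtain y where "- 1 * out y w < 0" "sqrt (dist2 x0 y) < r0" using good[OF w, of "- 1"] by auto
          then show ?thesis using less by (intro disjI2 exI[of _ y]) (simp add: sgn_if)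
        next
          case greater
          obtain y where "1 * out y w < 0" "sqrt (dist2 x0 y) < r0" using good[OF w, of 1] by auto
          then show ?thesis using greater by (intro disjI2 exI[of _ y]) (simp add: sgn_if)
        qed simp
        then show "w \<in> flip_set l dims ns ws ss x0 \<tau>"
          unfolding flip_set_def tnd rad xavier_eq using ws by (simp add: no)
      qed
      ultimately show "\<exists>A\<in>sets (xavier_measure l dims ws). A \<subseteq> flip_set l dims ns ws ss x0 \<tau> \<and>
        1 - e \<le> measure (xavier_measure l dims ws) A"
        using A unfolding xavier_eq by blast
    qed
  qed
qed

lemma flip_probability:
  assumes l: "1 \<le> l" and psi: "filterlim \<psi> at_top sequentially"
  shows "\<exists>eps :: nat \<Rightarrow> real. eps \<longlonglongrightarrow> 0 \<and>
     (\<forall>dims ns ws ss R x0 \<tau>. conv_arch l dims ns ws ss \<and>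
        (\<forall>v<l. \<psi> (dims 0) * ln (real (ns 0 * dims 0)) \<le> real (dims v)) \<and>
        0 < R \<and> (\<forall>j<ns 0. sqrt (\<Sum>k<dims 0. (x0 j k)\<^sup>2) = R) \<and> 0 < \<tau> \<longrightarrow>
        (\<exists>A \<in> sets (xavier_measure l dims ws). A \<subseteq> flip_set l dims ns ws ss x0 \<tau> \<and>
           (1 - eps (dims 0)) * (1 - 2 * exp (- (1 / 2) * \<tau>\<^sup>2 / (ln (real (dims 0)))\<^sup>2))
             \<le> measure (xavier_measure l dims ws) A))"
proof -
  obtain eps :: "nat \<Rightarrow> real" where eps: "eps \<longlonglongrightarrow> 0" "\<And>d. flip_bound l \<psi> (eps d) d" "\<And>d. eps d \<le> 1"
    using vanishing_sequence[of "flip_bound l \<psi>", OF flip_bound_eventually[OF l psi] flip_bound_1] by blast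
  show ?thesis
  proof (intro exI[of _ eps] conjI allI impI, rule eps(1), elim conjE)
    fix dims ns ws ss and R :: real and x0 :: "nat \<Rightarrow> nat \<Rightarrow> real" and \<tau> :: real
    assume arch: "conv_arch l dims ns ws ss"
      and dv: "\<forall>v<l. \<psi> (dims 0) * ln (real (ns 0 * dims 0)) \<le> real (dims v)"
      and R: "0 < R" and x0: "\<forall>j<ns 0. sqrt (\<Sum>k<dims 0. (x0 j k)\<^sup>2) = R" and tau: "0 < \<tau>"
    let ?d = "dims 0"
    let ?p = "1 - 2 * exp (- (1 / 2) * \<tau>\<^sup>2 / (ln (real ?d))\<^sup>2)"
    have e0: "0 \<le> 1 - eps ?d" using eps(3)[of ?d] by simp
    show "\<exists>A \<in> sets (xavier_measure l dims ws). A \<subseteq> flip_set l dims ns ws ss x0 \<tau> \<and>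
         (1 - eps ?d) * ?p \<le> measure (xavier_measure l dims ws) A"
    proof (cases "ln (real ?d) \<le> \<tau>")
      case True
      then obtain A where A: "A \<in> sets (xavier_measure l dims ws)" "A \<subseteq> flip_set l dims ns ws ss x0 \<tau>"
        "1 - eps ?d \<le> measure (xavier_measure l dims ws) A"
        using eps(2)[of ?d, unfolded flip_bound_def, rule_format, of dims ns ws ss R x0 \<tau>] arch dv R x0 tau by auto
      \<comment> \<open>The factor \<open>?p\<close> is at most 1 for every \<open>d\<close>,
        including \<open>d = 1\<close>, where division by \<open>ln 1 = 0\<close> yields 0.\<close>
      have "(1 - eps ?d) * ?p \<le> (1 - eps ?d) * 1" using e0 by (intro mult_left_mono) auto
      then show ?thesis using A by (intro bexI[of _ A]) auto
    next
      case False
      then have ln: "0 < ln (real ?d)" "\<tau> < ln (real ?d)" using tau by auto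
      have "\<tau>\<^sup>2 \<le> (ln (real ?d))\<^sup>2" using ln tau by (intro power_mono) auto
      then have "\<tau>\<^sup>2 / (ln (real ?d))\<^sup>2 \<le> 1" using ln by (simp add: divide_le_eq_1)
      then have "- (1 / 2) \<le> - (1 / 2) * \<tau>\<^sup>2 / (ln (real ?d))\<^sup>2" by simp
      then have "exp (- (1 / 2)) \<le> exp (- (1 / 2) * \<tau>\<^sup>2 / (ln (real ?d))\<^sup>2)" by simp
      \<comment> \<open>The constant \<open>1 / 2\<close> comes from here:
        \<open>exp (- 1 / 2) \<ge> 1 / 2\<close> makes the claimed probability nonpositive, and the
        empty event suffices.\<close>
      moreover have "1 + (- (1 / 2)) \<le> exp (- (1 / 2) :: real)" by (rule exp_ge_add_one_self)
      ultimately have "?p \<le> 0" by linarith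
      then have "(1 - eps ?d) * ?p \<le> 0" using e0 by (rule mult_nonneg_nonpos[rotated])
      then show ?thesis by (intro bexI[of _ "{}"]) auto
    qed
  qed
qed

text \<open>The constant \<open>c = 1 / 2\<close> serves every depth, while \<open>eps\<close> is
  chosen from \<open>l\<close> and \<open>\<psi>\<close> before architecture, input and
  \<open>\<tau>\<close>. A measurable subset of the event is exhibited since the event itself
  quantifies over uncountably many inputs.\<close>

theorem theorem2:
  fixes l :: nat
  assumes "1 \<le> l"
  shows "\<exists>c>0. \<forall>\<psi> :: nat \<Rightarrow> real. filterlim \<psi> at_top sequentially \<longrightarrow>
   (\<exists>eps :: nat \<Rightarrow> real. eps \<longlonglongrightarrow> 0 \<and>
     (\<forall>dims ns ws ss. conv_arch l dims ns ws ss \<and>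
        (\<forall>v<l. \<psi> (dims 0) * ln (real (ns 0 * dims 0)) \<le> real (dims v)) \<longrightarrow>
      (\<forall>(R::real) (x0 :: nat \<Rightarrow> nat \<Rightarrow> real) (\<tau>::real).
         0 < R \<and> (\<forall>j<ns 0. sqrt (\<Sum>k<dims 0. (x0 j k)\<^sup>2) = R) \<and> 0 < \<tau> \<longrightarrow>
        (\<exists>A \<in> sets (xavier_measure l dims ws).
           A \<subseteq> {wt \<in> space (xavier_measure l dims ws).
                 net_output l dims ws ss (weights_of wt) x0 = 0 \<or>
                 (\<exists>x. tnorm (ns 0) (dims 0) (\<lambda>j k. x j k - x0 j k)
                        \<le> (\<tau> / sqrt (real (dims 0) - 2) *
                            (spnorm (ns 0) (dims 0) x0 / tnorm (ns 0) (dims 0) x0))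
                          * tnorm (ns 0) (dims 0) x0 \<and>
                      sgn (net_output l dims ws ss (weights_of wt) x)
                        \<noteq> sgn (net_output l dims ws ss (weights_of wt) x0))} \<and>
           (1 - eps (dims 0)) * (1 - 2 * exp (- c * \<tau>\<^sup>2 / (ln (real (dims 0)))\<^sup>2))
             \<le> measure (xavier_measure l dims ws) A))))"
  unfolding flip_set_def[symmetric]
  by (rule exI[of _ "1 / 2"], rule conjI, simp, intro allI impI)
     (drule flip_probability[OF assms], elim exE conjE, intro exI conjI allI impI, assumption, elim conjE, blast)

end
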